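(* Let $(A,D)$ be a Cartan pair with $A$ separable, and let $q\colon\Sigma\to G$ be the associated twist, so that $G$ is a second countable topologically principal locally compact Hausdorff étale groupoid and $(A,D)$ is identified with $(C^*_{\lambda}(\Sigma),C_0(G^{(0)}))$. Assume that $G=S\ltimes_{\alpha}X$ for some strongly tight action $\alpha\colon S\curvearrowright X$ of an inverse semigroup $S$ (with zero) on a locally compact Hausdorff space $X$. Then the map $$T\mapsto C^*_{\lambda}(\Sigma_{T\ltimes_{\alpha}X})$$ is a one-to-one correspondence between the set of $\alpha$-join closed wide subsemigroups $T$ of $S$ and the set of Cartan intermediate subalgebras $D\subset B\subset A$.
   Context: Inverse semigroups and actions. An inverse semigroup is a semigroup $S$ such that every $s\in S$ has a unique $s^*$ with $s=ss^*s$, $s^*=s^*ss^*$; all inverse semigroups have a zero $0$. $E(S)$ is the set of idempotents. A subsemigroup is a subset closed under products and $s\mapsto s^*$; it is wide if it contains $E(S)$. For a topological space $X$, $I_X$ is the inverse semigroup of homeomorphisms between open subsets of $X$. An action $\alpha\colon S\curvearrowright X$ is a semigroup homomorphism $s\mapsto\alpha_s\in I_X$ with $\bigcup_{e\in E(S)}\operatorname{dom}(\alpha_e)=X$ and $\operatorname{dom}(\alpha_0)=\emptyset$; $D_e:=\operatorname{dom}(\alpha_e)$ for $e\in E(S)$, so $\alpha_s\colon D_{s^*s}\to D_{ss^*}$. It is strongly tight if every $D_e$ is compact and $\{D_e\}_{e\in E(S)}$ is a basis of $X$. A wide subsemigroup $T\subset S$ is $\alpha$-join closed if for every $s\in S$: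 $s\in T$ iff there is a finite $F\subset E(S)$ with $sf\in T$ for all $f\in F$ and $D_{s^*s}\subset\bigcup_{f\in F}D_f$. $S\ltimes_{\alpha}X$ is the étale groupoid of classes $[s,x]$ ($s\in S$, $x\in D_{s^*s}$), with $[s,x]=[t,y]$ iff $x=y$ and $se=te$ for some $e\in E(S)$ with $x\in D_e$; unit space $X$ ($x=[e,x]$ for $x\in D_e$), $d([s,x])=x$, $r([s,x])=\alpha_s(x)$, $[s,\alpha_t(x)][t,x]=[st,x]$, $[s,x]^{-1}=[s^*,\alpha_s(x)]$, topology with basis the sets $[s,U]=\{[s,x]\mid x\in U\}$, $U\subset D_{s^*s}$ open. For a wide subsemigroup $T\subset S$, $T\ltimes_{\alpha}X$ is identified with the wide open subgroupoid $\{[t,x]\mid t\in T,x\in D_{t^*t}\}$ of $S\ltimes_\alpha X$. Cartan pairs. A commutative C*-subalgebra $D$ of a C*-algebra $A$ is a Cartan subalgebra, and $(A,D)$ is a Cartan pair, if: (1) $D$ contains an approximate unit for $A$; (2) the normalizers, i.e. the $n\in A$ with $nDn^*\cup n^*Dn\subset D$, generate $A$ as a C*-algebra; (3) there is a faithful conditional expectation $A\to D$; (4) $D'=D$, where $D'=\{a\in A\mid da=ad\ \forall d\in D\}$. A C*-subalgebra $D\subset B\subset A$ is a Cartan intermediate subalgebra if $D$ is a Cartan subalgebra of $B$. Twists. A twist over a locally compact Hausdorff étale groupoid $G$ is a locally compact Hausdorff topological groupoid $\Sigma$ with a central extension $G^{(0)}\times\mathbb{T}\hookrightarrow\Sigma\overset{q}{\twoheadrightarrow}G$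 ($\mathbb{T}$ the circle group): the first map is a homeomorphic homomorphism onto $q^{-1}(G^{(0)})$ with central image, so that $\mathbb{T}$ acts on $\Sigma$, and $q$ is a continuous open surjective homomorphism, admitting local continuous sections, whose fibres are the $\mathbb{T}$-orbits. The reduced C*-algebra $C^*_{\lambda}(\Sigma)$ is the completion, in the norm given by the regular representations at the points $x\in G^{(0)}$ (on the Hilbert spaces of $\mathbb{T}$-equivariant functions on $\{\sigma\in\Sigma\mid d(\sigma)=x\}$ that are square-summable over $\{\gamma\in G\mid d(\gamma)=x\}$), of the $*$-algebra of compactly supported continuous $f\colon\Sigma\to\mathbb{C}$ with $f(z\sigma)=zf(\sigma)$ for $z\in\mathbb{T}$, with $(f*g)(\sigma)=\sum_{\gamma\in G,\,d(\gamma)=d(\sigma)}f(\sigma\tilde\gamma^{-1})g(\tilde\gamma)$ ($\tilde\gamma\in q^{-1}(\gamma)$ arbitrary) and $f^*(\sigma)=\overline{f(\sigma^{-1})}$. It contains $C_0(G^{(0)})$ as the closure of the functions supported in $q^{-1}(G^{(0)})$. For a wide open subgroupoid $H\subset G$, $\Sigma_H:=q^{-1}(H)$ is a twist over $H$, and extension of functions by zero gives a natural inclusion $C^*_{\lambda}(\Sigma_H)\subset C^*_{\lambda}(\Sigma)$. $G$ is topologically principal if the set of $x\in G^{(0)}$ with trivial isotropy group $\{\gamma\in G\mid d(\gamma)=r(\gamma)=x\}=\{x\}$ is dense in $G^{(0)}$. By Renault's theorem, every Cartan pair $(A,D)$ with $A$ separable has an associated twist $q\colon\Sigma\to G$, unique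 up to isomorphism, with $G$ second countable, topologically principal, locally compact Hausdorff and étale, and an isomorphism $A\cong C^*_{\lambda}(\Sigma)$ carrying $D$ onto $C_0(G^{(0)})$; $A$ and $D$ are identified with these algebras. *)

theory Defs
  imports "HOL-Analysis.Analysis"
begin

section \<open>Inverse semigroups and their actions\<close>

class inverse_semigroup_0 = semigroup_mult + mult_zero +
  assumes ex1_generalized_inverse: "\<exists>!t. s * t * s = s \<and> t * s * t = t"

definition istar :: "'s::inverse_semigroup_0 \<Rightarrow> 's" where
  "istar s = (THE t. s * t * s = s \<and> t * s * t = t)"

definition idempotents :: "'s::inverse_semigroup_0 set" where
  "idempotents = {e. e * e = e}"

definition wide_subsemigroup :: "'s::inverse_semigroup_0 set \<Rightarrow> bool" where
  "wide_subsemigroup T \<longleftrightarrow>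
     (\<forall>s\<in>T. \<forall>t\<in>T. s * t \<in> T) \<and> (\<forall>s\<in>T. istar s \<in> T) \<and> idempotents \<subseteq> T"

text \<open>
  The inverse semigroup of partial homeomorphisms of \<open>X\<close>. Partial maps are modelled by
  \<^typ>\<open>'x \<rightharpoonup> 'x\<close>, so that the product is composition \<open>\<circ>\<^sub>m\<close> of partial maps.
\<close>

definition partial_homeomorphisms :: "'x topology \<Rightarrow> ('x \<rightharpoonup> 'x) set" where
  "partial_homeomorphisms X = {f. openin X (dom f) \<and> openin X (ran f) \<and>
     homeomorphic_map (subtopology X (dom f)) (subtopology X (ran f)) (\<lambda>x. the (f x))}"

definition semigroup_action ::
    "'x topology \<Rightarrow> ('s::inverse_semigroup_0 \<Rightarrow> 'x \<rightharpoonup> 'x) \<Rightarrow> bool" where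
  "semigroup_action X \<alpha> \<longleftrightarrow>
     (\<forall>s. \<alpha> s \<in> partial_homeomorphisms X) \<and>
     (\<forall>s t. \<alpha> (s * t) = \<alpha> s \<circ>\<^sub>m \<alpha> t) \<and>
     (\<Union>e\<in>idempotents. dom (\<alpha> e)) = topspace X \<and>
     dom (\<alpha> 0) = {}"

definition topology_basis :: "'x topology \<Rightarrow> 'x set set \<Rightarrow> bool" where
  "topology_basis X \<B> \<longleftrightarrow>
     (\<forall>V\<in>\<B>. openin X V) \<and> (\<forall>U x. openin X U \<and> x \<in> U \<longrightarrow> (\<exists>V\<in>\<B>. x \<in> V \<and> V \<subseteq> U))"

definition strongly_tight ::
    "'x topology \<Rightarrow> ('s::inverse_semigroup_0 \<Rightarrow> 'x \<rightharpoonup> 'x) \<Rightarrow> bool" where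
  "strongly_tight X \<alpha> \<longleftrightarrow>
     (\<forall>e\<in>idempotents. compactin X (dom (\<alpha> e))) \<and>
     topology_basis X ((\<lambda>e. dom (\<alpha> e)) ` idempotents)"

definition join_closed ::
    "('s::inverse_semigroup_0 \<Rightarrow> 'x \<rightharpoonup> 'x) \<Rightarrow> 's set \<Rightarrow> bool" where
  "join_closed \<alpha> T \<longleftrightarrow>
     (\<forall>s. s \<in> T \<longleftrightarrow>
        (\<exists>F. finite F \<and> F \<subseteq> idempotents \<and> (\<forall>f\<in>F. s * f \<in> T) \<and>
             dom (\<alpha> (istar s * s)) \<subseteq> (\<Union>f\<in>F. dom (\<alpha> f))))"

section \<open>Topological groupoids\<close>

text \<open>
  The arrows are the points of the topology; a unit is identified with its identity arrow, so
  the domain and range maps take values in the arrows. The operations are unspecified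
  outside the arrows (for the product: outside the composable pairs).
\<close>

record 'g tgroupoid =
  gtop :: "'g topology"
  gdom :: "'g \<Rightarrow> 'g"
  gran :: "'g \<Rightarrow> 'g"
  gmult :: "'g \<Rightarrow> 'g \<Rightarrow> 'g"
  ginv :: "'g \<Rightarrow> 'g"

abbreviation arrows :: "('g, 'm) tgroupoid_scheme \<Rightarrow> 'g set" where
  "arrows G \<equiv> topspace (gtop G)"

definition units :: "('g, 'm) tgroupoid_scheme \<Rightarrow> 'g set" where
  "units G = gdom G ` arrows G"

definition composable :: "('g, 'm) tgroupoid_scheme \<Rightarrow> ('g \<times> 'g) set" where
  "composable G = {(g, h). g \<in> arrows G \<and> h \<in> arrows G \<and> gdom G g = gran G h}"

definition is_groupoid :: "('g, 'm) tgroupoid_scheme \<Rightarrow> bool" where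
  "is_groupoid G \<longleftrightarrow>
     (\<forall>g\<in>arrows G. gdom G g \<in> arrows G \<and> gran G g \<in> arrows G \<and> ginv G g \<in> arrows G) \<and>
     (\<forall>g\<in>arrows G. gdom G (gdom G g) = gdom G g \<and> gran G (gdom G g) = gdom G g \<and>
                   gdom G (gran G g) = gran G g \<and> gran G (gran G g) = gran G g) \<and>
     (\<forall>(g, h)\<in>composable G. gmult G g h \<in> arrows G \<and>
        gdom G (gmult G g h) = gdom G h \<and> gran G (gmult G g h) = gran G g) \<and>
     (\<forall>g h k. (g, h) \<in> composable G \<and> (h, k) \<in> composable G \<longrightarrow>
        gmult G (gmult G g h) k = gmult G g (gmult G h k)) \<and>
     (\<forall>g\<in>arrows G. gmult G g (gdom G g) = g \<and> gmult G (gran G g) g = g) \<and>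
     (\<forall>g\<in>arrows G. gdom G (ginv G g) = gran G g \<and> gran G (ginv G g) = gdom G g \<and>
        gmult G (ginv G g) g = gdom G g \<and> gmult G g (ginv G g) = gran G g)"

definition topological_groupoid :: "('g, 'm) tgroupoid_scheme \<Rightarrow> bool" where
  "topological_groupoid G \<longleftrightarrow> is_groupoid G \<and>
     continuous_map (subtopology (prod_topology (gtop G) (gtop G)) (composable G)) (gtop G)
       (\<lambda>(g, h). gmult G g h) \<and>
     continuous_map (gtop G) (gtop G) (ginv G)"

definition lch_groupoid :: "('g, 'm) tgroupoid_scheme \<Rightarrow> bool" where
  "lch_groupoid G \<longleftrightarrow>
     topological_groupoid G \<and> locally_compact_space (gtop G) \<and> Hausdorff_space (gtop G)"

definition etale :: "('g, 'm) tgroupoid_scheme \<Rightarrow> bool" where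
  "etale G \<longleftrightarrow> (\<forall>g\<in>arrows G. \<exists>U. openin (gtop G) U \<and> g \<in> U \<and>
     openin (subtopology (gtop G) (units G)) (gdom G ` U) \<and>
     homeomorphic_map (subtopology (gtop G) U) (subtopology (gtop G) (gdom G ` U)) (gdom G))"

definition topologically_principal :: "('g, 'm) tgroupoid_scheme \<Rightarrow> bool" where
  "topologically_principal G \<longleftrightarrow>
     (subtopology (gtop G) (units G)) closure_of
       {x \<in> units G. {g \<in> arrows G. gdom G g = x \<and> gran G g = x} = {x}} = units G"

definition restrict_groupoid :: "'g tgroupoid \<Rightarrow> 'g set \<Rightarrow> 'g tgroupoid" where
  "restrict_groupoid G H = G\<lparr>gtop := subtopology (gtop G) H\<rparr>"

subsection \<open>The groupoid of germs of an action\<close>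

definition germ ::
    "('s::inverse_semigroup_0 \<Rightarrow> 'x \<rightharpoonup> 'x) \<Rightarrow> 's \<Rightarrow> 'x \<Rightarrow> ('s \<times> 'x) set" where
  "germ \<alpha> s x = {(t, y). y \<in> dom (\<alpha> (istar t * t)) \<and> x = y \<and>
     (\<exists>e\<in>idempotents. x \<in> dom (\<alpha> e) \<and> s * e = t * e)}"

definition germ_rep :: "('s \<times> 'x) set \<Rightarrow> 's \<times> 'x" where
  "germ_rep g = (SOME p. p \<in> g)"

text \<open>
  The sets \<open>[s,U]\<close> used below are a basis, not merely a subbasis, of the topology they
  generate. A unit \<open>x\<close> of the transformation groupoid is the germ \<open>[e,x]\<close>, for any idempotent
  \<open>e\<close> with \<open>x\<close> in its domain.
\<close>

definition transformation_groupoid ::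
    "'x topology \<Rightarrow> ('s::inverse_semigroup_0 \<Rightarrow> 'x \<rightharpoonup> 'x) \<Rightarrow> ('s \<times> 'x) set tgroupoid" where
  "transformation_groupoid X \<alpha> =
     \<lparr> gtop = topology_generated_by
         {germ \<alpha> s ` U |s U. openin X U \<and> U \<subseteq> dom (\<alpha> (istar s * s))},
       gdom = (\<lambda>g. case germ_rep g of (s, x) \<Rightarrow> germ \<alpha> (istar s * s) x),
       gran = (\<lambda>g. case germ_rep g of (s, x) \<Rightarrow> germ \<alpha> (s * istar s) (the (\<alpha> s x))),
       gmult = (\<lambda>g h. case germ_rep g of (s, y) \<Rightarrow> case germ_rep h of (t, x) \<Rightarrow>
                        germ \<alpha> (s * t) x),
       ginv = (\<lambda>g. case germ_rep g of (s, x) \<Rightarrow> germ \<alpha> (istar s) (the (\<alpha> s x))) \<rparr>"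

definition transformation_subgroupoid ::
    "('s::inverse_semigroup_0 \<Rightarrow> 'x \<rightharpoonup> 'x) \<Rightarrow> 's set \<Rightarrow> ('s \<times> 'x) set set" where
  "transformation_subgroupoid \<alpha> T = {germ \<alpha> t x |t x. t \<in> T \<and> x \<in> dom (\<alpha> (istar t * t))}"

section \<open>C*-algebras and Cartan pairs\<close>

class cstar_algebra = real_normed_algebra + banach +
  fixes scaleC :: "complex \<Rightarrow> 'a \<Rightarrow> 'a"
    and star :: "'a \<Rightarrow> 'a"
  assumes scaleC_of_real: "scaleC (complex_of_real r) a = r *\<^sub>R a"
    and scaleC_add_left: "scaleC (c + c') a = scaleC c a + scaleC c' a"
    and scaleC_add_right: "scaleC c (a + b) = scaleC c a + scaleC c b"
    and scaleC_scaleC: "scaleC c (scaleC c' a) = scaleC (c * c') a"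
    and scaleC_mult_left: "scaleC c a * b = scaleC c (a * b)"
    and scaleC_mult_right: "a * scaleC c b = scaleC c (a * b)"
    and norm_scaleC: "norm (scaleC c a) = cmod c * norm a"
    and star_star: "star (star a) = a"
    and star_add: "star (a + b) = star a + star b"
    and star_scaleC: "star (scaleC c a) = scaleC (cnj c) (star a)"
    and star_mult: "star (a * b) = star b * star a"
    and cstar_identity: "norm (star a * a) = norm a ^ 2"

definition cstar_subalgebra :: "'a::cstar_algebra set \<Rightarrow> bool" where
  "cstar_subalgebra B \<longleftrightarrow> 0 \<in> B \<and> closed B \<and>
     (\<forall>a\<in>B. \<forall>b\<in>B. a + b \<in> B \<and> a * b \<in> B) \<and>
     (\<forall>c. \<forall>a\<in>B. scaleC c a \<in> B) \<and> (\<forall>a\<in>B. star a \<in> B)"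

definition cstar_positive :: "'a::cstar_algebra \<Rightarrow> bool" where
  "cstar_positive a \<longleftrightarrow> (\<exists>b. a = star b * b)"

text \<open>Nets are expressed by proper filters.\<close>

definition contains_approximate_unit ::
    "'a::cstar_algebra set \<Rightarrow> 'a set \<Rightarrow> bool" where
  "contains_approximate_unit D B \<longleftrightarrow>
     (\<exists>\<F>. \<F> \<noteq> bot \<and> (\<forall>\<^sub>F u in \<F>. u \<in> D \<and> cstar_positive u \<and> norm u \<le> 1) \<and>
        (\<forall>b\<in>B. ((\<lambda>u. u * b) \<longlongrightarrow> b) \<F> \<and> ((\<lambda>u. b * u) \<longlongrightarrow> b) \<F>))"

definition normalizers :: "'a::cstar_algebra set \<Rightarrow> 'a set \<Rightarrow> 'a set" where
  "normalizers B D = {n \<in> B. \<forall>d\<in>D. n * d * star n \<in> D \<and> star n * d * n \<in> D}"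

definition conditional_expectation ::
    "'a::cstar_algebra set \<Rightarrow> 'a set \<Rightarrow> ('a \<Rightarrow> 'a) \<Rightarrow> bool" where
  "conditional_expectation B D P \<longleftrightarrow>
     (\<forall>a\<in>B. P a \<in> D) \<and> (\<forall>d\<in>D. P d = d) \<and>
     (\<forall>a\<in>B. \<forall>b\<in>B. P (a + b) = P a + P b) \<and>
     (\<forall>c. \<forall>a\<in>B. P (scaleC c a) = scaleC c (P a)) \<and>
     (\<forall>a\<in>B. \<forall>d\<in>D. P (d * a) = d * P a \<and> P (a * d) = P a * d) \<and>
     (\<forall>a\<in>B. cstar_positive (P (star a * a))) \<and>
     (\<forall>a\<in>B. norm (P a) \<le> norm a)"

definition faithful_on :: "'a::cstar_algebra set \<Rightarrow> ('a \<Rightarrow> 'a) \<Rightarrow> bool" where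
  "faithful_on B P \<longleftrightarrow> (\<forall>a\<in>B. P (star a * a) = 0 \<longrightarrow> a = 0)"

text \<open>The algebra of a Cartan pair is a C*-subalgebra of an ambient C*-algebra, possibly all of it.\<close>

definition cartan_pair :: "'a::cstar_algebra set \<Rightarrow> 'a set \<Rightarrow> bool" where
  "cartan_pair B D \<longleftrightarrow>
     cstar_subalgebra B \<and> cstar_subalgebra D \<and> D \<subseteq> B \<and> (\<forall>a\<in>D. \<forall>b\<in>D. a * b = b * a) \<and>
     contains_approximate_unit D B \<and>
     cstar_subalgebra hull (normalizers B D) = B \<and>
     (\<exists>P. conditional_expectation B D P \<and> faithful_on B P) \<and>
     {a \<in> B. \<forall>d\<in>D. d * a = a * d} = D"

definition cartan_intermediate ::
    "'a::cstar_algebra set \<Rightarrow> 'a set \<Rightarrow> 'a set \<Rightarrow> bool" where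
  "cartan_intermediate A D B \<longleftrightarrow> cstar_subalgebra B \<and> D \<subseteq> B \<and> B \<subseteq> A \<and> cartan_pair B D"

section \<open>Twists and their reduced C*-algebras\<close>

record ('e, 'g) twist_data =
  total :: "'e tgroupoid"
  base :: "'g tgroupoid"
  incl :: "'g \<times> complex \<Rightarrow> 'e"
  proj :: "'e \<Rightarrow> 'g"

abbreviation circle :: "complex set" where
  "circle \<equiv> sphere 0 1"

definition preimage :: "('e, 'g) twist_data \<Rightarrow> 'g set \<Rightarrow> 'e set" where
  "preimage \<Sigma> H = {\<sigma> \<in> arrows (total \<Sigma>). proj \<Sigma> \<sigma> \<in> H}"

definition circle_act :: "('e, 'g) twist_data \<Rightarrow> complex \<Rightarrow> 'e \<Rightarrow> 'e" where
  "circle_act \<Sigma> z \<sigma> = gmult (total \<Sigma>) (incl \<Sigma> (gran (base \<Sigma>) (proj \<Sigma> \<sigma>), z)) \<sigma>"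

definition central_inclusion :: "('e, 'g) twist_data \<Rightarrow> bool" where
  "central_inclusion \<Sigma> \<longleftrightarrow>
     homeomorphic_map
       (prod_topology (subtopology (gtop (base \<Sigma>)) (units (base \<Sigma>))) (top_of_set circle))
       (subtopology (gtop (total \<Sigma>)) (preimage \<Sigma> (units (base \<Sigma>)))) (incl \<Sigma>) \<and>
     (\<forall>x\<in>units (base \<Sigma>). \<forall>z\<in>circle.
        gdom (total \<Sigma>) (incl \<Sigma> (x, z)) = incl \<Sigma> (x, 1) \<and>
        gran (total \<Sigma>) (incl \<Sigma> (x, z)) = incl \<Sigma> (x, 1) \<and>
        proj \<Sigma> (incl \<Sigma> (x, z)) = x \<and>
        (\<forall>w\<in>circle. gmult (total \<Sigma>) (incl \<Sigma> (x, z)) (incl \<Sigma> (x, w)) = incl \<Sigma> (x, z * w))) \<and>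
     (\<forall>\<sigma>\<in>arrows (total \<Sigma>). \<forall>z\<in>circle.
        gmult (total \<Sigma>) (incl \<Sigma> (gran (base \<Sigma>) (proj \<Sigma> \<sigma>), z)) \<sigma> =
        gmult (total \<Sigma>) \<sigma> (incl \<Sigma> (gdom (base \<Sigma>) (proj \<Sigma> \<sigma>), z)))"

definition twist_projection :: "('e, 'g) twist_data \<Rightarrow> bool" where
  "twist_projection \<Sigma> \<longleftrightarrow>
     continuous_map (gtop (total \<Sigma>)) (gtop (base \<Sigma>)) (proj \<Sigma>) \<and>
     open_map (gtop (total \<Sigma>)) (gtop (base \<Sigma>)) (proj \<Sigma>) \<and>
     proj \<Sigma> ` arrows (total \<Sigma>) = arrows (base \<Sigma>) \<and>
     (\<forall>\<sigma>\<in>arrows (total \<Sigma>).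
        proj \<Sigma> (gdom (total \<Sigma>) \<sigma>) = gdom (base \<Sigma>) (proj \<Sigma> \<sigma>) \<and>
        proj \<Sigma> (gran (total \<Sigma>) \<sigma>) = gran (base \<Sigma>) (proj \<Sigma> \<sigma>)) \<and>
     (\<forall>(\<sigma>, \<tau>)\<in>composable (total \<Sigma>).
        proj \<Sigma> (gmult (total \<Sigma>) \<sigma> \<tau>) = gmult (base \<Sigma>) (proj \<Sigma> \<sigma>) (proj \<Sigma> \<tau>)) \<and>
     (\<forall>g\<in>arrows (base \<Sigma>). \<exists>U k. openin (gtop (base \<Sigma>)) U \<and> g \<in> U \<and>
        continuous_map (subtopology (gtop (base \<Sigma>)) U) (gtop (total \<Sigma>)) k \<and>
        (\<forall>h\<in>U. proj \<Sigma> (k h) = h)) \<and>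
     (\<forall>\<sigma>\<in>arrows (total \<Sigma>). \<forall>\<tau>\<in>arrows (total \<Sigma>).
        proj \<Sigma> \<sigma> = proj \<Sigma> \<tau> \<longleftrightarrow> (\<exists>z\<in>circle. \<tau> = circle_act \<Sigma> z \<sigma>))"

definition twist :: "('e, 'g) twist_data \<Rightarrow> bool" where
  "twist \<Sigma> \<longleftrightarrow> lch_groupoid (base \<Sigma>) \<and> etale (base \<Sigma>) \<and> lch_groupoid (total \<Sigma>) \<and>
     central_inclusion \<Sigma> \<and> twist_projection \<Sigma>"

definition restrict_twist :: "('e, 'g) twist_data \<Rightarrow> 'g set \<Rightarrow> ('e, 'g) twist_data" where
  "restrict_twist \<Sigma> H =
     \<Sigma>\<lparr>total := restrict_groupoid (total \<Sigma>) (preimage \<Sigma> H), base := restrict_groupoid (base \<Sigma>) H\<rparr>"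

subsection \<open>The convolution algebra\<close>

text \<open>
  Functions on (a subset of) the total groupoid are extended by zero to the whole type. In
  particular, extending functions by zero from the restriction of a twist to an open
  subgroupoid does not change their representation.
\<close>

definition equivariant_on :: "('e, 'g) twist_data \<Rightarrow> 'e set \<Rightarrow> ('e \<Rightarrow> complex) \<Rightarrow> bool" where
  "equivariant_on \<Sigma> Y f \<longleftrightarrow>
     (\<forall>\<sigma>\<in>Y. \<forall>z\<in>circle. f (circle_act \<Sigma> z \<sigma>) = z * f \<sigma>) \<and> (\<forall>\<sigma>. \<sigma> \<notin> Y \<longrightarrow> f \<sigma> = 0)"

definition Cc :: "('e, 'g) twist_data \<Rightarrow> ('e \<Rightarrow> complex) set" where
  "Cc \<Sigma> = {f. continuous_map (gtop (total \<Sigma>)) euclidean f \<and>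
     compactin (gtop (total \<Sigma>)) (gtop (total \<Sigma>) closure_of {\<sigma>. f \<sigma> \<noteq> 0}) \<and>
     equivariant_on \<Sigma> (arrows (total \<Sigma>)) f}"

definition lift :: "('e, 'g) twist_data \<Rightarrow> 'g \<Rightarrow> 'e" where
  "lift \<Sigma> \<gamma> = (SOME \<tau>. \<tau> \<in> arrows (total \<Sigma>) \<and> proj \<Sigma> \<tau> = \<gamma>)"

definition source_fibre :: "('e, 'g) twist_data \<Rightarrow> 'g \<Rightarrow> 'g set" where
  "source_fibre \<Sigma> x = {\<gamma> \<in> arrows (base \<Sigma>). gdom (base \<Sigma>) \<gamma> = x}"

definition convolution ::
    "('e, 'g) twist_data \<Rightarrow> ('e \<Rightarrow> complex) \<Rightarrow> ('e \<Rightarrow> complex) \<Rightarrow> 'e \<Rightarrow> complex" where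
  "convolution \<Sigma> f g \<sigma> =
     (if \<sigma> \<in> arrows (total \<Sigma>)
      then \<Sum>\<^sub>\<infinity>\<gamma>\<in>source_fibre \<Sigma> (gdom (base \<Sigma>) (proj \<Sigma> \<sigma>)).
             f (gmult (total \<Sigma>) \<sigma> (ginv (total \<Sigma>) (lift \<Sigma> \<gamma>))) * g (lift \<Sigma> \<gamma>)
      else 0)"

definition involution :: "('e, 'g) twist_data \<Rightarrow> ('e \<Rightarrow> complex) \<Rightarrow> 'e \<Rightarrow> complex" where
  "involution \<Sigma> f \<sigma> = (if \<sigma> \<in> arrows (total \<Sigma>) then cnj (f (ginv (total \<Sigma>) \<sigma>)) else 0)"

subsection \<open>The reduced norm\<close>

definition rep_space :: "('e, 'g) twist_data \<Rightarrow> 'g \<Rightarrow> ('e \<Rightarrow> complex) set" where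
  "rep_space \<Sigma> x = {\<xi>. equivariant_on \<Sigma> (preimage \<Sigma> (source_fibre \<Sigma> x)) \<xi> \<and>
     (\<lambda>\<gamma>. (cmod (\<xi> (lift \<Sigma> \<gamma>)))\<^sup>2) summable_on source_fibre \<Sigma> x}"

definition rep_norm :: "('e, 'g) twist_data \<Rightarrow> 'g \<Rightarrow> ('e \<Rightarrow> complex) \<Rightarrow> real" where
  "rep_norm \<Sigma> x \<xi> = sqrt (\<Sum>\<^sub>\<infinity>\<gamma>\<in>source_fibre \<Sigma> x. (cmod (\<xi> (lift \<Sigma> \<gamma>)))\<^sup>2)"

text \<open>
  The regular representation at \<open>x\<close> sends \<open>f\<close> to the operator of convolution by \<open>f\<close> on
  \<^term>\<open>rep_space \<Sigma> x\<close>, which is bounded, uniformly in \<open>x\<close>, for \<^term>\<open>f \<in> Cc \<Sigma>\<close>.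
  The additional \<open>0\<close> in \<open>reduced_norm\<close> only matters when there are no units.
\<close>

definition regular_rep_norm :: "('e, 'g) twist_data \<Rightarrow> 'g \<Rightarrow> ('e \<Rightarrow> complex) \<Rightarrow> real" where
  "regular_rep_norm \<Sigma> x f =
     (SUP \<xi> \<in> {\<xi> \<in> rep_space \<Sigma> x. rep_norm \<Sigma> x \<xi> \<le> 1}. rep_norm \<Sigma> x (convolution \<Sigma> f \<xi>))"

definition reduced_norm :: "('e, 'g) twist_data \<Rightarrow> ('e \<Rightarrow> complex) \<Rightarrow> real" where
  "reduced_norm \<Sigma> f = Sup (insert 0 ((\<lambda>x. regular_rep_norm \<Sigma> x f) ` units (base \<Sigma>)))"

subsection \<open>The reduced C*-algebra\<close>

text \<open>
  \<open>reduced_cstar_algebra \<Sigma> A \<iota>\<close>: the C*-algebra \<open>A\<close>, together with \<open>\<iota>\<close>, is the completion of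
  the *-algebra \<^term>\<open>Cc \<Sigma>\<close> in the reduced norm. Such a pair is the same as an isomorphism
  of \<open>A\<close> with the reduced C*-algebra of \<open>\<Sigma>\<close>.
\<close>

definition reduced_cstar_algebra ::
    "('e, 'g) twist_data \<Rightarrow> 'a::cstar_algebra set \<Rightarrow> (('e \<Rightarrow> complex) \<Rightarrow> 'a) \<Rightarrow> bool" where
  "reduced_cstar_algebra \<Sigma> A \<iota> \<longleftrightarrow>
     (\<forall>f\<in>Cc \<Sigma>. \<forall>g\<in>Cc \<Sigma>. \<iota> (\<lambda>\<sigma>. f \<sigma> + g \<sigma>) = \<iota> f + \<iota> g \<and> \<iota> (convolution \<Sigma> f g) = \<iota> f * \<iota> g) \<and>
     (\<forall>c. \<forall>f\<in>Cc \<Sigma>. \<iota> (\<lambda>\<sigma>. c * f \<sigma>) = scaleC c (\<iota> f)) \<and>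
     (\<forall>f\<in>Cc \<Sigma>. \<iota> (involution \<Sigma> f) = star (\<iota> f)) \<and>
     (\<forall>f\<in>Cc \<Sigma>. norm (\<iota> f) = reduced_norm \<Sigma> f) \<and>
     cstar_subalgebra A \<and> closure (\<iota> ` Cc \<Sigma>) = A"

definition C0_units ::
    "('e, 'g) twist_data \<Rightarrow> (('e \<Rightarrow> complex) \<Rightarrow> 'a::cstar_algebra) \<Rightarrow> 'a set" where
  "C0_units \<Sigma> \<iota> =
     closure (\<iota> ` {f \<in> Cc \<Sigma>. \<forall>\<sigma>. f \<sigma> \<noteq> 0 \<longrightarrow> \<sigma> \<in> preimage \<Sigma> (units (base \<Sigma>))})"

text \<open>
  The reduced C*-algebra of the restriction \<open>\<Sigma>\<^sub>H\<close> of \<open>\<Sigma>\<close> to \<open>H\<close>, as a subset of that of \<open>\<Sigma>\<close>.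
  A point of the former is given by a sequence in \<^term>\<open>Cc (restrict_twist \<Sigma> H)\<close> that is
  Cauchy in the reduced norm of \<open>\<Sigma>\<^sub>H\<close>; the natural inclusion extends the functions by zero
  and takes the limit in the reduced C*-algebra of \<open>\<Sigma>\<close>.
\<close>

definition reduced_subalgebra ::
    "('e, 'g) twist_data \<Rightarrow> (('e \<Rightarrow> complex) \<Rightarrow> 'a::cstar_algebra) \<Rightarrow> 'g set \<Rightarrow> 'a set" where
  "reduced_subalgebra \<Sigma> \<iota> H =
     {a. \<exists>f. (\<forall>n. f n \<in> Cc (restrict_twist \<Sigma> H)) \<and>
        (\<forall>\<epsilon>>0. \<exists>N. \<forall>m\<ge>N. \<forall>n\<ge>N. reduced_norm (restrict_twist \<Sigma> H) (\<lambda>\<sigma>. f m \<sigma> - f n \<sigma>) < \<epsilon>) \<and>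
        (\<lambda>n. \<iota> (f n)) \<longlonglongrightarrow> a}"

end

(*
  Strong tightness makes G an ample groupoid, so everything can be done with compact open
  bisections. Wide open subgroupoids H of G correspond to join closed wide subsemigroups T via
  T = {s. [s,x] is in H for all x}: compactness of the domains supplies the finite joins.

  The algebra of H is Cartan intermediate because the conditional expectation and the maximality
  of D are inherited from A, and functions supported on bisections are normalizers. It determines
  H since elements a of A are continuous functions ev a on the twist, with values bounded by the
  norm. Conversely, let D be Cartan in B, and let H be the union of the supports of the functions
  in B which live on bisections. A normalizer n of D is supported on a bisection, because G is
  topologically principal. Cutting n down by projections of D shows that its support lies in H.
  The norm of an element supported on a bisection is at most the supremum of its values, so n is
  a limit of functions with compact support in H, whence B is the algebra of H.
*)

theory Submission
  imports Defs
begin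

section \<open>Groupoids\<close>

text \<open>Uniform closeness of two functions does not control their distance in the reduced norm,
  so in general an element of A cannot be recovered by cutting its function \<open>ev a\<close> to
  larger and larger compact sets. A function on a bisection is the exception: in each regular
  representation its matrix has at most one nonzero entry in every row and column, so its norm is at
  most the supremum of its values. This is why B is rebuilt from normalizers, and why the regularity
  of D in B is the property that determines B. Ampleness takes the place of partitions of unity: a
  compactly supported function is cut along clopen sets into finitely many continuous pieces, each
  on a bisection over which the twist is trivial, and convolution with such a piece has one term.
  Two gaps in the setting have to be bridged. The completion is abstract, so its elements acquire
  values only through the bound of values by the norm. The algebra of H is defined by the norm of H,
  and for it a comparison with the norm of \<Sigma> in one direction suffices.\<close>

lemma continuous_map_locally:
  assumes "\<And>x. x \<in> topspace X \<Longrightarrow>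
    \<exists>U. openin X U \<and> x \<in> U \<and> continuous_map (subtopology X U) Y f"
  shows "continuous_map X Y f"
proof -
  let ?I = "{U. openin X U \<and> continuous_map (subtopology X U) Y f}"
  show ?thesis
    by (rule pasting_lemma[where I = ?I and T = "\<lambda>U. U" and f = "\<lambda>_. f"]) (use assms in auto)
qed

text \<open>The two pieces live on disjoint open sets, so they need not agree anywhere. Extension by
  zero from a clopen set is the typical use.\<close>

lemma continuous_map_cut:
  assumes C: "openin X C" "closedin X C"
    and f: "continuous_map (subtopology X C) Y f"
    and g: "continuous_map (subtopology X (topspace X - C)) Y g"
  shows "continuous_map X Y (\<lambda>x. if x \<in> C then f x else g x)"
proof (rule continuous_map_locally)
  fix x assume x: "x \<in> topspace X"
  let ?h = "\<lambda>x. if x \<in> C then f x else g x"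
  have "continuous_map (subtopology X C) Y ?h"
    by (rule continuous_map_eq[OF f]) auto
  moreover have "continuous_map (subtopology X (topspace X - C)) Y ?h"
    by (rule continuous_map_eq[OF g]) auto
  ultimately show "\<exists>U. openin X U \<and> x \<in> U \<and> continuous_map (subtopology X U) Y ?h"
    using C x by (cases "x \<in> C") blast+
qed

section \<open>Algebra in a groupoid\<close>

locale groupoid =
  fixes G :: "'g tgroupoid"
  assumes is_groupoid: "is_groupoid G"
begin

lemma arrow [simp]:
  "g \<in> arrows G \<Longrightarrow> gdom G g \<in> arrows G"
  "g \<in> arrows G \<Longrightarrow> gran G g \<in> arrows G"
  "g \<in> arrows G \<Longrightarrow> ginv G g \<in> arrows G"
  using is_groupoid unfolding is_groupoid_def by auto

lemma dom_ran [simp]: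
  assumes "g \<in> arrows G"
  shows "gdom G (gdom G g) = gdom G g" "gran G (gdom G g) = gdom G g"
    "gdom G (gran G g) = gran G g" "gran G (gran G g) = gran G g"
    "gdom G (ginv G g) = gran G g" "gran G (ginv G g) = gdom G g"
    "gmult G g (gdom G g) = g" "gmult G (gran G g) g = g"
    "gmult G (ginv G g) g = gdom G g" "gmult G g (ginv G g) = gran G g"
  using is_groupoid assms unfolding is_groupoid_def by auto

lemma mult [simp]:
  assumes "g \<in> arrows G" "h \<in> arrows G" "gdom G g = gran G h"
  shows "gmult G g h \<in> arrows G" "gdom G (gmult G g h) = gdom G h"
    "gran G (gmult G g h) = gran G g"
proof -
  have "(g, h) \<in> composable G" using assms by (simp add: composable_def)
  then show "gmult G g h \<in> arrows G" "gdom G (gmult G g h) = gdom G h"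
    "gran G (gmult G g h) = gran G g"
    using is_groupoid unfolding is_groupoid_def by blast+
qed

lemma assoc:
  assumes "g \<in> arrows G" "h \<in> arrows G" "k \<in> arrows G"
    "gdom G g = gran G h" "gdom G h = gran G k"
  shows "gmult G (gmult G g h) k = gmult G g (gmult G h k)"
proof -
  have "(g, h) \<in> composable G" "(h, k) \<in> composable G"
    using assms by (simp_all add: composable_def)
  then show ?thesis using is_groupoid unfolding is_groupoid_def by blast
qed

lemma inv_unique:
  assumes "g \<in> arrows G" "h \<in> arrows G" "gdom G g = gran G h" "gmult G g h = gran G g"
  shows "h = ginv G g"
proof -
  have "h = gmult G (gmult G (ginv G g) g) h"
    using assms by simp
  also have "\<dots> = gmult G (ginv G g) (gran G g)"
    using assms by (subst assoc) auto
  also have "\<dots> = ginv G g"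
    using assms dom_ran(7)[of "ginv G g"] by simp
  finally show ?thesis .
qed

lemma inv_inv [simp]: "g \<in> arrows G \<Longrightarrow> ginv G (ginv G g) = g"
  by (rule inv_unique[symmetric]) auto

lemma mult_mult_inv [simp]:
  "\<lbrakk>g \<in> arrows G; h \<in> arrows G; gdom G g = gran G h\<rbrakk> \<Longrightarrow> gmult G (gmult G g h) (ginv G h) = g"
  using dom_ran(7)[of g] by (subst assoc) auto

lemma mult_inv_mult [simp]:
  "\<lbrakk>g \<in> arrows G; h \<in> arrows G; gdom G g = gdom G h\<rbrakk> \<Longrightarrow> gmult G (gmult G g (ginv G h)) h = g"
  using mult_mult_inv[of g "ginv G h"] by simp

lemma inv_mult_mult [simp]:
  "\<lbrakk>g \<in> arrows G; h \<in> arrows G; gdom G g = gran G h\<rbrakk> \<Longrightarrow> gmult G (ginv G g) (gmult G g h) = h"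
  by (subst assoc[symmetric]) auto

lemma unit_iff: "x \<in> units G \<longleftrightarrow> x \<in> arrows G \<and> gdom G x = x"
  unfolding units_def by (metis arrow(1) dom_ran(1) image_iff)

lemma unit [simp]:
  assumes "x \<in> units G"
  shows "x \<in> arrows G" "gdom G x = x" "gran G x = x" "gmult G x x = x" "ginv G x = x"
proof -
  show x: "x \<in> arrows G" "gdom G x = x" using assms by (auto simp: unit_iff)
  show r: "gran G x = x" using dom_ran(2)[OF x(1)] x by simp
  show m: "gmult G x x = x" using dom_ran(7)[OF x(1)] x by simp
  show "ginv G x = x" by (rule inv_unique[symmetric]) (use x r m in auto)
qed

lemma dom_unit [simp]: "g \<in> arrows G \<Longrightarrow> gdom G g \<in> units G"
  and ran_unit [simp]: "g \<in> arrows G \<Longrightarrow> gran G g \<in> units G"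
  by (simp_all add: unit_iff del: unit)

text \<open>A unit is its own source, and the source of \<open>gmult G g (ginv G h)\<close> is the
  range of \<open>h\<close>; multiplying by \<open>h\<close> gives \<open>g = h\<close>. So distinct
  arrows with a common source never differ by a unit. This makes convolution with functions on the
  units a one-term sum, and turns trivial isotropy into equality of arrows.\<close>

lemma mult_inv_unit_imp_eq:
  assumes "g \<in> arrows G" "h \<in> arrows G" "gdom G g = gdom G h"
    "gmult G g (ginv G h) \<in> units G"
  shows "g = h"
proof -
  have "gmult G g (ginv G h) = gran G h"
    using assms unit(2)[OF assms(4)] mult(2)[of g "ginv G h"] by (metis arrow(3) dom_ran(5,6))
  then show ?thesis using mult_inv_mult[of g h] dom_ran(8)[of h] assms(1-3) by simp
qed

lemma mult_right_cancel:
  assumes "g \<in> arrows G" "h \<in> arrows G" "k \<in> arrows G" "gdom G g = gran G k" "gdom G h = gran G k"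
    "gmult G g k = gmult G h k"
  shows "g = h"
  using assms by (metis mult_mult_inv)

lemma mult_left_cancel:
  assumes "g \<in> arrows G" "h \<in> arrows G" "k \<in> arrows G" "gdom G k = gran G g" "gdom G k = gran G h"
    "gmult G k g = gmult G k h"
  shows "g = h"
  using assms by (metis inv_mult_mult)

end

section \<open>Topological groupoids: compact sets and bisections\<close>

locale lch_topological_groupoid = groupoid G for G :: "'g tgroupoid" +
  assumes lch: "lch_groupoid G"
begin

lemma Hausdorff: "Hausdorff_space (gtop G)"
  using lch by (simp add: lch_groupoid_def)

lemma continuous_map_inv: "continuous_map (gtop G) (gtop G) (ginv G)"
  using lch by (simp add: lch_groupoid_def topological_groupoid_def)

lemma continuous_map_mult:
  assumes a: "continuous_map Z (gtop G) a" and b: "continuous_map Z (gtop G) b"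
    and ab: "\<And>z. z \<in> topspace Z \<Longrightarrow> gdom G (a z) = gran G (b z)"
  shows "continuous_map Z (gtop G) (\<lambda>z. gmult G (a z) (b z))"
proof -
  have 1: "continuous_map (subtopology (prod_topology (gtop G) (gtop G)) (composable G)) (gtop G)
       (\<lambda>(g, h). gmult G g h)"
    using lch by (simp add: lch_groupoid_def topological_groupoid_def)
  have "continuous_map Z (subtopology (prod_topology (gtop G) (gtop G)) (composable G)) (\<lambda>z. (a z, b z))"
    using a b ab continuous_map_funspace[OF a] continuous_map_funspace[OF b]
    by (auto simp: continuous_map_in_subtopology continuous_map_paired composable_def)
  from continuous_map_compose[OF this 1] show ?thesis by (simp add: o_def)
qed

text \<open>Continuity of source and range is not an axiom; it follows from d(g) = g^-1 g and r(g) =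
  g g^-1.\<close>

lemma continuous_map_dom: "continuous_map (gtop G) (gtop G) (gdom G)"
  by (rule continuous_map_eq[OF continuous_map_mult[OF continuous_map_inv continuous_map_id[unfolded id_def]]]) auto

lemma continuous_map_ran: "continuous_map (gtop G) (gtop G) (gran G)"
  by (rule continuous_map_eq[OF continuous_map_mult[OF continuous_map_id[unfolded id_def] continuous_map_inv]]) auto

text \<open>The equalizer of two continuous maps into a Hausdorff space is closed. Hence the
  composable pairs from two compact sets form a compact set, which bounds the support of a
  convolution.\<close>

lemma closedin_composable: "closedin (prod_topology (gtop G) (gtop G)) (composable G)"
proof -
  have "closedin (prod_topology (gtop G) (gtop G))
    {z \<in> topspace (prod_topology (gtop G) (gtop G)). (gdom G \<circ> fst) z = (gran G \<circ> snd) z}"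
    by (intro closedin_continuous_maps_eq[OF Hausdorff] continuous_map_compose[OF continuous_map_fst]
        continuous_map_compose[OF continuous_map_snd] continuous_map_dom continuous_map_ran)
  also have "{z \<in> topspace (prod_topology (gtop G) (gtop G)). (gdom G \<circ> fst) z = (gran G \<circ> snd) z}
    = composable G"
    by (auto simp: composable_def)
  finally show ?thesis .
qed

definition products :: "'g set \<Rightarrow> 'g set \<Rightarrow> 'g set" where
  "products K L = {gmult G g h |g h. g \<in> K \<and> h \<in> L \<and> gdom G g = gran G h}"

lemma compactin_products:
  assumes "compactin (gtop G) K" "compactin (gtop G) L"
  shows "compactin (gtop G) (products K L)"
proof -
  have KL: "K \<subseteq> arrows G" "L \<subseteq> arrows G"
    using assms by (simp_all add: compactin_subset_topspace)
  have "compactin (prod_topology (gtop G) (gtop G)) (K \<times> L)"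
    using assms by (auto simp: compactin_Times)
  then have "compactin (prod_topology (gtop G) (gtop G)) (composable G \<inter> K \<times> L)"
    using closedin_composable by (rule closed_Int_compactin[rotated])
  then have "compactin (subtopology (prod_topology (gtop G) (gtop G)) (composable G)) (composable G \<inter> K \<times> L)"
    by (simp add: compactin_subtopology)
  then have "compactin (gtop G) ((\<lambda>(g, h). gmult G g h) ` (composable G \<inter> K \<times> L))"
    by (rule image_compactin) (use lch in \<open>simp add: lch_groupoid_def topological_groupoid_def\<close>)
  also have "(\<lambda>(g, h). gmult G g h) ` (composable G \<inter> K \<times> L) = products K L"
    using KL by (fastforce simp: products_def composable_def)
  finally show ?thesis .
qed

definition inverses :: "'g set \<Rightarrow> 'g set" where
  "inverses K = ginv G ` K"

lemma compactin_inverses: "compactin (gtop G) K \<Longrightarrow> compactin (gtop G) (inverses K)"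
  unfolding inverses_def by (rule image_compactin) (auto simp: continuous_map_inv)

text \<open>A bisection need not be open here.\<close>

definition bisection :: "'g set \<Rightarrow> bool" where
  "bisection U \<longleftrightarrow> inj_on (gdom G) U \<and> inj_on (gran G) U"

lemma bisection_domD: "\<lbrakk>bisection U; g \<in> U; h \<in> U; gdom G g = gdom G h\<rbrakk> \<Longrightarrow> g = h"
  and bisection_ranD: "\<lbrakk>bisection U; g \<in> U; h \<in> U; gran G g = gran G h\<rbrakk> \<Longrightarrow> g = h"
  by (auto simp: bisection_def inj_on_def)

lemma bisection_products:
  assumes U: "bisection U" "U \<subseteq> arrows G" and V: "bisection V" "V \<subseteq> arrows G"
  shows "bisection (products U V)"
  unfolding bisection_def
proof (intro conjI inj_onI)
  fix a b assume "a \<in> products U V" "b \<in> products U V"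
  then obtain g h g' h' where ab: "a = gmult G g h" "b = gmult G g' h'"
    and gh: "g \<in> U" "h \<in> V" "g' \<in> U" "h' \<in> V" "gdom G g = gran G h" "gdom G g' = gran G h'"
    unfolding products_def by blast
  have arr: "g \<in> arrows G" "h \<in> arrows G" "g' \<in> arrows G" "h' \<in> arrows G" using gh U(2) V(2) by auto
  {
    assume "gdom G a = gdom G b"
    then have "gdom G h = gdom G h'" using ab gh arr by simp
    then have h: "h = h'" using bisection_domD[OF V(1) gh(2,4)] by blast
    then have "g = g'" using bisection_domD[OF U(1) gh(1,3)] gh(5,6) by simp
    with h ab show "a = b" by simp
  next
    assume "gran G a = gran G b"
    then have "gran G g = gran G g'" using ab gh arr by simp
    then have g: "g = g'" using bisection_ranD[OF U(1) gh(1,3)] by blast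
    then have "h = h'" using bisection_ranD[OF V(1) gh(2,4)] gh(5,6) by simp
    with g ab show "a = b" by simp
  }
qed

lemma bisection_inverses:
  assumes U: "bisection U" "U \<subseteq> arrows G"
  shows "bisection (inverses U)"
  unfolding bisection_def inverses_def
  using U by (auto simp: inj_on_def bisection_def subset_iff)

definition compact_open_bisection :: "'g set \<Rightarrow> bool" where
  "compact_open_bisection U \<longleftrightarrow> openin (gtop G) U \<and> compactin (gtop G) U \<and> bisection U"

lemma bisection_subset: "bisection U \<Longrightarrow> V \<subseteq> U \<Longrightarrow> bisection V"
  unfolding bisection_def by (blast intro: inj_on_subset)

lemma compact_open_bisectionD:
  assumes "compact_open_bisection U"
  shows "openin (gtop G) U" "compactin (gtop G) U" "closedin (gtop G) U" "bisection U"
    "U \<subseteq> arrows G"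
  using assms compactin_imp_closedin[OF Hausdorff] openin_subset
  by (auto simp: compact_open_bisection_def)

definition open_subgroupoid :: "'g set \<Rightarrow> bool" where
  "open_subgroupoid H \<longleftrightarrow> openin (gtop G) H \<and> units G \<subseteq> H \<and> (\<forall>g\<in>H. ginv G g \<in> H) \<and>
     (\<forall>g\<in>H. \<forall>h\<in>H. gdom G g = gran G h \<longrightarrow> gmult G g h \<in> H)"

end

section \<open>Ample groupoids\<close>

locale ample_groupoid = lch_topological_groupoid G for G :: "'g tgroupoid" +
  assumes etale: "etale G"
    and ample: "\<And>W g. \<lbrakk>openin (gtop G) W; g \<in> W\<rbrakk> \<Longrightarrow> \<exists>U. compact_open_bisection U \<and> g \<in> U \<and> U \<subseteq> W"
begin

text \<open>Let the source be injective on a neighbourhood U of a unit. If both g and d(g) lie in U,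
  they have the same source, so g = d(g) is a unit; such g form a neighbourhood.\<close>

lemma openin_units: "openin (gtop G) (units G)"
proof (subst openin_subopen, intro ballI)
  fix x assume x: "x \<in> units G"
  then obtain U where U: "openin (gtop G) U" "x \<in> U"
    "homeomorphic_map (subtopology (gtop G) U) (subtopology (gtop G) (gdom G ` U)) (gdom G)"
    using etale by (meson etale_def unit(1))
  let ?V = "{g \<in> arrows G. gdom G g \<in> U} \<inter> U"
  have "openin (gtop G) ?V"
    using U openin_continuous_map_preimage[OF continuous_map_dom] by blast
  moreover have "x \<in> ?V" using x U by simp
  moreover have "?V \<subseteq> units G"
  proof
    fix g assume g: "g \<in> ?V"
    have "inj_on (gdom G) (arrows G \<inter> U)"
      using homeomorphic_imp_injective_map[OF U(3)] by simp
    then have "gdom G g = g"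
      by (rule inj_onD) (use g in \<open>auto simp: dom_ran(1)\<close>)
    with g show "g \<in> units G" by (simp add: unit_iff del: unit)
  qed
  ultimately show "\<exists>T. openin (gtop G) T \<and> x \<in> T \<and> T \<subseteq> units G" by blast
qed

lemma closedin_units: "closedin (gtop G) (units G)"
proof -
  have "closedin (gtop G) {g \<in> arrows G. gdom G g = g}"
    using closedin_continuous_maps_eq[OF Hausdorff continuous_map_dom continuous_map_id[unfolded id_def]] .
  moreover have "{g \<in> arrows G. gdom G g = g} = units G" using unit_iff by blast
  ultimately show ?thesis by simp
qed

text \<open>\<open>etale\<close> gives openness only locally and relative to the unit space;
  openness of the unit space makes it absolute.\<close>

lemma openin_dom_image:
  assumes U: "openin (gtop G) U"
  shows "openin (gtop G) (gdom G ` U)"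
proof (subst openin_subopen, intro ballI)
  fix x assume "x \<in> gdom G ` U"
  then obtain g where g: "g \<in> U" "x = gdom G g" by auto
  then have ga: "g \<in> arrows G" using openin_subset[OF U] by auto
  then obtain V where V: "openin (gtop G) V" "g \<in> V"
    "openin (subtopology (gtop G) (units G)) (gdom G ` V)"
    "homeomorphic_map (subtopology (gtop G) V) (subtopology (gtop G) (gdom G ` V)) (gdom G)"
    using etale unfolding etale_def by blast
  have "openin (subtopology (gtop G) V) (U \<inter> V)"
    using U by (auto simp: openin_subtopology)
  then have "openin (subtopology (gtop G) (gdom G ` V)) (gdom G ` (U \<inter> V))"
    using homeomorphic_imp_open_map[OF V(4)] by (auto simp: open_map_def)
  moreover have "openin (gtop G) (gdom G ` V)"
    using V(3) openin_units by (meson openin_trans_full)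
  ultimately have "openin (gtop G) (gdom G ` (U \<inter> V))"
    using openin_trans_full by blast
  then show "\<exists>T. openin (gtop G) T \<and> x \<in> T \<and> T \<subseteq> gdom G ` U"
    using g V by blast
qed

lemma clopen_dom_image:
  assumes "compact_open_bisection U"
  shows "openin (gtop G) (gdom G ` U)" "closedin (gtop G) (gdom G ` U)"
    "compactin (gtop G) (gdom G ` U)"
  using assms image_compactin[OF _ continuous_map_dom]
  by (auto simp: compact_open_bisection_def openin_dom_image compactin_imp_closedin[OF Hausdorff])

text \<open>A continuous bijection from a compact space onto a Hausdorff space is a homeomorphism.
  Its inverse sends a unit to the only arrow of U with this source.\<close>

lemma dom_inverse_continuous:
  assumes "compact_open_bisection U"
  obtains s where "continuous_map (subtopology (gtop G) (gdom G ` U)) (subtopology (gtop G) U) s"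
    "\<And>g. g \<in> U \<Longrightarrow> s (gdom G g) = g"
proof -
  note U = compact_open_bisectionD[OF assms]
  have "homeomorphic_map (subtopology (gtop G) U) (subtopology (gtop G) (gdom G ` U)) (gdom G)"
    by (rule continuous_imp_homeomorphic_map)
      (use U continuous_map_dom in \<open>auto simp: continuous_map_in_subtopology
        continuous_map_from_subtopology compact_space_subtopology Hausdorff_space_subtopology Hausdorff bisection_def
        intro: inj_on_subset\<close>)
  then obtain s where "homeomorphic_maps (subtopology (gtop G) U) (subtopology (gtop G) (gdom G ` U)) (gdom G) s"
    by (auto simp: homeomorphic_map_maps)
  then show ?thesis using that U by (auto simp: homeomorphic_maps_def)
qed

end

section \<open>Twists over ample groupoids\<close>

locale ample_twist = G: ample_groupoid "base \<Sigma>"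
  for \<Sigma> :: "('e, 'g) twist_data" +
  assumes twist: "twist \<Sigma>"
begin

abbreviation "\<G> \<equiv> base \<Sigma>"
abbreviation "\<E> \<equiv> total \<Sigma>"
abbreviation "p \<equiv> proj \<Sigma>"
abbreviation "src \<sigma> \<equiv> gdom (base \<Sigma>) (proj \<Sigma> \<sigma>)"
abbreviation "rng \<sigma> \<equiv> gran (base \<Sigma>) (proj \<Sigma> \<sigma>)"
abbreviation "one x \<equiv> incl \<Sigma> (x, 1)"
abbreviation act (infixr "\<star>" 75) where "z \<star> \<sigma> \<equiv> circle_act \<Sigma> z \<sigma>"
abbreviation mul (infixl "\<cdot>" 70) where "\<sigma> \<cdot> \<tau> \<equiv> gmult (total \<Sigma>) \<sigma> \<tau>"
abbreviation "inv\<^sub>E \<equiv> ginv (total \<Sigma>)"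

sublocale E: lch_topological_groupoid "total \<Sigma>"
proof
  show "lch_groupoid (total \<Sigma>)" using twist by (simp add: twist_def)
  then show "is_groupoid (total \<Sigma>)" by (simp add: lch_groupoid_def topological_groupoid_def)
qed

lemma central: "central_inclusion \<Sigma>" and projection: "twist_projection \<Sigma>"
  using twist by (simp_all add: twist_def)

lemma proj_continuous: "continuous_map (gtop \<E>) (gtop \<G>) p"
  and proj_open: "open_map (gtop \<E>) (gtop \<G>) p"
  and proj_surj: "p ` arrows \<E> = arrows \<G>"
  using projection by (simp_all add: twist_projection_def)

lemma proj_arrow [simp]: "\<sigma> \<in> arrows \<E> \<Longrightarrow> p \<sigma> \<in> arrows \<G>"
  using proj_surj by blast

lemma proj_dom [simp]: "\<sigma> \<in> arrows \<E> \<Longrightarrow> p (gdom \<E> \<sigma>) = src \<sigma>"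
  and proj_ran [simp]: "\<sigma> \<in> arrows \<E> \<Longrightarrow> p (gran \<E> \<sigma>) = rng \<sigma>"
  using projection by (simp_all add: twist_projection_def)

lemma proj_eq_iff:
  "\<lbrakk>\<sigma> \<in> arrows \<E>; \<tau> \<in> arrows \<E>\<rbrakk> \<Longrightarrow> p \<sigma> = p \<tau> \<longleftrightarrow> (\<exists>z\<in>circle. \<tau> = z \<star> \<sigma>)"
  using projection by (simp add: twist_projection_def)

lemma incl_homeo:
  "homeomorphic_map (prod_topology (subtopology (gtop \<G>) (units \<G>)) (top_of_set circle))
     (subtopology (gtop \<E>) (preimage \<Sigma> (units \<G>))) (incl \<Sigma>)"
  using central by (simp add: central_inclusion_def)

lemma preimage_iff [simp]: "\<sigma> \<in> preimage \<Sigma> H \<longleftrightarrow> \<sigma> \<in> arrows \<E> \<and> p \<sigma> \<in> H"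
  by (simp add: preimage_def)

lemma units_subset: "units \<G> \<subseteq> arrows \<G>"
  by auto

lemma incl_image: "incl \<Sigma> ` (units \<G> \<times> circle) = preimage \<Sigma> (units \<G>)"
proof -
  have "arrows \<E> \<inter> preimage \<Sigma> (units \<G>) = preimage \<Sigma> (units \<G>)" by auto
  then show ?thesis
    using homeomorphic_imp_surjective_map[OF incl_homeo] units_subset by (simp add: Int_absorb1)
qed

lemma incl [simp]:
  assumes "x \<in> units \<G>" "cmod z = 1"
  shows "incl \<Sigma> (x, z) \<in> arrows \<E>" "p (incl \<Sigma> (x, z)) = x"
    "gdom \<E> (incl \<Sigma> (x, z)) = one x" "gran \<E> (incl \<Sigma> (x, z)) = one x"
proof -
  have z: "z \<in> circle" using assms by simp
  show "incl \<Sigma> (x, z) \<in> arrows \<E>" using incl_image z assms(1) by auto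
  show "p (incl \<Sigma> (x, z)) = x" "gdom \<E> (incl \<Sigma> (x, z)) = one x" "gran \<E> (incl \<Sigma> (x, z)) = one x"
    using central z assms(1) by (simp_all add: central_inclusion_def)
qed

lemma incl_mult [simp]:
  "\<lbrakk>x \<in> units \<G>; cmod z = 1; cmod w = 1\<rbrakk> \<Longrightarrow> incl \<Sigma> (x, z) \<cdot> incl \<Sigma> (x, w) = incl \<Sigma> (x, z * w)"
  using central by (simp add: central_inclusion_def)

lemma incl_central:
  "\<lbrakk>\<sigma> \<in> arrows \<E>; cmod z = 1\<rbrakk> \<Longrightarrow> incl \<Sigma> (rng \<sigma>, z) \<cdot> \<sigma> = \<sigma> \<cdot> incl \<Sigma> (src \<sigma>, z)"
  using central by (simp add: central_inclusion_def)

lemma unit_arrow_cases: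
  assumes "\<sigma> \<in> arrows \<E>" "p \<sigma> \<in> units \<G>"
  obtains z where "cmod z = 1" "\<sigma> = incl \<Sigma> (p \<sigma>, z)"
proof -
  have "\<sigma> \<in> incl \<Sigma> ` (units \<G> \<times> circle)" using assms incl_image by auto
  then obtain x z where xz: "x \<in> units \<G>" "cmod z = 1" "\<sigma> = incl \<Sigma> (x, z)" by auto
  then have "p \<sigma> = x" by simp
  with xz show ?thesis by (intro that[of z]) simp_all
qed

text \<open>The source of \<sigma> lies over a unit, so it is \<open>incl \<Sigma> (x, z)\<close>
  for some z. Every such element has source \<open>one x\<close>, and a source is its own source.
  With \<open>ran_E\<close> this moves all composability conditions from the total groupoid to the
  base.\<close>

lemma dom_E [simp]: "\<sigma> \<in> arrows \<E> \<Longrightarrow> gdom \<E> \<sigma> = one (src \<sigma>)"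
proof -
  assume s: "\<sigma> \<in> arrows \<E>"
  then obtain z where z: "cmod z = 1" "gdom \<E> \<sigma> = incl \<Sigma> (src \<sigma>, z)"
    using unit_arrow_cases[of "gdom \<E> \<sigma>"] by (metis E.arrow(1) G.dom_unit proj_arrow proj_dom)
  then have "gdom \<E> (gdom \<E> \<sigma>) = one (src \<sigma>)" using s by simp
  then show ?thesis using E.dom_ran(1)[OF s] by simp
qed

lemma ran_E [simp]: "\<sigma> \<in> arrows \<E> \<Longrightarrow> gran \<E> \<sigma> = one (rng \<sigma>)"
proof -
  assume s: "\<sigma> \<in> arrows \<E>"
  then obtain z where z: "cmod z = 1" "gran \<E> \<sigma> = incl \<Sigma> (rng \<sigma>, z)"
    using unit_arrow_cases[of "gran \<E> \<sigma>"] by (metis E.arrow(2) G.ran_unit proj_arrow proj_ran)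
  then have "gdom \<E> (gran \<E> \<sigma>) = one (rng \<sigma>)" using s by simp
  then show ?thesis using E.dom_ran(3)[OF s] by simp
qed

lemma E_mult [simp]:
  assumes "\<sigma> \<in> arrows \<E>" "\<tau> \<in> arrows \<E>" "src \<sigma> = rng \<tau>"
  shows "\<sigma> \<cdot> \<tau> \<in> arrows \<E>" "p (\<sigma> \<cdot> \<tau>) = gmult \<G> (p \<sigma>) (p \<tau>)"
proof -
  have d: "gdom \<E> \<sigma> = gran \<E> \<tau>" using assms by simp
  then show "\<sigma> \<cdot> \<tau> \<in> arrows \<E>" using assms E.mult by blast
  have "(\<sigma>, \<tau>) \<in> composable \<E>" using d assms(1,2) by (simp add: composable_def)
  then show "p (\<sigma> \<cdot> \<tau>) = gmult \<G> (p \<sigma>) (p \<tau>)"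
    using projection unfolding twist_projection_def by blast
qed

lemma E_one [simp]:
  assumes "\<sigma> \<in> arrows \<E>"
  shows "\<sigma> \<cdot> one (src \<sigma>) = \<sigma>" "one (rng \<sigma>) \<cdot> \<sigma> = \<sigma>"
  using E.dom_ran(7,8)[OF assms] dom_E[OF assms] ran_E[OF assms] by simp_all

lemma E_inv [simp]:
  assumes "\<sigma> \<in> arrows \<E>"
  shows "inv\<^sub>E \<sigma> \<in> arrows \<E>" "p (inv\<^sub>E \<sigma>) = ginv \<G> (p \<sigma>)"
    "inv\<^sub>E \<sigma> \<cdot> \<sigma> = one (src \<sigma>)" "\<sigma> \<cdot> inv\<^sub>E \<sigma> = one (rng \<sigma>)" "inv\<^sub>E (inv\<^sub>E \<sigma>) = \<sigma>"
proof -
  show i: "inv\<^sub>E \<sigma> \<in> arrows \<E>" using assms by simp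
  show "inv\<^sub>E (inv\<^sub>E \<sigma>) = \<sigma>" using assms by (rule E.inv_inv)
  show "inv\<^sub>E \<sigma> \<cdot> \<sigma> = one (src \<sigma>)" "\<sigma> \<cdot> inv\<^sub>E \<sigma> = one (rng \<sigma>)"
    using E.dom_ran(9,10)[OF assms] assms by simp_all
  have "p (gran \<E> (inv\<^sub>E \<sigma>)) = p (gdom \<E> \<sigma>)" using assms E.dom_ran(6) by metis
  then have r: "src \<sigma> = rng (inv\<^sub>E \<sigma>)" using assms i by (metis proj_dom proj_ran)
  have "gmult \<G> (p \<sigma>) (p (inv\<^sub>E \<sigma>)) = p (one (rng \<sigma>))"
    using \<open>\<sigma> \<cdot> inv\<^sub>E \<sigma> = one (rng \<sigma>)\<close> E_mult(2)[OF assms i r] by simp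
  then have "gmult \<G> (p \<sigma>) (p (inv\<^sub>E \<sigma>)) = rng \<sigma>" using assms by simp
  then show "p (inv\<^sub>E \<sigma>) = ginv \<G> (p \<sigma>)"
    using G.inv_unique i r assms proj_arrow by blast
qed

lemma E_assoc:
  assumes "\<sigma> \<in> arrows \<E>" "\<tau> \<in> arrows \<E>" "\<rho> \<in> arrows \<E>" "src \<sigma> = rng \<tau>" "src \<tau> = rng \<rho>"
  shows "(\<sigma> \<cdot> \<tau>) \<cdot> \<rho> = \<sigma> \<cdot> (\<tau> \<cdot> \<rho>)"
  by (rule E.assoc) (use assms in simp_all)

lemma E_mult_mult_inv [simp]:
  assumes "\<sigma> \<in> arrows \<E>" "\<tau> \<in> arrows \<E>" "src \<sigma> = rng \<tau>"
  shows "\<sigma> \<cdot> \<tau> \<cdot> inv\<^sub>E \<tau> = \<sigma>"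
  by (rule E.mult_mult_inv) (use assms in simp_all)

lemma act [simp]:
  assumes "\<sigma> \<in> arrows \<E>" "cmod z = 1"
  shows "z \<star> \<sigma> \<in> arrows \<E>" "p (z \<star> \<sigma>) = p \<sigma>"
  using assms unfolding circle_act_def by simp_all

lemma act_1 [simp]: "\<sigma> \<in> arrows \<E> \<Longrightarrow> 1 \<star> \<sigma> = \<sigma>"
  by (simp add: circle_act_def)

lemma act_mult_left:
  assumes "\<sigma> \<in> arrows \<E>" "\<tau> \<in> arrows \<E>" "src \<sigma> = rng \<tau>" "cmod z = 1"
  shows "(z \<star> \<sigma>) \<cdot> \<tau> = z \<star> (\<sigma> \<cdot> \<tau>)"
  using assms unfolding circle_act_def by (simp add: E_assoc)

text \<open>Centrality is used here to carry the scalar across \<sigma>; for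
  \<open>act_mult_left\<close> associativity is enough.\<close>

lemma act_mult_right:
  assumes "\<sigma> \<in> arrows \<E>" "\<tau> \<in> arrows \<E>" "src \<sigma> = rng \<tau>" "cmod z = 1"
  shows "\<sigma> \<cdot> (z \<star> \<tau>) = z \<star> (\<sigma> \<cdot> \<tau>)"
proof -
  have "\<sigma> \<cdot> (z \<star> \<tau>) = (\<sigma> \<cdot> incl \<Sigma> (src \<sigma>, z)) \<cdot> \<tau>"
    using assms unfolding circle_act_def by (simp add: E_assoc)
  also have "\<dots> = (z \<star> \<sigma>) \<cdot> \<tau>"
    using assms by (simp add: circle_act_def incl_central)
  finally show ?thesis using assms by (simp add: act_mult_left)
qed

lemma act_act:
  assumes "\<sigma> \<in> arrows \<E>" "cmod z = 1" "cmod w = 1"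
  shows "z \<star> (w \<star> \<sigma>) = (z * w) \<star> \<sigma>"
  using assms by (simp add: circle_act_def E_assoc[symmetric])

lemma cnj_mult_circle: "cmod z = 1 \<Longrightarrow> z * cnj z = 1" "cmod z = 1 \<Longrightarrow> cnj z * z = 1"
  by (simp_all add: complex_norm_square[symmetric] mult.commute)

lemma inv_act:
  assumes "\<sigma> \<in> arrows \<E>" "cmod z = 1"
  shows "inv\<^sub>E (z \<star> \<sigma>) = cnj z \<star> inv\<^sub>E \<sigma>"
proof (rule E.inv_unique[symmetric])
  show "z \<star> \<sigma> \<cdot> cnj z \<star> inv\<^sub>E \<sigma> = gran \<E> (z \<star> \<sigma>)"
    using assms by (simp add: act_mult_left act_mult_right act_act cnj_mult_circle)
qed (use assms in auto)

lemma same_fibre: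
  assumes "\<sigma> \<in> arrows \<E>" "\<tau> \<in> arrows \<E>" "p \<sigma> = p \<tau>"
  obtains z where "cmod z = 1" "\<tau> = z \<star> \<sigma>"
  using assms proj_eq_iff by auto

lemma lift [simp]:
  assumes "\<gamma> \<in> arrows \<G>"
  shows "lift \<Sigma> \<gamma> \<in> arrows \<E>" "p (lift \<Sigma> \<gamma>) = \<gamma>"
proof -
  have "\<exists>\<tau>. \<tau> \<in> arrows \<E> \<and> p \<tau> = \<gamma>" using assms proj_surj by (metis image_iff)
  from someI_ex[OF this] show "lift \<Sigma> \<gamma> \<in> arrows \<E>" "p (lift \<Sigma> \<gamma>) = \<gamma>"
    unfolding lift_def by auto
qed

lemma one_inv [simp]: "x \<in> units \<G> \<Longrightarrow> inv\<^sub>E (one x) = one x"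
  by (rule E.inv_unique[symmetric]) simp_all

lemma ample_section:
  assumes "openin (gtop \<G>) W" "g \<in> W"
  obtains U k where "G.compact_open_bisection U" "g \<in> U" "U \<subseteq> W"
    "continuous_map (subtopology (gtop \<G>) U) (gtop \<E>) k" "\<And>h. h \<in> U \<Longrightarrow> p (k h) = h"
    "\<And>h. h \<in> U \<Longrightarrow> k h \<in> arrows \<E>"
proof -
  have "g \<in> arrows \<G>" using assms openin_subset by blast
  then obtain V k where V: "openin (gtop \<G>) V" "g \<in> V"
    "continuous_map (subtopology (gtop \<G>) V) (gtop \<E>) k" "\<forall>h\<in>V. p (k h) = h"
    using projection unfolding twist_projection_def by blast
  then obtain U where U: "G.compact_open_bisection U" "g \<in> U" "U \<subseteq> W \<inter> V"
    using G.ample[of "W \<inter> V" g] assms by blast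
  have c: "continuous_map (subtopology (gtop \<G>) U) (gtop \<E>) k"
    using V(3) U(3) by (meson continuous_map_from_subtopology_mono le_inf_iff)
  have "k h \<in> arrows \<E>" if "h \<in> U" for h
    using continuous_map_funspace[OF c] that G.compact_open_bisectionD(5)[OF U(1)] by auto
  then show ?thesis using that[OF U(1,2) _ c] U(3) V(4) by blast
qed

lemma closedin_preimage: "closedin (gtop \<G>) K \<Longrightarrow> closedin (gtop \<E>) (preimage \<Sigma> K)"
  unfolding preimage_def by (rule closedin_continuous_map_preimage[OF proj_continuous])

lemma openin_preimage: "openin (gtop \<G>) K \<Longrightarrow> openin (gtop \<E>) (preimage \<Sigma> K)"
  unfolding preimage_def by (rule openin_continuous_map_preimage[OF proj_continuous])

text \<open>Over a compact open set with a continuous section \<open>k\<close>, the preimage is the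
  image of a compact set times the circle under \<open>(g, z) \<mapsto> z \<star> k g\<close>.
  Finitely many such sets cover K, and the preimage of K is closed. Compactness of supports can
  therefore be tested in the base.\<close>

lemma compactin_preimage:
  assumes K: "compactin (gtop \<G>) K"
  shows "compactin (gtop \<E>) (preimage \<Sigma> K)"
proof -
  let ?\<C> = "{U. openin (gtop \<G>) U \<and> compactin (gtop \<E>) (preimage \<Sigma> U)}"
  have "\<exists>U\<in>?\<C>. g \<in> U" if g: "g \<in> K" for g
  proof -
    have "g \<in> arrows \<G>" using K g compactin_subset_topspace by blast
    then obtain U k where U: "G.compact_open_bisection U" "g \<in> U"
      "continuous_map (subtopology (gtop \<G>) U) (gtop \<E>) k" "\<And>h. h \<in> U \<Longrightarrow> p (k h) = h"
      "\<And>h. h \<in> U \<Longrightarrow> k h \<in> arrows \<E>"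
      using ample_section[OF openin_topspace] by metis
    note U' = G.compact_open_bisectionD[OF U(1)]
    let ?Z = "prod_topology (subtopology (gtop \<G>) U) (top_of_set circle)"
    have "continuous_map ?Z (gtop \<G>) fst"
      using continuous_map_fst continuous_map_into_fulltopology by blast
    then have "continuous_map ?Z (gtop \<G>) (gran \<G> \<circ> fst)"
      by (rule continuous_map_compose[OF _ G.continuous_map_ran])
    then have "continuous_map ?Z (subtopology (gtop \<G>) (units \<G>)) (gran \<G> \<circ> fst)"
      by (auto simp: continuous_map_in_subtopology)
    then have "continuous_map ?Z (prod_topology (subtopology (gtop \<G>) (units \<G>)) (top_of_set circle))
      (\<lambda>z. (gran \<G> (fst z), snd z))"
      by (auto simp: continuous_map_paired o_def continuous_map_snd)
    from continuous_map_compose[OF this homeomorphic_imp_continuous_map[OF incl_homeo]]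
    have "continuous_map ?Z (gtop \<E>) (\<lambda>z. incl \<Sigma> (gran \<G> (fst z), snd z))"
      by (simp add: o_def continuous_map_in_subtopology)
    moreover have "continuous_map ?Z (gtop \<E>) (\<lambda>z. k (fst z))"
      using continuous_map_compose[OF continuous_map_fst U(3)] by (simp add: o_def)
    ultimately have "continuous_map ?Z (gtop \<E>) (\<lambda>z. incl \<Sigma> (gran \<G> (fst z), snd z) \<cdot> k (fst z))"
      by (rule E.continuous_map_mult) (use U in auto)
    moreover have "compactin ?Z (U \<times> circle)"
      using U' by (auto simp: compactin_Times compactin_subtopology)
    ultimately have "compactin (gtop \<E>) ((\<lambda>z. incl \<Sigma> (gran \<G> (fst z), snd z) \<cdot> k (fst z)) ` (U \<times> circle))"
      using image_compactin by blast
    also have "(\<lambda>z. incl \<Sigma> (gran \<G> (fst z), snd z) \<cdot> k (fst z)) ` (U \<times> circle) = preimage \<Sigma> U" (is "?L = ?R")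
    proof
      show "?L \<subseteq> ?R" using U' U by auto
      show "?R \<subseteq> ?L"
      proof
        fix \<sigma> assume s: "\<sigma> \<in> ?R"
        then obtain z where z: "cmod z = 1" "\<sigma> = z \<star> k (p \<sigma>)"
          using same_fibre[of "k (p \<sigma>)" \<sigma>] U by auto
        then have "\<sigma> = incl \<Sigma> (rng \<sigma>, z) \<cdot> k (p \<sigma>)"
          using s U by (simp add: circle_act_def)
        then show "\<sigma> \<in> ?L" using s z(1) by (intro image_eqI[of _ _ "(p \<sigma>, z)"]) auto
      qed
    qed
    finally show ?thesis using U' U by blast
  qed
  then have "K \<subseteq> \<Union>?\<C>" by blast
  then obtain \<U> where \<U>: "finite \<U>" "\<U> \<subseteq> ?\<C>" "K \<subseteq> \<Union>\<U>"
    using K unfolding compactin_def by (metis (no_types, lifting) mem_Collect_eq)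
  have "compactin (gtop \<E>) (\<Union>(preimage \<Sigma> ` \<U>))"
    by (rule compactin_Union) (use \<U> in auto)
  moreover have "preimage \<Sigma> K \<subseteq> \<Union>(preimage \<Sigma> ` \<U>)"
    using \<U>(3) by (fastforce simp: preimage_def)
  moreover have "closedin (gtop \<E>) (preimage \<Sigma> K)"
    using K by (intro closedin_preimage compactin_imp_closedin[OF G.Hausdorff])
  ultimately show ?thesis using closed_compactin by blast
qed

end

section \<open>Compactly supported equivariant functions\<close>

lemma continuous_map_complex_mult:
  fixes f g :: "'b \<Rightarrow> complex"
  shows "\<lbrakk>continuous_map X euclidean f; continuous_map X euclidean g\<rbrakk>
    \<Longrightarrow> continuous_map X euclidean (\<lambda>x. f x * g x)"
  by (simp add: continuous_map_atin tendsto_mult)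

lemma continuous_map_cnj:
  "continuous_map X euclidean f \<Longrightarrow> continuous_map X euclidean (\<lambda>x. cnj (f x))"
  by (simp add: continuous_map_atin tendsto_cnj)

context ample_twist begin

text \<open>The condition is on the points where f is nonzero, not on their closure; for compact K
  this is the same, since \<open>preimage \<Sigma> K\<close> is closed. K may also be noncompact,
  for instance the whole unit space.\<close>

definition Cc_on :: "'g set \<Rightarrow> ('e \<Rightarrow> complex) set" where
  "Cc_on K = {f \<in> Cc \<Sigma>. \<forall>\<sigma>. f \<sigma> \<noteq> 0 \<longrightarrow> \<sigma> \<in> preimage \<Sigma> K}"

lemma Cc_onI:
  assumes c: "continuous_map (gtop \<E>) euclidean f"
    and e: "\<And>\<sigma> z. \<lbrakk>\<sigma> \<in> arrows \<E>; cmod z = 1\<rbrakk> \<Longrightarrow> f (z \<star> \<sigma>) = z * f \<sigma>"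
    and K: "compactin (gtop \<G>) K" "\<And>\<sigma>. f \<sigma> \<noteq> 0 \<Longrightarrow> \<sigma> \<in> preimage \<Sigma> K"
  shows "f \<in> Cc_on K"
proof -
  have "gtop \<E> closure_of {\<sigma>. f \<sigma> \<noteq> 0} \<subseteq> preimage \<Sigma> K"
    using K by (intro closure_of_minimal closedin_preimage compactin_imp_closedin[OF G.Hausdorff]) blast
  then have "compactin (gtop \<E>) (gtop \<E> closure_of {\<sigma>. f \<sigma> \<noteq> 0})"
    using closed_compactin[OF compactin_preimage[OF K(1)]] by (meson closedin_closure_of)
  moreover have "equivariant_on \<Sigma> (arrows \<E>) f"
    using e K(2) unfolding equivariant_on_def by force
  ultimately show ?thesis using c K(2) by (auto simp: Cc_on_def Cc_def)
qed

lemma Cc_on_Cc: "f \<in> Cc_on K \<Longrightarrow> f \<in> Cc \<Sigma>"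
  and Cc_on_mono: "f \<in> Cc_on K \<Longrightarrow> K \<subseteq> L \<Longrightarrow> f \<in> Cc_on L"
  and Cc_on_support: "f \<in> Cc_on K \<Longrightarrow> p \<sigma> \<notin> K \<Longrightarrow> f \<sigma> = 0"
  unfolding Cc_on_def by auto

lemma Cc_D:
  assumes "f \<in> Cc \<Sigma>"
  shows "continuous_map (gtop \<E>) euclidean f"
    "\<And>\<sigma> z. \<lbrakk>\<sigma> \<in> arrows \<E>; cmod z = 1\<rbrakk> \<Longrightarrow> f (z \<star> \<sigma>) = z * f \<sigma>"
    "\<And>\<sigma>. \<sigma> \<notin> arrows \<E> \<Longrightarrow> f \<sigma> = 0"
  using assms unfolding Cc_def equivariant_on_def by auto

lemma closure_support:
  assumes "f \<in> Cc \<Sigma>"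
  shows "{\<sigma>. f \<sigma> \<noteq> 0} \<subseteq> gtop \<E> closure_of {\<sigma>. f \<sigma> \<noteq> 0}"
  using Cc_D(3)[OF assms] by (intro closure_of_subset) auto

lemma Cc_compact:
  assumes "f \<in> Cc \<Sigma>"
  obtains K where "compactin (gtop \<G>) K" "f \<in> Cc_on K"
proof -
  let ?S = "gtop \<E> closure_of {\<sigma>. f \<sigma> \<noteq> 0}"
  have "compactin (gtop \<E>) ?S" using assms by (simp add: Cc_def)
  then have "compactin (gtop \<G>) (p ` ?S)" using image_compactin proj_continuous by blast
  moreover have "f \<in> Cc_on (p ` ?S)"
    using assms closure_support[OF assms] Cc_D(3)[OF assms] by (auto simp: Cc_on_def)
  ultimately show ?thesis using that by blast
qed

lemma Cc_on_compact:
  assumes "f \<in> Cc_on L" "closedin (gtop \<G>) L"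
  obtains K where "compactin (gtop \<G>) K" "K \<subseteq> L" "f \<in> Cc_on K"
proof -
  obtain K where K: "compactin (gtop \<G>) K" "f \<in> Cc_on K"
    using Cc_compact Cc_on_Cc assms(1) by blast
  then have "f \<in> Cc_on (L \<inter> K)" using assms(1) by (auto simp: Cc_on_def)
  then show ?thesis using that[of "L \<inter> K"] closed_Int_compactin[OF assms(2) K(1)] by blast
qed

lemma Cc_add:
  assumes "f \<in> Cc_on K" "g \<in> Cc_on K" "compactin (gtop \<G>) K"
  shows "(\<lambda>\<sigma>. f \<sigma> + g \<sigma>) \<in> Cc_on K"
proof (rule Cc_onI)
  show "continuous_map (gtop \<E>) euclidean (\<lambda>\<sigma>. f \<sigma> + g \<sigma>)"
    using assms by (intro continuous_map_add Cc_D(1)) (auto simp: Cc_on_Cc)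
next
  fix \<sigma> assume "f \<sigma> + g \<sigma> \<noteq> 0"
  then have "f \<sigma> \<noteq> 0 \<or> g \<sigma> \<noteq> 0" by auto
  then show "\<sigma> \<in> preimage \<Sigma> K" using assms by (auto simp: Cc_on_def)
qed (use assms Cc_D(2)[OF Cc_on_Cc[OF assms(1)]] Cc_D(2)[OF Cc_on_Cc[OF assms(2)]]
    in \<open>auto simp: distrib_left\<close>)

lemma Cc_scale:
  assumes "f \<in> Cc_on K" "compactin (gtop \<G>) K"
  shows "(\<lambda>\<sigma>. c * f \<sigma>) \<in> Cc_on K"
proof (rule Cc_onI)
  show "continuous_map (gtop \<E>) euclidean (\<lambda>\<sigma>. c * f \<sigma>)"
    using Cc_D(1)[OF Cc_on_Cc[OF assms(1)]] by (intro continuous_map_complex_mult) simp_all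
qed (use assms Cc_D(2)[OF Cc_on_Cc[OF assms(1)]] in \<open>auto simp: Cc_on_def\<close>)

lemma Cc_zero: "(\<lambda>_. 0) \<in> Cc_on K"
proof -
  have "(\<lambda>_. 0) \<in> Cc_on {}" by (rule Cc_onI) auto
  then show ?thesis by (rule Cc_on_mono) simp
qed

lemma Cc_common_compact:
  assumes "f \<in> Cc \<Sigma>" "g \<in> Cc \<Sigma>"
  obtains K where "compactin (gtop \<G>) K" "f \<in> Cc_on K" "g \<in> Cc_on K"
proof -
  obtain K L where "compactin (gtop \<G>) K" "f \<in> Cc_on K" "compactin (gtop \<G>) L" "g \<in> Cc_on L"
    using Cc_compact assms by metis
  then show ?thesis
    by (intro that[of "K \<union> L"]) (auto simp: compactin_Un intro: Cc_on_mono)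
qed

lemma Cc_plus:
  assumes "f \<in> Cc \<Sigma>" "g \<in> Cc \<Sigma>"
  shows "(\<lambda>\<sigma>. f \<sigma> + g \<sigma>) \<in> Cc \<Sigma>"
proof -
  obtain K where "compactin (gtop \<G>) K" "f \<in> Cc_on K" "g \<in> Cc_on K"
    by (rule Cc_common_compact[OF assms])
  then show ?thesis using Cc_on_Cc[OF Cc_add] by blast
qed

lemma Cc_times: "f \<in> Cc \<Sigma> \<Longrightarrow> (\<lambda>\<sigma>. c * f \<sigma>) \<in> Cc \<Sigma>"
  by (rule Cc_compact) (auto intro: Cc_on_Cc[OF Cc_scale])

lemma Cc_minus:
  assumes "f \<in> Cc \<Sigma>" "g \<in> Cc \<Sigma>"
  shows "(\<lambda>\<sigma>. f \<sigma> - g \<sigma>) \<in> Cc \<Sigma>"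
  using Cc_plus[OF assms(1) Cc_times[OF assms(2), of "-1"]] by simp

text \<open>A compact open W is clopen, so continuity of \<open>f\<close> over W is enough. This
  yields compactly supported functions from functions that are not: from \<open>ev a\<close> for
  arbitrary a in A, and from inverses of functions that vanish elsewhere.\<close>

lemma Cc_restrictI:
  assumes W: "openin (gtop \<G>) W" "compactin (gtop \<G>) W"
    and c: "continuous_map (subtopology (gtop \<E>) (preimage \<Sigma> W)) euclidean f"
    and e: "\<And>\<sigma> z. \<lbrakk>\<sigma> \<in> arrows \<E>; p \<sigma> \<in> W; cmod z = 1\<rbrakk> \<Longrightarrow> f (z \<star> \<sigma>) = z * f \<sigma>"
  shows "(\<lambda>\<sigma>. if \<sigma> \<in> preimage \<Sigma> W then f \<sigma> else 0) \<in> Cc_on W"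
proof (rule Cc_onI)
  show "continuous_map (gtop \<E>) euclidean (\<lambda>\<sigma>. if \<sigma> \<in> preimage \<Sigma> W then f \<sigma> else 0)"
    by (rule continuous_map_cut[OF openin_preimage closedin_preimage c])
      (use W compactin_imp_closedin[OF G.Hausdorff] in auto)
qed (use W e in \<open>auto split: if_splits\<close>)

lemma Cc_cut:
  assumes f: "f \<in> Cc_on K" "compactin (gtop \<G>) K"
    and W: "openin (gtop \<G>) W" "closedin (gtop \<G>) W"
  shows "(\<lambda>\<sigma>. if p \<sigma> \<in> W then f \<sigma> else 0) \<in> Cc_on (K \<inter> W)"
proof (rule Cc_onI)
  have "continuous_map (gtop \<E>) euclidean (\<lambda>\<sigma>. if \<sigma> \<in> preimage \<Sigma> W then f \<sigma> else 0)"
    by (rule continuous_map_cut[OF openin_preimage closedin_preimage])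
      (use W continuous_map_from_subtopology[OF Cc_D(1)[OF Cc_on_Cc[OF f(1)]]] in auto)
  then show "continuous_map (gtop \<E>) euclidean (\<lambda>\<sigma>. if p \<sigma> \<in> W then f \<sigma> else 0)"
    by (rule continuous_map_eq) auto
  show "compactin (gtop \<G>) (K \<inter> W)"
    using f(2) W(2) by (rule compact_Int_closedin)
qed (use f Cc_D(2)[OF Cc_on_Cc[OF f(1)]] in \<open>auto simp: Cc_on_def split: if_splits\<close>)

text \<open>The substitute for a partition of unity: after splitting off a clopen set the remainder
  is again continuous and lives on fewer members of the cover. The cover need not be disjoint, and
  both summands stay over K, so one compact set serves throughout.\<close>

lemma Cc_induct:
  assumes f: "f \<in> Cc_on K" "compactin (gtop \<G>) K"
    and \<U>: "finite \<U>" "K \<subseteq> \<Union>\<U>" "\<And>U. U \<in> \<U> \<Longrightarrow> openin (gtop \<G>) U \<and> closedin (gtop \<G>) U"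
    and zero: "P (\<lambda>_. 0)"
    and add: "\<And>f g. \<lbrakk>f \<in> Cc_on K; g \<in> Cc_on K; P f; P g\<rbrakk> \<Longrightarrow> P (\<lambda>\<sigma>. f \<sigma> + g \<sigma>)"
    and single: "\<And>f U. \<lbrakk>U \<in> \<U>; f \<in> Cc_on (K \<inter> U)\<rbrakk> \<Longrightarrow> P f"
  shows "P f"
proof -
  \<comment> \<open>The induction tracks where f is nonzero instead of the set K, because after a
    cut the remainder is covered by one set fewer while K is not.\<close>
  have "P f" if "finite \<V>" "\<V> \<subseteq> \<U>" "f \<in> Cc_on K" "\<And>\<sigma>. f \<sigma> \<noteq> 0 \<Longrightarrow> p \<sigma> \<in> \<Union>\<V>" for \<V> f
    using that
  proof (induction \<V> arbitrary: f rule: finite_induct)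
    case empty
    then have "f = (\<lambda>_. 0)" by auto
    then show ?case using zero by simp
  next
    case (insert U \<V>)
    have U: "openin (gtop \<G>) U" "closedin (gtop \<G>) U" using \<U>(3) insert.prems by auto
    have C: "openin (gtop \<G>) (arrows \<G> - U)" "closedin (gtop \<G>) (arrows \<G> - U)"
      using U by auto
    let ?f1 = "\<lambda>\<sigma>. if p \<sigma> \<in> U then f \<sigma> else 0"
    let ?f2 = "\<lambda>\<sigma>. if p \<sigma> \<in> arrows \<G> - U then f \<sigma> else 0"
    have 1: "?f1 \<in> Cc_on (K \<inter> U)" and 2: "?f2 \<in> Cc_on (K \<inter> (arrows \<G> - U))"
      using Cc_cut[OF insert.prems(2) f(2) U] Cc_cut[OF insert.prems(2) f(2) C] by auto
    have "P ?f1" using 1 insert.prems(1) by (intro single) auto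
    moreover have "P ?f2"
      using insert.prems(1,3) Cc_on_mono[OF 2, of K] by (intro insert.IH) (auto split: if_splits)
    ultimately have "P (\<lambda>\<sigma>. ?f1 \<sigma> + ?f2 \<sigma>)"
      using Cc_on_mono[OF 1, of K] Cc_on_mono[OF 2, of K] by (intro add) auto
    also have "(\<lambda>\<sigma>. ?f1 \<sigma> + ?f2 \<sigma>) = f"
    proof
      fix \<sigma> show "?f1 \<sigma> + ?f2 \<sigma> = f \<sigma>"
        using Cc_D(3)[OF Cc_on_Cc[OF insert.prems(2)]] by (cases "\<sigma> \<in> arrows \<E>") auto
    qed
    finally show ?case .
  qed
  moreover have "\<And>\<sigma>. f \<sigma> \<noteq> 0 \<Longrightarrow> p \<sigma> \<in> \<Union>\<U>" using f(1) \<U>(2) by (auto simp: Cc_on_def)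
  ultimately show ?thesis using \<U>(1) f(1) by blast
qed

text \<open>A section \<open>k\<close> trivializes the twist over U: every arrow over U is
  \<open>z \<star> k g\<close> for a unique z, and \<open>u\<close> is this coordinate. It is
  continuous because \<sigma> times the inverse of \<open>k (p \<sigma>)\<close> lies over the
  units, where the inverse of \<open>incl\<close> recovers z.\<close>

lemma section_function:
  assumes U: "openin (gtop \<G>) U" "compactin (gtop \<G>) U"
    and k: "continuous_map (subtopology (gtop \<G>) U) (gtop \<E>) k"
      "\<And>g. g \<in> U \<Longrightarrow> p (k g) = g" "\<And>g. g \<in> U \<Longrightarrow> k g \<in> arrows \<E>"
  obtains u where "u \<in> Cc_on U" "\<And>g z. \<lbrakk>g \<in> U; cmod z = 1\<rbrakk> \<Longrightarrow> u (z \<star> k g) = z"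
proof -
  let ?S = "subtopology (gtop \<E>) (preimage \<Sigma> U)"
  obtain J where J: "homeomorphic_maps (prod_topology (subtopology (gtop \<G>) (units \<G>)) (top_of_set circle))
     (subtopology (gtop \<E>) (preimage \<Sigma> (units \<G>))) (incl \<Sigma>) J"
    using incl_homeo by (auto simp: homeomorphic_map_maps)
  have Jincl: "J (incl \<Sigma> (x, z)) = (x, z)" if "x \<in> units \<G>" "cmod z = 1" for x z
    using J that by (auto simp: homeomorphic_maps_def)
  define v where "v \<sigma> = snd (J (\<sigma> \<cdot> inv\<^sub>E (k (p \<sigma>))))" for \<sigma>
  have v: "v (z \<star> k g) = z" if "g \<in> U" "cmod z = 1" for g z
  proof -
    have "g \<in> arrows \<G>" using that U openin_subset by blast
    then have "(z \<star> k g) \<cdot> inv\<^sub>E (k g) = incl \<Sigma> (gran \<G> g, z)"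
      using that k by (simp add: circle_act_def)
    then show ?thesis using that k \<open>g \<in> arrows \<G>\<close> by (simp add: v_def Jincl)
  qed
  have pc: "continuous_map ?S (subtopology (gtop \<G>) U) p"
    by (auto simp: continuous_map_in_subtopology continuous_map_from_subtopology[OF proj_continuous])
  have "continuous_map ?S (gtop \<E>) (\<lambda>\<sigma>. inv\<^sub>E (k (p \<sigma>)))"
    using continuous_map_compose[OF continuous_map_compose[OF pc k(1)] E.continuous_map_inv]
    by (simp add: o_def)
  then have "continuous_map ?S (gtop \<E>) (\<lambda>\<sigma>. \<sigma> \<cdot> inv\<^sub>E (k (p \<sigma>)))"
    by (rule E.continuous_map_mult[OF continuous_map_id_subt[unfolded id_def]]) (use k in auto)
  then have "continuous_map ?S (subtopology (gtop \<E>) (preimage \<Sigma> (units \<G>))) (\<lambda>\<sigma>. \<sigma> \<cdot> inv\<^sub>E (k (p \<sigma>)))"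
    using k by (auto simp: continuous_map_in_subtopology)
  moreover have "continuous_map (subtopology (gtop \<E>) (preimage \<Sigma> (units \<G>))) euclidean (snd \<circ> J)"
    using J continuous_map_compose[of _ _ J, OF _ continuous_map_snd]
    by (fastforce simp: homeomorphic_maps_def dest: continuous_map_into_fulltopology)
  ultimately have vc: "continuous_map ?S euclidean v"
    unfolding v_def using continuous_map_compose by (fastforce simp: o_def)
  have ve: "v (z \<star> \<sigma>) = z * v \<sigma>" if s: "\<sigma> \<in> arrows \<E>" "p \<sigma> \<in> U" "cmod z = 1" for \<sigma> z
  proof -
    obtain w where w: "cmod w = 1" "\<sigma> = w \<star> k (p \<sigma>)"
      using same_fibre[of "k (p \<sigma>)" \<sigma>] k s by auto
    have "z \<star> \<sigma> = (z * w) \<star> k (p \<sigma>)"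
      using w s k act_act by metis
    moreover have "cmod (z * w) = 1" using w s by (simp add: norm_mult)
    ultimately show ?thesis using v[of "p \<sigma>"] w s by metis
  qed
  show ?thesis
  proof (rule that[of "\<lambda>\<sigma>. if \<sigma> \<in> preimage \<Sigma> U then v \<sigma> else 0"])
    show "(\<lambda>\<sigma>. if \<sigma> \<in> preimage \<Sigma> U then v \<sigma> else 0) \<in> Cc_on U"
      by (rule Cc_restrictI[OF U vc ve])
  qed (use v k in auto)
qed

definition unit_supported :: "('e \<Rightarrow> complex) set" where
  "unit_supported = Cc_on (units \<G>)"

text \<open>A function on the units is described by \<open>x \<mapsto> h (one x)\<close>; in this
  picture \<open>h\<close> is the characteristic function of K, obtained from the section
  \<open>one\<close>. These are the projections of D by which normalizers are cut.\<close>

lemma unit_indicator: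
  assumes K: "openin (gtop \<G>) K" "compactin (gtop \<G>) K" "K \<subseteq> units \<G>"
  obtains h where "h \<in> Cc_on K" "h \<in> unit_supported" "\<And>x z. \<lbrakk>x \<in> K; cmod z = 1\<rbrakk> \<Longrightarrow> h (incl \<Sigma> (x, z)) = z"
proof -
  have "continuous_map (subtopology (gtop \<G>) K)
    (prod_topology (subtopology (gtop \<G>) (units \<G>)) (top_of_set circle)) (\<lambda>x. (x, 1))"
    using K by (auto simp: continuous_map_paired continuous_map_in_subtopology
      intro!: continuous_map_from_subtopology continuous_map_id[unfolded id_def])
  from continuous_map_compose[OF this homeomorphic_imp_continuous_map[OF incl_homeo]]
  have c: "continuous_map (subtopology (gtop \<G>) K) (gtop \<E>) (\<lambda>x. one x)"
    by (simp add: o_def continuous_map_in_subtopology)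
  obtain h where h: "h \<in> Cc_on K" "\<And>x z. \<lbrakk>x \<in> K; cmod z = 1\<rbrakk> \<Longrightarrow> h (z \<star> one x) = z"
    by (rule section_function[OF K(1,2) c]) (use K in auto)
  have "z \<star> one x = incl \<Sigma> (x, z)" if "x \<in> K" "cmod z = 1" for x z
    using that K by (auto simp: circle_act_def)
  with h that K show ?thesis by (metis Cc_on_mono unit_supported_def)
qed

text \<open>The compact open bisections over which the twist is trivial.\<close>

definition sectioned :: "'g set \<Rightarrow> bool" where
  "sectioned U \<longleftrightarrow> G.compact_open_bisection U \<and>
     (\<exists>k. continuous_map (subtopology (gtop \<G>) U) (gtop \<E>) k \<and> (\<forall>h\<in>U. p (k h) = h \<and> k h \<in> arrows \<E>))"

lemma sectioned_basis:
  assumes "openin (gtop \<G>) W" "g \<in> W"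
  obtains U where "sectioned U" "g \<in> U" "U \<subseteq> W"
proof (rule ample_section[OF assms])
  fix U k assume "G.compact_open_bisection U" "g \<in> U" "U \<subseteq> W"
    "continuous_map (subtopology (gtop \<G>) U) (gtop \<E>) k"
    "\<And>h. h \<in> U \<Longrightarrow> p (k h) = h" "\<And>h. h \<in> U \<Longrightarrow> k h \<in> arrows \<E>"
  then show thesis by (intro that[of U]) (auto simp: sectioned_def)
qed

lemma sectioned_cover:
  assumes K: "compactin (gtop \<G>) K" and W: "openin (gtop \<G>) W" "K \<subseteq> W"
  obtains \<U> where "finite \<U>" "\<And>U. U \<in> \<U> \<Longrightarrow> sectioned U \<and> U \<subseteq> W" "K \<subseteq> \<Union>\<U>"
proof -
  let ?\<C> = "{U. sectioned U \<and> U \<subseteq> W}"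
  have "K \<subseteq> \<Union>?\<C>"
  proof
    fix g assume "g \<in> K"
    then obtain U where "sectioned U" "g \<in> U" "U \<subseteq> W" using sectioned_basis W by blast
    then show "g \<in> \<Union>?\<C>" by blast
  qed
  moreover have "openin (gtop \<G>) U" if "U \<in> ?\<C>" for U
    using that by (auto simp: sectioned_def G.compact_open_bisectionD)
  ultimately obtain \<U> where "finite \<U>" "\<U> \<subseteq> ?\<C>" "K \<subseteq> \<Union>\<U>"
    using compactinD[OF K, of ?\<C>] by blast
  then show ?thesis using that by blast
qed

lemma sectionedD:
  assumes "sectioned U"
  shows "openin (gtop \<G>) U" "compactin (gtop \<G>) U" "closedin (gtop \<G>) U" "G.bisection U"
    "U \<subseteq> arrows \<G>" "G.compact_open_bisection U"
  using assms G.compact_open_bisectionD unfolding sectioned_def by blast+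

text \<open>The coordinate of a trivialization is unimodular, so it witnesses every arrow of U by a
  value far from zero.\<close>

lemma bump:
  assumes "sectioned U"
  obtains u where "u \<in> Cc_on U" "\<And>\<sigma>. \<sigma> \<in> preimage \<Sigma> U \<Longrightarrow> cmod (u \<sigma>) = 1"
proof -
  obtain k where k: "continuous_map (subtopology (gtop \<G>) U) (gtop \<E>) k"
    "\<And>h. h \<in> U \<Longrightarrow> p (k h) = h" "\<And>h. h \<in> U \<Longrightarrow> k h \<in> arrows \<E>"
    using assms unfolding sectioned_def by blast
  note U = sectionedD[OF assms]
  obtain u where u: "u \<in> Cc_on U" "\<And>g z. \<lbrakk>g \<in> U; cmod z = 1\<rbrakk> \<Longrightarrow> u (z \<star> k g) = z"
    by (rule section_function[OF U(1,2) k]) auto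
  have "cmod (u \<sigma>) = 1" if s: "\<sigma> \<in> preimage \<Sigma> U" for \<sigma>
  proof -
    obtain w where w: "cmod w = 1" "\<sigma> = w \<star> k (p \<sigma>)"
      using same_fibre[of "k (p \<sigma>)" \<sigma>] k s by auto
    then show ?thesis using u(2)[of "p \<sigma>" w] s by auto
  qed
  with u(1) that show ?thesis by blast
qed

end

section \<open>Convolution\<close>

context ample_twist begin

text \<open>A bisection has at most one arrow with a given source and at most one with a given
  range, so N can be the number of bisections in a finite cover of K. The bound does not depend on
  x, which keeps the regular representations uniformly bounded.\<close>

lemma compact_fibre_bound:
  assumes K: "compactin (gtop \<G>) K"
  obtains N where
    "\<And>x. finite {\<gamma> \<in> K. gdom \<G> \<gamma> = x}" "\<And>x. card {\<gamma> \<in> K. gdom \<G> \<gamma> = x} \<le> N"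
    "\<And>x. finite {\<gamma> \<in> K. gran \<G> \<gamma> = x}" "\<And>x. card {\<gamma> \<in> K. gran \<G> \<gamma> = x} \<le> N"
proof -
  obtain \<U> where \<U>: "finite \<U>" "\<And>U. U \<in> \<U> \<Longrightarrow> sectioned U" "K \<subseteq> \<Union>\<U>"
    using sectioned_cover[OF K openin_topspace] compactin_subset_topspace[OF K] by metis
  have "\<forall>\<gamma>. \<gamma> \<in> K \<longrightarrow> (\<exists>U. U \<in> \<U> \<and> \<gamma> \<in> U)" using \<U>(3) by blast
  then obtain c where c: "\<gamma> \<in> K \<Longrightarrow> c \<gamma> \<in> \<U> \<and> \<gamma> \<in> c \<gamma>" for \<gamma> by metis
  have bis: "G.bisection U" if "U \<in> \<U>" for U using \<U>(2) that by (simp add: sectionedD)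
  have 1: "inj_on c {\<gamma> \<in> K. gdom \<G> \<gamma> = x}" "inj_on c {\<gamma> \<in> K. gran \<G> \<gamma> = x}" for x
  proof -
    show "inj_on c {\<gamma> \<in> K. gdom \<G> \<gamma> = x}"
    proof (rule inj_onI)
      fix g h assume a: "g \<in> {\<gamma> \<in> K. gdom \<G> \<gamma> = x}" "h \<in> {\<gamma> \<in> K. gdom \<G> \<gamma> = x}" "c g = c h"
      then have "inj_on (gdom \<G>) (c g)" using bis[of "c g"] c[of g] by (auto simp: G.bisection_def)
      then show "g = h" by (rule inj_onD) (use a c[of g] c[of h] in auto)
    qed
    show "inj_on c {\<gamma> \<in> K. gran \<G> \<gamma> = x}"
    proof (rule inj_onI)
      fix g h assume a: "g \<in> {\<gamma> \<in> K. gran \<G> \<gamma> = x}" "h \<in> {\<gamma> \<in> K. gran \<G> \<gamma> = x}" "c g = c h"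
      then have "inj_on (gran \<G>) (c g)" using bis[of "c g"] c[of g] by (auto simp: G.bisection_def)
      then show "g = h" by (rule inj_onD) (use a c[of g] c[of h] in auto)
    qed
  qed
  have 2: "c ` {\<gamma> \<in> K. P \<gamma>} \<subseteq> \<U>" for P using c by auto
  show ?thesis
    using that[of "card \<U>"] inj_on_finite[OF 1(1) 2 \<U>(1)] inj_on_finite[OF 1(2) 2 \<U>(1)]
      card_inj_on_le[OF 1(1) 2 \<U>(1)] card_inj_on_le[OF 1(2) 2 \<U>(1)] by blast
qed

lemma Cc_bounded:
  assumes "f \<in> Cc \<Sigma>"
  obtains M where "M \<ge> 0" "\<And>\<sigma>. cmod (f \<sigma>) \<le> M"
proof -
  obtain K where K: "compactin (gtop \<G>) K" "f \<in> Cc_on K" using Cc_compact[OF assms] .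
  have "compact (f ` preimage \<Sigma> K)"
    using image_compactin[OF compactin_preimage[OF K(1)] Cc_D(1)[OF assms]] by simp
  then obtain M where M: "\<And>\<sigma>. \<sigma> \<in> preimage \<Sigma> K \<Longrightarrow> cmod (f \<sigma>) \<le> M"
    using compact_imp_bounded bounded_iff by (metis image_eqI)
  have "cmod (f \<sigma>) \<le> max 0 M" for \<sigma>
    using M[of \<sigma>] K(2) by (cases "f \<sigma> = 0") (auto simp: Cc_on_def)
  then show ?thesis using that[of "max 0 M"] by auto
qed

lemma source_fibre_iff [simp]: "\<gamma> \<in> source_fibre \<Sigma> x \<longleftrightarrow> \<gamma> \<in> arrows \<G> \<and> gdom \<G> \<gamma> = x"
  by (simp add: source_fibre_def)

text \<open>Nothing is assumed of f and g apart from the vanishing products, so this applies equally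
  to functions in \<open>Cc \<Sigma>\<close> and to vectors of the regular representations.\<close>

lemma convolution_sum:
  assumes "\<sigma> \<in> arrows \<E>" "finite F" "F \<subseteq> source_fibre \<Sigma> (src \<sigma>)"
    "\<And>\<gamma>. \<lbrakk>\<gamma> \<in> arrows \<G>; gdom \<G> \<gamma> = src \<sigma>; \<gamma> \<notin> F\<rbrakk> \<Longrightarrow> f (\<sigma> \<cdot> inv\<^sub>E (lift \<Sigma> \<gamma>)) * g (lift \<Sigma> \<gamma>) = 0"
  shows "convolution \<Sigma> f g \<sigma> = (\<Sum>\<gamma>\<in>F. f (\<sigma> \<cdot> inv\<^sub>E (lift \<Sigma> \<gamma>)) * g (lift \<Sigma> \<gamma>))"
proof -
  have "convolution \<Sigma> f g \<sigma> =
      (\<Sum>\<^sub>\<infinity>\<gamma>\<in>source_fibre \<Sigma> (src \<sigma>). f (\<sigma> \<cdot> inv\<^sub>E (lift \<Sigma> \<gamma>)) * g (lift \<Sigma> \<gamma>))"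
    using assms(1) by (simp add: convolution_def)
  also have "\<dots> = (\<Sum>\<^sub>\<infinity>\<gamma>\<in>F. f (\<sigma> \<cdot> inv\<^sub>E (lift \<Sigma> \<gamma>)) * g (lift \<Sigma> \<gamma>))"
    by (rule infsum_cong_neutral) (use assms in auto)
  finally show ?thesis using assms(2) by simp
qed

lemma Cc_on_fibre:
  assumes "g \<in> Cc_on K" "compactin (gtop \<G>) K"
  shows "finite (source_fibre \<Sigma> x \<inter> K)"
    "\<gamma> \<in> arrows \<G> \<Longrightarrow> \<gamma> \<notin> source_fibre \<Sigma> (gdom \<G> \<gamma>) \<inter> K \<Longrightarrow> g (lift \<Sigma> \<gamma>) = 0"
proof -
  obtain N where N: "\<And>x. finite {\<gamma> \<in> K. gdom \<G> \<gamma> = x}"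
    using compact_fibre_bound[OF assms(2)] by metis
  have "source_fibre \<Sigma> x \<inter> K \<subseteq> {\<gamma> \<in> K. gdom \<G> \<gamma> = x}" by auto
  then show "finite (source_fibre \<Sigma> x \<inter> K)" using N finite_subset by blast
  show "\<gamma> \<in> arrows \<G> \<Longrightarrow> \<gamma> \<notin> source_fibre \<Sigma> (gdom \<G> \<gamma>) \<inter> K \<Longrightarrow> g (lift \<Sigma> \<gamma>) = 0"
    using Cc_on_support[OF assms(1), of "lift \<Sigma> \<gamma>"] by auto
qed

lemma convolution_Cc_on:
  assumes "g \<in> Cc_on K" "compactin (gtop \<G>) K" "\<sigma> \<in> arrows \<E>"
  shows "convolution \<Sigma> f g \<sigma> =
    (\<Sum>\<gamma>\<in>source_fibre \<Sigma> (src \<sigma>) \<inter> K. f (\<sigma> \<cdot> inv\<^sub>E (lift \<Sigma> \<gamma>)) * g (lift \<Sigma> \<gamma>))"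
  by (rule convolution_sum)
    (use assms(3) Cc_on_fibre[OF assms(1,2)] in auto)

lemma convolution_outside: "\<sigma> \<notin> arrows \<E> \<Longrightarrow> convolution \<Sigma> f g \<sigma> = 0"
  by (simp add: convolution_def)

lemma convolution_add_right:
  assumes "g \<in> Cc_on K" "h \<in> Cc_on K" "compactin (gtop \<G>) K"
  shows "convolution \<Sigma> f (\<lambda>\<sigma>. g \<sigma> + h \<sigma>) = (\<lambda>\<sigma>. convolution \<Sigma> f g \<sigma> + convolution \<Sigma> f h \<sigma>)"
proof
  fix \<sigma>
  show "convolution \<Sigma> f (\<lambda>\<sigma>. g \<sigma> + h \<sigma>) \<sigma> = convolution \<Sigma> f g \<sigma> + convolution \<Sigma> f h \<sigma>"
    using convolution_Cc_on[OF assms(1,3), of \<sigma> f] convolution_Cc_on[OF assms(2,3), of \<sigma> f]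
      convolution_Cc_on[OF Cc_add[OF assms] assms(3), of \<sigma> f]
    by (cases "\<sigma> \<in> arrows \<E>") (simp_all add: convolution_outside distrib_left sum.distrib)
qed

text \<open>Replacing the chosen lift of \<open>p \<tau>\<close> by \<open>\<tau>\<close> changes
  the two factors by conjugate scalars of modulus one, so any lift may be used to compute the
  term.\<close>

lemma convolution_single:
  assumes f: "f \<in> Cc \<Sigma>" and g: "g \<in> Cc \<Sigma>"
    and s: "\<sigma> \<in> arrows \<E>" and t: "\<tau> \<in> arrows \<E>" "src \<sigma> = src \<tau>"
    and 0: "\<And>\<gamma>. \<lbrakk>\<gamma> \<in> arrows \<G>; gdom \<G> \<gamma> = src \<sigma>; \<gamma> \<noteq> p \<tau>\<rbrakk> \<Longrightarrow>
      f (\<sigma> \<cdot> inv\<^sub>E (lift \<Sigma> \<gamma>)) * g (lift \<Sigma> \<gamma>) = 0"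
  shows "convolution \<Sigma> f g \<sigma> = f (\<sigma> \<cdot> inv\<^sub>E \<tau>) * g \<tau>"
proof -
  have "convolution \<Sigma> f g \<sigma> = (\<Sum>\<gamma>\<in>{p \<tau>}. f (\<sigma> \<cdot> inv\<^sub>E (lift \<Sigma> \<gamma>)) * g (lift \<Sigma> \<gamma>))"
    by (rule convolution_sum) (use assms in auto)
  then have eq: "convolution \<Sigma> f g \<sigma> = f (\<sigma> \<cdot> inv\<^sub>E (lift \<Sigma> (p \<tau>))) * g (lift \<Sigma> (p \<tau>))" by simp
  obtain z where z: "cmod z = 1" "lift \<Sigma> (p \<tau>) = z \<star> \<tau>"
    using same_fibre[of \<tau> "lift \<Sigma> (p \<tau>)"] t by auto
  have "\<sigma> \<cdot> inv\<^sub>E (z \<star> \<tau>) = cnj z \<star> (\<sigma> \<cdot> inv\<^sub>E \<tau>)"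
    using s t z(1) by (simp add: inv_act act_mult_right)
  then have "f (\<sigma> \<cdot> inv\<^sub>E (lift \<Sigma> (p \<tau>))) = cnj z * f (\<sigma> \<cdot> inv\<^sub>E \<tau>)"
    using s t z Cc_D(2)[OF f] by simp
  moreover have "g (lift \<Sigma> (p \<tau>)) = z * g \<tau>" using t z Cc_D(2)[OF g] by simp
  ultimately have "convolution \<Sigma> f g \<sigma> = (cnj z * z) * (f (\<sigma> \<cdot> inv\<^sub>E \<tau>) * g \<tau>)"
    unfolding eq by simp
  then show ?thesis using cnj_mult_circle(2)[OF z(1)] by simp
qed

lemma convolution_act:
  assumes "f \<in> Cc \<Sigma>" "g \<in> Cc \<Sigma>" "\<sigma> \<in> arrows \<E>" "cmod z = 1"
  shows "convolution \<Sigma> f g (z \<star> \<sigma>) = z * convolution \<Sigma> f g \<sigma>"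
proof -
  obtain K where K: "compactin (gtop \<G>) K" "g \<in> Cc_on K" using Cc_compact[OF assms(2)] .
  have "f ((z \<star> \<sigma>) \<cdot> inv\<^sub>E (lift \<Sigma> \<gamma>)) = z * f (\<sigma> \<cdot> inv\<^sub>E (lift \<Sigma> \<gamma>))"
    if "\<gamma> \<in> source_fibre \<Sigma> (src \<sigma>)" for \<gamma>
    using that assms Cc_D(2)[OF assms(1), of "\<sigma> \<cdot> inv\<^sub>E (lift \<Sigma> \<gamma>)" z] by (simp add: act_mult_left)
  then show ?thesis
    using assms convolution_Cc_on[OF K(2,1), of _ f]
    by (simp add: sum_distrib_left mult.assoc)
qed

lemma convolution_support:
  assumes "f \<in> Cc_on K" "g \<in> Cc_on L" "convolution \<Sigma> f g \<sigma> \<noteq> 0"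
  shows "\<sigma> \<in> preimage \<Sigma> (G.products K L)"
proof -
  have s: "\<sigma> \<in> arrows \<E>" using assms(3) convolution_outside by blast
  obtain \<gamma> where g: "\<gamma> \<in> source_fibre \<Sigma> (src \<sigma>)" "f (\<sigma> \<cdot> inv\<^sub>E (lift \<Sigma> \<gamma>)) * g (lift \<Sigma> \<gamma>) \<noteq> 0"
  proof (rule ccontr)
    assume "\<not> thesis"
    then have "\<forall>\<gamma>\<in>source_fibre \<Sigma> (src \<sigma>). f (\<sigma> \<cdot> inv\<^sub>E (lift \<Sigma> \<gamma>)) * g (lift \<Sigma> \<gamma>) = 0"
      using that by blast
    then have "convolution \<Sigma> f g \<sigma> = 0"
      using s unfolding convolution_def by (auto intro!: infsum_0)
    then show False using assms(3) by simp
  qed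
  then have "gmult \<G> (p \<sigma>) (ginv \<G> \<gamma>) \<in> K" "\<gamma> \<in> L"
    using s Cc_on_support[OF assms(1), of "\<sigma> \<cdot> inv\<^sub>E (lift \<Sigma> \<gamma>)"] Cc_on_support[OF assms(2), of "lift \<Sigma> \<gamma>"]
    by auto
  moreover have "p \<sigma> = gmult \<G> (gmult \<G> (p \<sigma>) (ginv \<G> \<gamma>)) \<gamma>" using s g by simp
  moreover have "gdom \<G> (gmult \<G> (p \<sigma>) (ginv \<G> \<gamma>)) = gran \<G> \<gamma>" using s g by simp
  ultimately have "p \<sigma> \<in> G.products K L" unfolding G.products_def by blast
  then show ?thesis using s by simp
qed

text \<open>Only the arrow of U with the source of \<sigma> can contribute. It depends continuously
  on \<sigma> through the inverse of the source map on U, and \<open>k\<close> lifts it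
  continuously, which the arbitrary choice \<open>lift\<close> need not do. Where U has no arrow
  with this source, which is a clopen condition, the convolution vanishes.\<close>

lemma convolution_continuous_sectioned:
  assumes f: "f \<in> Cc \<Sigma>" and U: "sectioned U" and g: "g \<in> Cc_on U"
  shows "continuous_map (gtop \<E>) euclidean (convolution \<Sigma> f g)"
proof -
  note U' = sectionedD[OF U]
  obtain k where k: "continuous_map (subtopology (gtop \<G>) U) (gtop \<E>) k"
    "\<And>h. h \<in> U \<Longrightarrow> p (k h) = h" "\<And>h. h \<in> U \<Longrightarrow> k h \<in> arrows \<E>"
    using U unfolding sectioned_def by blast
  obtain s where s: "continuous_map (subtopology (gtop \<G>) (gdom \<G> ` U)) (subtopology (gtop \<G>) U) s"
    "\<And>g. g \<in> U \<Longrightarrow> s (gdom \<G> g) = g"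
    by (rule G.dom_inverse_continuous[OF U'(6)]) blast
  have sc: "continuous_map (gtop \<E>) (gtop \<G>) (\<lambda>\<sigma>. src \<sigma>)"
    using continuous_map_compose[OF proj_continuous G.continuous_map_dom] by (simp add: o_def)
  let ?O = "{\<sigma> \<in> arrows \<E>. src \<sigma> \<in> gdom \<G> ` U}"
  let ?S = "subtopology (gtop \<E>) ?O"
  have O: "openin (gtop \<E>) ?O" "closedin (gtop \<E>) ?O"
    using G.clopen_dom_image[OF U'(6)] openin_continuous_map_preimage[OF sc]
      closedin_continuous_map_preimage[OF sc] by auto
  have "continuous_map ?S (subtopology (gtop \<G>) (gdom \<G> ` U)) (\<lambda>\<sigma>. src \<sigma>)"
    by (auto simp: continuous_map_in_subtopology continuous_map_from_subtopology[OF sc])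
  from continuous_map_compose[OF this s(1)]
  have c1: "continuous_map ?S (subtopology (gtop \<G>) U) (\<lambda>\<sigma>. s (src \<sigma>))" by (simp add: o_def)
  from continuous_map_compose[OF this k(1)]
  have c2: "continuous_map ?S (gtop \<E>) (\<lambda>\<sigma>. k (s (src \<sigma>)))" by (simp add: o_def)
  have su: "s (src \<sigma>) \<in> U" "gdom \<G> (s (src \<sigma>)) = src \<sigma>" if "\<sigma> \<in> ?O" for \<sigma>
    using that s(2) by auto
  have c3: "continuous_map ?S (gtop \<E>) (\<lambda>\<sigma>. inv\<^sub>E (k (s (src \<sigma>))))"
    using continuous_map_compose[OF c2 E.continuous_map_inv] by (simp add: o_def)
  have "continuous_map ?S (gtop \<E>) (\<lambda>\<sigma>. \<sigma> \<cdot> inv\<^sub>E (k (s (src \<sigma>))))"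
    by (rule E.continuous_map_mult[OF continuous_map_id_subt[unfolded id_def] c3])
      (use su k U'(5) in \<open>auto simp: subset_iff\<close>)
  from continuous_map_compose[OF this Cc_D(1)[OF f]] continuous_map_compose[OF c2 Cc_D(1)[OF Cc_on_Cc[OF g]]]
  have c4: "continuous_map ?S euclidean (\<lambda>\<sigma>. f (\<sigma> \<cdot> inv\<^sub>E (k (s (src \<sigma>)))) * g (k (s (src \<sigma>))))"
    by (intro continuous_map_complex_mult) (simp_all add: o_def)
  have "continuous_map (gtop \<E>) euclidean
     (\<lambda>\<sigma>. if \<sigma> \<in> ?O then f (\<sigma> \<cdot> inv\<^sub>E (k (s (src \<sigma>)))) * g (k (s (src \<sigma>))) else 0)"
    by (rule continuous_map_cut[OF O c4]) simp
  moreover have "(if \<sigma> \<in> ?O then f (\<sigma> \<cdot> inv\<^sub>E (k (s (src \<sigma>)))) * g (k (s (src \<sigma>))) else 0)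
      = convolution \<Sigma> f g \<sigma>" if \<sigma>: "\<sigma> \<in> arrows \<E>" for \<sigma>
  proof (cases "\<sigma> \<in> ?O")
    case True
    have "convolution \<Sigma> f g \<sigma> = f (\<sigma> \<cdot> inv\<^sub>E (k (s (src \<sigma>)))) * g (k (s (src \<sigma>)))"
    proof (rule convolution_single[OF f Cc_on_Cc[OF g] \<sigma>])
      fix \<gamma> assume a: "\<gamma> \<in> arrows \<G>" "gdom \<G> \<gamma> = src \<sigma>" "\<gamma> \<noteq> p (k (s (src \<sigma>)))"
      then have "\<gamma> \<notin> U"
        using G.bisection_domD[OF U'(4), of \<gamma> "s (src \<sigma>)"] su[OF True] k(2) by auto
      then show "f (\<sigma> \<cdot> inv\<^sub>E (lift \<Sigma> \<gamma>)) * g (lift \<Sigma> \<gamma>) = 0"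
        using Cc_on_support[OF g, of "lift \<Sigma> \<gamma>"] a by simp
    qed (use su[OF True] k in auto)
    with True show ?thesis by simp
  next
    case False
    then have "source_fibre \<Sigma> (src \<sigma>) \<inter> U = {}" using \<sigma> by (auto, metis imageI)
    then have "convolution \<Sigma> f g \<sigma> = 0" using convolution_Cc_on[OF g U'(2) \<sigma>, of f] by simp
    with False show ?thesis by (simp only: if_False)
  qed
  ultimately show ?thesis by (rule continuous_map_eq)
qed

text \<open>Additivity in g reduces continuity to functions g on sectioned sets; the support is
  bounded for general g by the products of the two compact sets.\<close>

lemma convolution_Cc:
  assumes f: "f \<in> Cc_on K" "compactin (gtop \<G>) K" and g: "g \<in> Cc_on L" "compactin (gtop \<G>) L"
  shows "convolution \<Sigma> f g \<in> Cc_on (G.products K L)"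
proof (rule Cc_onI)
  obtain \<U> where \<U>: "finite \<U>" "\<And>U. U \<in> \<U> \<Longrightarrow> sectioned U" "L \<subseteq> \<Union>\<U>"
    using sectioned_cover[OF g(2) openin_topspace] compactin_subset_topspace[OF g(2)] by metis
  show "continuous_map (gtop \<E>) euclidean (convolution \<Sigma> f g)"
  proof (rule Cc_induct[OF g \<U>(1,3)])
    fix U h assume "U \<in> \<U>" "h \<in> Cc_on (L \<inter> U)"
    then show "continuous_map (gtop \<E>) euclidean (convolution \<Sigma> f h)"
      using \<U>(2) Cc_on_mono[of h "L \<inter> U" U] convolution_continuous_sectioned[OF Cc_on_Cc[OF f(1)]] by auto
  next
    have "convolution \<Sigma> f (\<lambda>_. 0) = (\<lambda>_. 0)" by (auto simp: convolution_def)
    then show "continuous_map (gtop \<E>) euclidean (convolution \<Sigma> f (\<lambda>_. 0))" by simp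
  next
    fix h h' assume h: "h \<in> Cc_on L" "h' \<in> Cc_on L"
      "continuous_map (gtop \<E>) euclidean (convolution \<Sigma> f h)"
      "continuous_map (gtop \<E>) euclidean (convolution \<Sigma> f h')"
    then show "continuous_map (gtop \<E>) euclidean (convolution \<Sigma> f (\<lambda>\<sigma>. h \<sigma> + h' \<sigma>))"
      by (simp only: convolution_add_right[OF h(1,2) g(2)] continuous_map_add)
  qed (use \<U>(2) sectionedD in blast)
qed (use assms convolution_support convolution_act G.compactin_products Cc_on_Cc in \<open>auto simp del: preimage_iff\<close>)

lemma convolution_in_Cc:
  assumes "f \<in> Cc \<Sigma>" "g \<in> Cc \<Sigma>" shows "convolution \<Sigma> f g \<in> Cc \<Sigma>"
proof -
  obtain K L where "compactin (gtop \<G>) K" "f \<in> Cc_on K" "compactin (gtop \<G>) L" "g \<in> Cc_on L"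
    using Cc_compact assms by metis
  then show ?thesis using convolution_Cc Cc_on_Cc by blast
qed

lemma involution_Cc_on:
  assumes f: "f \<in> Cc_on K" "compactin (gtop \<G>) K"
  shows "involution \<Sigma> f \<in> Cc_on (G.inverses K)"
proof (rule Cc_onI)
  have "continuous_map (gtop \<E>) euclidean (\<lambda>\<sigma>. cnj (f (inv\<^sub>E \<sigma>)))"
    using continuous_map_compose[OF E.continuous_map_inv Cc_D(1)[OF Cc_on_Cc[OF f(1)]]]
    by (intro continuous_map_cnj) (simp add: o_def)
  then show "continuous_map (gtop \<E>) euclidean (involution \<Sigma> f)"
    by (rule continuous_map_eq) (simp add: involution_def)
next
  fix \<sigma> z assume "\<sigma> \<in> arrows \<E>" "cmod z = 1"
  then show "involution \<Sigma> f (z \<star> \<sigma>) = z * involution \<Sigma> f \<sigma>"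
    using Cc_D(2)[OF Cc_on_Cc[OF f(1)], of "inv\<^sub>E \<sigma>" "cnj z"]
    by (simp add: involution_def inv_act)
next
  fix \<sigma> assume a: "involution \<Sigma> f \<sigma> \<noteq> 0"
  then have s: "\<sigma> \<in> arrows \<E>" "f (inv\<^sub>E \<sigma>) \<noteq> 0" by (auto simp: involution_def split: if_splits)
  then have "ginv \<G> (p \<sigma>) \<in> K" using f(1) by (auto simp: Cc_on_def)
  then have "p \<sigma> \<in> G.inverses K"
    unfolding G.inverses_def using s G.inv_inv[OF proj_arrow[OF s(1)]] by (metis imageI)
  then show "\<sigma> \<in> preimage \<Sigma> (G.inverses K)" using s by simp
qed (rule G.compactin_inverses[OF f(2)])

lemma involution_in_Cc: "f \<in> Cc \<Sigma> \<Longrightarrow> involution \<Sigma> f \<in> Cc \<Sigma>"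
  using Cc_compact involution_Cc_on Cc_on_Cc by metis

lemma convolution_unit_right:
  assumes f: "f \<in> Cc \<Sigma>" and h: "h \<in> unit_supported" and s: "\<sigma> \<in> arrows \<E>"
  shows "convolution \<Sigma> f h \<sigma> = f \<sigma> * h (one (src \<sigma>))"
proof -
  have h': "h \<in> Cc_on (units \<G>)" using h by (simp add: unit_supported_def)
  have "convolution \<Sigma> f h \<sigma> = f (\<sigma> \<cdot> inv\<^sub>E (one (src \<sigma>))) * h (one (src \<sigma>))"
  proof (rule convolution_single[OF f Cc_on_Cc[OF h'] s])
    fix \<gamma> assume a: "\<gamma> \<in> arrows \<G>" "gdom \<G> \<gamma> = src \<sigma>" "\<gamma> \<noteq> p (one (src \<sigma>))"
    then have "\<gamma> \<notin> units \<G>" using s by auto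
    then show "f (\<sigma> \<cdot> inv\<^sub>E (lift \<Sigma> \<gamma>)) * h (lift \<Sigma> \<gamma>) = 0"
      using Cc_on_support[OF h', of "lift \<Sigma> \<gamma>"] a by simp
  qed (use s in auto)
  then show ?thesis using s by simp
qed

lemma convolution_unit_left:
  assumes f: "f \<in> Cc \<Sigma>" and h: "h \<in> unit_supported" and s: "\<sigma> \<in> arrows \<E>"
  shows "convolution \<Sigma> h f \<sigma> = h (one (rng \<sigma>)) * f \<sigma>"
proof -
  have h': "h \<in> Cc_on (units \<G>)" using h by (simp add: unit_supported_def)
  have "convolution \<Sigma> h f \<sigma> = h (\<sigma> \<cdot> inv\<^sub>E \<sigma>) * f \<sigma>"
  proof (rule convolution_single[OF Cc_on_Cc[OF h'] f s s])
    fix \<gamma> assume a: "\<gamma> \<in> arrows \<G>" "gdom \<G> \<gamma> = src \<sigma>" "\<gamma> \<noteq> p \<sigma>"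
    then have "gmult \<G> (p \<sigma>) (ginv \<G> \<gamma>) \<notin> units \<G>"
      using G.mult_inv_unit_imp_eq[of "p \<sigma>" \<gamma>] s by auto
    then show "h (\<sigma> \<cdot> inv\<^sub>E (lift \<Sigma> \<gamma>)) * f (lift \<Sigma> \<gamma>) = 0"
      using Cc_on_support[OF h', of "\<sigma> \<cdot> inv\<^sub>E (lift \<Sigma> \<gamma>)"] a s by simp
  qed simp
  then show ?thesis using s by simp
qed

text \<open>At a unit x the convolution of \<open>involution \<Sigma> f\<close> with f is the sum of
  the squared moduli of f over the arrows with source x, and \<open>p \<sigma>\<close> contributes
  one summand. The inequality, unlike the formula, passes to limits without infinite sums.\<close>

lemma involution_convolution_ge:
  assumes f: "f \<in> Cc \<Sigma>" and s: "\<sigma> \<in> arrows \<E>"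
  shows "(cmod (f \<sigma>))\<^sup>2 \<le> Re (convolution \<Sigma> (involution \<Sigma> f) f (one (src \<sigma>)))"
proof -
  obtain K where K: "compactin (gtop \<G>) K" "f \<in> Cc_on K" using Cc_compact[OF f] .
  let ?F = "source_fibre \<Sigma> (src \<sigma>) \<inter> K"
  let ?x = "src \<sigma>"
  have x: "?x \<in> units \<G>" using s by simp
  have "convolution \<Sigma> (involution \<Sigma> f) f (one ?x)
    = (\<Sum>\<gamma>\<in>?F. involution \<Sigma> f (one ?x \<cdot> inv\<^sub>E (lift \<Sigma> \<gamma>)) * f (lift \<Sigma> \<gamma>))"
    using convolution_Cc_on[OF K(2,1), of "one ?x" "involution \<Sigma> f"] x by simp
  also have "\<dots> = (\<Sum>\<gamma>\<in>?F. complex_of_real ((cmod (f (lift \<Sigma> \<gamma>)))\<^sup>2))"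
  proof (rule sum.cong[OF refl])
    fix \<gamma> assume a: "\<gamma> \<in> ?F"
    then have "one ?x \<cdot> inv\<^sub>E (lift \<Sigma> \<gamma>) = inv\<^sub>E (lift \<Sigma> \<gamma>)"
      using E_one(2)[of "inv\<^sub>E (lift \<Sigma> \<gamma>)"] by simp
    then show "involution \<Sigma> f (one ?x \<cdot> inv\<^sub>E (lift \<Sigma> \<gamma>)) * f (lift \<Sigma> \<gamma>) = complex_of_real ((cmod (f (lift \<Sigma> \<gamma>)))\<^sup>2)"
      using a by (simp add: involution_def mult.commute flip: complex_norm_square)
  qed
  finally have eq: "Re (convolution \<Sigma> (involution \<Sigma> f) f (one ?x)) = (\<Sum>\<gamma>\<in>?F. (cmod (f (lift \<Sigma> \<gamma>)))\<^sup>2)"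
    by simp
  show ?thesis
  proof (cases "f \<sigma> = 0")
    case True then show ?thesis unfolding eq by (simp add: sum_nonneg)
  next
    case False
    then have "p \<sigma> \<in> ?F" using s K(2) by (auto simp: Cc_on_def)
    moreover obtain z where z: "cmod z = 1" "lift \<Sigma> (p \<sigma>) = z \<star> \<sigma>"
      using same_fibre[of \<sigma> "lift \<Sigma> (p \<sigma>)"] s by auto
    ultimately have "(cmod (f (lift \<Sigma> (p \<sigma>))))\<^sup>2 \<le> (\<Sum>\<gamma>\<in>?F. (cmod (f (lift \<Sigma> \<gamma>)))\<^sup>2)"
      using Cc_on_fibre(1)[OF K(2,1)] by (intro member_le_sum) auto
    then show ?thesis unfolding eq using z s Cc_D(2)[OF f s z(1)] by (simp add: norm_mult)
  qed
qed

end

section \<open>The reduced norm\<close>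

text \<open>Cauchy-Schwarz on the at most N nonzero entries of each row gives one factor N; summing
  over the rows counts each column at most N times and gives the other. With N = 1 this is the bound
  for a weighted partial permutation.\<close>

lemma sparse_matrix_bound:
  fixes m :: "'b \<Rightarrow> 'c \<Rightarrow> complex" and M :: real and N :: nat
  assumes fin: "finite F" "finite R"
    and m: "\<And>g h. \<lbrakk>g \<in> F; h \<in> R\<rbrakk> \<Longrightarrow> cmod (m g h) \<le> M"
    and row: "\<And>g. g \<in> F \<Longrightarrow> card {h \<in> R. m g h \<noteq> 0} \<le> N"
    and column: "\<And>h. h \<in> R \<Longrightarrow> card {g \<in> F. m g h \<noteq> 0} \<le> N"
  shows "(\<Sum>g\<in>F. (cmod (\<Sum>h\<in>R. m g h * v h))\<^sup>2) \<le> M\<^sup>2 * N * N * (\<Sum>h\<in>R. (cmod (v h))\<^sup>2)"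
proof -
  let ?v = "\<lambda>h. (cmod (v h))\<^sup>2"
  have 1: "(cmod (\<Sum>h\<in>R. m g h * v h))\<^sup>2 \<le> M\<^sup>2 * N * (\<Sum>h\<in>{h \<in> R. m g h \<noteq> 0}. ?v h)"
    if g: "g \<in> F" for g
  proof -
    let ?R = "{h \<in> R. m g h \<noteq> 0}"
    have eq: "(\<Sum>h\<in>R. m g h * v h) = (\<Sum>h\<in>?R. m g h * v h)"
      by (rule sum.mono_neutral_right) (use fin in auto)
    have "cmod (\<Sum>h\<in>R. m g h * v h) \<le> (\<Sum>h\<in>?R. M * cmod (v h))"
      unfolding eq by (rule sum_norm_le) (use m[OF g] in \<open>simp add: norm_mult mult_right_mono\<close>)
    also have "\<dots> = M * (\<Sum>h\<in>?R. cmod (v h))" by (simp add: sum_distrib_left)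
    finally have "(cmod (\<Sum>h\<in>R. m g h * v h))\<^sup>2 \<le> (M * (\<Sum>h\<in>?R. cmod (v h)))\<^sup>2"
      by (rule power_mono) simp
    also have "\<dots> = M\<^sup>2 * (\<Sum>h\<in>?R. cmod (v h))\<^sup>2" by (rule power_mult_distrib)
    also have "\<dots> \<le> M\<^sup>2 * ((\<Sum>h\<in>?R. ?v h) * card ?R)"
      by (intro mult_left_mono sum_squared_le_sum_of_squares) simp
    also have "\<dots> \<le> M\<^sup>2 * ((\<Sum>h\<in>?R. ?v h) * N)"
      using row[OF g] by (intro mult_left_mono) (auto simp: sum_nonneg)
    finally show ?thesis by (simp add: mult_ac)
  qed
  have "(\<Sum>g\<in>F. \<Sum>h\<in>{h \<in> R. m g h \<noteq> 0}. ?v h) = (\<Sum>h\<in>R. \<Sum>g\<in>{g \<in> F. m g h \<noteq> 0}. ?v h)"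
    using sum.swap_restrict[OF fin, of "\<lambda>g h. ?v h" "\<lambda>g h. m g h \<noteq> 0"] by simp
  also have "\<dots> \<le> (\<Sum>h\<in>R. N * ?v h)"
    using column by (intro sum_mono) (simp add: mult_right_mono)
  also have "\<dots> = N * (\<Sum>h\<in>R. ?v h)" by (simp add: sum_distrib_left)
  finally have 2: "(\<Sum>g\<in>F. \<Sum>h\<in>{h \<in> R. m g h \<noteq> 0}. ?v h) \<le> N * (\<Sum>h\<in>R. ?v h)" .
  have "(\<Sum>g\<in>F. (cmod (\<Sum>h\<in>R. m g h * v h))\<^sup>2)
      \<le> (\<Sum>g\<in>F. M\<^sup>2 * N * (\<Sum>h\<in>{h \<in> R. m g h \<noteq> 0}. ?v h))"
    by (rule sum_mono) (rule 1)
  also have "\<dots> = M\<^sup>2 * N * (\<Sum>g\<in>F. \<Sum>h\<in>{h \<in> R. m g h \<noteq> 0}. ?v h)"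
    by (rule sum_distrib_left[symmetric])
  also have "\<dots> \<le> M\<^sup>2 * N * (N * (\<Sum>h\<in>R. ?v h))" using 2 by (intro mult_left_mono) auto
  finally show ?thesis by (simp add: mult_ac)
qed

context ample_twist begin

abbreviation "rep_ball x \<equiv> {\<xi> \<in> rep_space \<Sigma> x. rep_norm \<Sigma> x \<xi> \<le> 1}"

lemma rep_ballD:
  assumes "\<xi> \<in> rep_ball x"
  shows "(\<lambda>\<gamma>. (cmod (\<xi> (lift \<Sigma> \<gamma>)))\<^sup>2) summable_on source_fibre \<Sigma> x"
    "(\<Sum>\<^sub>\<infinity>\<gamma>\<in>source_fibre \<Sigma> x. (cmod (\<xi> (lift \<Sigma> \<gamma>)))\<^sup>2) \<le> 1"
    "\<And>F. \<lbrakk>finite F; F \<subseteq> source_fibre \<Sigma> x\<rbrakk> \<Longrightarrow> (\<Sum>\<gamma>\<in>F. (cmod (\<xi> (lift \<Sigma> \<gamma>)))\<^sup>2) \<le> 1"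
proof -
  show 1: "(\<lambda>\<gamma>. (cmod (\<xi> (lift \<Sigma> \<gamma>)))\<^sup>2) summable_on source_fibre \<Sigma> x"
    using assms by (simp add: rep_space_def)
  show 2: "(\<Sum>\<^sub>\<infinity>\<gamma>\<in>source_fibre \<Sigma> x. (cmod (\<xi> (lift \<Sigma> \<gamma>)))\<^sup>2) \<le> 1"
    using assms unfolding rep_norm_def by simp
  fix F assume "finite F" "F \<subseteq> source_fibre \<Sigma> x"
  then have "(\<Sum>\<gamma>\<in>F. (cmod (\<xi> (lift \<Sigma> \<gamma>)))\<^sup>2) \<le> (\<Sum>\<^sub>\<infinity>\<gamma>\<in>source_fibre \<Sigma> x. (cmod (\<xi> (lift \<Sigma> \<gamma>)))\<^sup>2)"
    using 1 by (intro finite_sum_le_infsum) auto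
  with 2 show "(\<Sum>\<gamma>\<in>F. (cmod (\<xi> (lift \<Sigma> \<gamma>)))\<^sup>2) \<le> 1" by linarith
qed

lemma rep_ballI:
  assumes "equivariant_on \<Sigma> (preimage \<Sigma> (source_fibre \<Sigma> x)) \<xi>"
    and "\<And>F. \<lbrakk>finite F; F \<subseteq> source_fibre \<Sigma> x\<rbrakk> \<Longrightarrow> (\<Sum>\<gamma>\<in>F. (cmod (\<xi> (lift \<Sigma> \<gamma>)))\<^sup>2) \<le> 1"
  shows "\<xi> \<in> rep_ball x"
proof -
  have 1: "(\<lambda>\<gamma>. (cmod (\<xi> (lift \<Sigma> \<gamma>)))\<^sup>2) summable_on source_fibre \<Sigma> x"
    using assms(2) by (intro nonneg_bdd_above_summable_on) (auto simp: bdd_above_def)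
  then have "(\<Sum>\<^sub>\<infinity>\<gamma>\<in>source_fibre \<Sigma> x. (cmod (\<xi> (lift \<Sigma> \<gamma>)))\<^sup>2) \<le> 1"
    using assms(2) by (rule infsum_le_finite_sums)
  with 1 assms(1) show ?thesis by (simp add: rep_space_def rep_norm_def)
qed

text \<open>Convolution by f is a matrix indexed by the arrows with a fixed source; its entry is the
  value of f at a lift of \<open>gmult \<G> g (ginv \<G> \<gamma>)\<close>. For f living on K,
  \<open>row K g\<close> contains the columns of all nonzero entries in row g.\<close>

definition row :: "'g set \<Rightarrow> 'g \<Rightarrow> 'g set" where
  "row K g = {\<gamma> \<in> source_fibre \<Sigma> (gdom \<G> g). gmult \<G> g (ginv \<G> \<gamma>) \<in> K}"

text \<open>For fixed g, sending \<gamma> to g \<gamma>^-1 embeds a row into the arrows of K with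
  the range of g. For fixed \<gamma>, sending g to g \<gamma>^-1 embeds a column into the arrows of
  K whose source is the range of \<gamma>.\<close>

lemma row_column_bound:
  assumes K: "compactin (gtop \<G>) K"
  obtains N where "\<And>g. g \<in> arrows \<G> \<Longrightarrow> finite (row K g) \<and> card (row K g) \<le> N"
    "\<And>\<gamma> x. \<gamma> \<in> arrows \<G> \<Longrightarrow> finite {g \<in> source_fibre \<Sigma> x. \<gamma> \<in> row K g} \<and> card {g \<in> source_fibre \<Sigma> x. \<gamma> \<in> row K g} \<le> N"
proof -
  obtain N where N: "\<And>x. finite {\<gamma> \<in> K. gdom \<G> \<gamma> = x}" "\<And>x. card {\<gamma> \<in> K. gdom \<G> \<gamma> = x} \<le> N"
    "\<And>x. finite {\<gamma> \<in> K. gran \<G> \<gamma> = x}" "\<And>x. card {\<gamma> \<in> K. gran \<G> \<gamma> = x} \<le> N"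
    by (rule compact_fibre_bound[OF K]) blast
  have "finite (row K g) \<and> card (row K g) \<le> N" if g: "g \<in> arrows \<G>" for g
  proof -
    let ?m = "\<lambda>\<gamma>. gmult \<G> g (ginv \<G> \<gamma>)"
    have inj: "inj_on ?m (row K g)"
    proof (rule inj_onI)
      fix a b assume ab: "a \<in> row K g" "b \<in> row K g" "?m a = ?m b"
      have "ginv \<G> a = ginv \<G> b"
        by (rule G.mult_left_cancel[OF _ _ _ _ _ ab(3)]) (use g ab(1,2) in \<open>auto simp: row_def\<close>)
      moreover have "a \<in> arrows \<G>" "b \<in> arrows \<G>" using ab by (simp_all add: row_def)
      ultimately show "a = b" using G.inv_inv by metis
    qed
    have im: "?m ` row K g \<subseteq> {\<gamma> \<in> K. gran \<G> \<gamma> = gran \<G> g}" using g by (auto simp: row_def)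
    show ?thesis
      using inj_on_finite[OF inj im N(3)] card_inj_on_le[OF inj im N(3)] N(4)[of "gran \<G> g"] by linarith
  qed
  moreover have "finite {g \<in> source_fibre \<Sigma> x. \<gamma> \<in> row K g} \<and> card {g \<in> source_fibre \<Sigma> x. \<gamma> \<in> row K g} \<le> N"
    if g: "\<gamma> \<in> arrows \<G>" for \<gamma> x
  proof -
    let ?C = "{g \<in> source_fibre \<Sigma> x. \<gamma> \<in> row K g}"
    let ?m = "\<lambda>g. gmult \<G> g (ginv \<G> \<gamma>)"
    have inj: "inj_on ?m ?C"
    proof (rule inj_onI)
      fix a b assume ab: "a \<in> ?C" "b \<in> ?C" "?m a = ?m b"
      have "a \<in> arrows \<G>" "b \<in> arrows \<G>" "gdom \<G> a = gdom \<G> \<gamma>" "gdom \<G> b = gdom \<G> \<gamma>"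
        using ab(1,2) unfolding row_def source_fibre_def mem_Collect_eq by metis+
      then show "a = b"
        using G.mult_right_cancel[OF _ _ _ _ _ ab(3)] g by simp
    qed
    have im: "?m ` ?C \<subseteq> {k \<in> K. gdom \<G> k = gran \<G> \<gamma>}" using g by (auto simp: row_def)
    show ?thesis
      using inj_on_finite[OF inj im N(1)] card_inj_on_le[OF inj im N(1)] N(2)[of "gran \<G> \<gamma>"] by linarith
  qed
  ultimately show ?thesis by (intro that[of N])
qed

lemma convolution_row:
  assumes f: "f \<in> Cc_on K" and g: "g \<in> arrows \<G>"
    and R: "finite R" "row K g \<subseteq> R" "R \<subseteq> source_fibre \<Sigma> (gdom \<G> g)"
  shows "convolution \<Sigma> f \<xi> (lift \<Sigma> g) =
    (\<Sum>\<gamma>\<in>R. f (lift \<Sigma> g \<cdot> inv\<^sub>E (lift \<Sigma> \<gamma>)) * \<xi> (lift \<Sigma> \<gamma>))"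
    "\<gamma> \<in> source_fibre \<Sigma> (gdom \<G> g) \<Longrightarrow> f (lift \<Sigma> g \<cdot> inv\<^sub>E (lift \<Sigma> \<gamma>)) \<noteq> 0 \<Longrightarrow> \<gamma> \<in> row K g"
proof -
  show 1: "\<gamma> \<in> row K g" if "\<gamma> \<in> source_fibre \<Sigma> (gdom \<G> g)" "f (lift \<Sigma> g \<cdot> inv\<^sub>E (lift \<Sigma> \<gamma>)) \<noteq> 0" for \<gamma>
    using Cc_on_support[OF f, of "lift \<Sigma> g \<cdot> inv\<^sub>E (lift \<Sigma> \<gamma>)"] that g
    unfolding row_def by fastforce
  show "convolution \<Sigma> f \<xi> (lift \<Sigma> g) =
    (\<Sum>\<gamma>\<in>R. f (lift \<Sigma> g \<cdot> inv\<^sub>E (lift \<Sigma> \<gamma>)) * \<xi> (lift \<Sigma> \<gamma>))"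
    by (rule convolution_sum) (use g R 1 in auto)
qed

text \<open>The constant is the square of M N, with M a bound for the values of f and N the row and
  column bound. It makes the suprema in the reduced norm suprema of bounded sets, without which
  \<open>Sup\<close> on the reals carries no information.\<close>

lemma rep_bound:
  assumes f: "f \<in> Cc \<Sigma>"
  obtains C where "C \<ge> 0" "\<And>x \<xi> F. \<lbrakk>\<xi> \<in> rep_ball x; finite F; F \<subseteq> source_fibre \<Sigma> x\<rbrakk> \<Longrightarrow>
    (\<Sum>g\<in>F. (cmod (convolution \<Sigma> f \<xi> (lift \<Sigma> g)))\<^sup>2) \<le> C"
proof -
  obtain K where K: "compactin (gtop \<G>) K" "f \<in> Cc_on K" using Cc_compact[OF f] .
  obtain M where M: "M \<ge> 0" "\<And>\<sigma>. cmod (f \<sigma>) \<le> M" by (rule Cc_bounded[OF f]) blast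
  obtain N where N: "\<And>g. g \<in> arrows \<G> \<Longrightarrow> finite (row K g) \<and> card (row K g) \<le> N"
    "\<And>\<gamma> x. \<gamma> \<in> arrows \<G> \<Longrightarrow> finite {g \<in> source_fibre \<Sigma> x. \<gamma> \<in> row K g} \<and> card {g \<in> source_fibre \<Sigma> x. \<gamma> \<in> row K g} \<le> N"
    by (rule row_column_bound[OF K(1)]) blast
  have "(\<Sum>g\<in>F. (cmod (convolution \<Sigma> f \<xi> (lift \<Sigma> g)))\<^sup>2) \<le> M\<^sup>2 * N * N"
    if \<xi>: "\<xi> \<in> rep_ball x" and F: "finite F" "F \<subseteq> source_fibre \<Sigma> x" for x \<xi> F
  proof -
    \<comment> \<open>Finitely many rows meet only finitely many columns, so the estimate is about a
      finite matrix even when \<xi> has infinite support.\<close>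
    define R where "R = (\<Union>g\<in>F. row K g)"
    have arr: "g \<in> arrows \<G>" "gdom \<G> g = x" if "g \<in> F" for g using F(2) that by auto
    have R: "finite R" "R \<subseteq> source_fibre \<Sigma> x"
      using F N(1) arr by (auto simp: R_def row_def)
    have row: "row K g \<subseteq> R" if "g \<in> F" for g using that by (auto simp: R_def)
    note conv = convolution_row[OF K(2) arr(1) R(1) row]
    let ?m = "\<lambda>g \<gamma>. f (lift \<Sigma> g \<cdot> inv\<^sub>E (lift \<Sigma> \<gamma>))"
    have nz: "\<gamma> \<in> row K g" if "g \<in> F" "\<gamma> \<in> R" "?m g \<gamma> \<noteq> 0" for g \<gamma>
      using conv(2)[of g \<gamma>] that R(2) arr by auto
    have "(\<Sum>g\<in>F. (cmod (convolution \<Sigma> f \<xi> (lift \<Sigma> g)))\<^sup>2)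
        = (\<Sum>g\<in>F. (cmod (\<Sum>\<gamma>\<in>R. ?m g \<gamma> * \<xi> (lift \<Sigma> \<gamma>)))\<^sup>2)"
      using conv(1) arr R(2) by (intro sum.cong refl) auto
    also have "\<dots> \<le> M\<^sup>2 * N * N * (\<Sum>\<gamma>\<in>R. (cmod (\<xi> (lift \<Sigma> \<gamma>)))\<^sup>2)"
    proof (rule sparse_matrix_bound[OF F(1) R(1)])
      fix g assume g: "g \<in> F"
      then have "{\<gamma> \<in> R. ?m g \<gamma> \<noteq> 0} \<subseteq> row K g" using nz by auto
      then show "card {\<gamma> \<in> R. ?m g \<gamma> \<noteq> 0} \<le> N"
        using N(1)[OF arr(1)[OF g]] card_mono order_trans by blast
    next
      fix \<gamma> assume g: "\<gamma> \<in> R"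
      then have "{g \<in> F. ?m g \<gamma> \<noteq> 0} \<subseteq> {g \<in> source_fibre \<Sigma> x. \<gamma> \<in> row K g}" using nz F(2) by blast
      moreover have "\<gamma> \<in> arrows \<G>" using g R(2) by auto
      ultimately show "card {g \<in> F. ?m g \<gamma> \<noteq> 0} \<le> N"
        using N(2)[of \<gamma> x] card_mono order_trans by blast
    qed (use M in auto)
    also have "\<dots> \<le> M\<^sup>2 * N * N * 1"
      using rep_ballD(3)[OF \<xi> R] by (intro mult_left_mono) auto
    finally show ?thesis by simp
  qed
  then show ?thesis using that[of "M\<^sup>2 * N * N"] by simp
qed

lemma zero_rep_ball: "(\<lambda>_. 0) \<in> rep_ball x"
  by (rule rep_ballI) (auto simp: equivariant_on_def)

lemma rep_norm_le_reduced_norm: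
  assumes f: "f \<in> Cc \<Sigma>" and x: "x \<in> units \<G>" and \<xi>: "\<xi> \<in> rep_ball x"
  shows "(\<lambda>g. (cmod (convolution \<Sigma> f \<xi> (lift \<Sigma> g)))\<^sup>2) summable_on source_fibre \<Sigma> x"
    "rep_norm \<Sigma> x (convolution \<Sigma> f \<xi>) \<le> reduced_norm \<Sigma> f"
proof -
  obtain C where C: "C \<ge> 0" "\<And>x \<xi> F. \<lbrakk>\<xi> \<in> rep_ball x; finite F; F \<subseteq> source_fibre \<Sigma> x\<rbrakk> \<Longrightarrow>
    (\<Sum>g\<in>F. (cmod (convolution \<Sigma> f \<xi> (lift \<Sigma> g)))\<^sup>2) \<le> C"
    by (rule rep_bound[OF f]) blast
  have s: "(\<lambda>g. (cmod (convolution \<Sigma> f \<xi> (lift \<Sigma> g)))\<^sup>2) summable_on source_fibre \<Sigma> x"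
    if "\<xi> \<in> rep_ball x" for x \<xi>
    using C(2)[OF that] by (intro nonneg_bdd_above_summable_on) (auto simp: bdd_above_def)
  show "(\<lambda>g. (cmod (convolution \<Sigma> f \<xi> (lift \<Sigma> g)))\<^sup>2) summable_on source_fibre \<Sigma> x" using s[OF \<xi>] .
  have b: "rep_norm \<Sigma> x (convolution \<Sigma> f \<xi>) \<le> sqrt C" if "\<xi> \<in> rep_ball x" for x \<xi>
    unfolding rep_norm_def using infsum_le_finite_sums[OF s[OF that] C(2)[OF that]] by simp
  have b1: "bdd_above ((\<lambda>\<xi>. rep_norm \<Sigma> x (convolution \<Sigma> f \<xi>)) ` rep_ball x)" for x
    using b by (auto simp: bdd_above_def)
  have b2: "bdd_above (insert 0 ((\<lambda>x. regular_rep_norm \<Sigma> x f) ` units \<G>))"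
  proof (rule bdd_aboveI[of _ "sqrt C"])
    fix r assume "r \<in> insert 0 ((\<lambda>x. regular_rep_norm \<Sigma> x f) ` units \<G>)"
    moreover have "regular_rep_norm \<Sigma> x f \<le> sqrt C" for x
      unfolding regular_rep_norm_def using b zero_rep_ball by (intro cSUP_least) blast+
    ultimately show "r \<le> sqrt C" using C(1) by auto
  qed
  have "rep_norm \<Sigma> x (convolution \<Sigma> f \<xi>) \<le> regular_rep_norm \<Sigma> x f"
    unfolding regular_rep_norm_def by (rule cSUP_upper[OF \<xi> b1])
  also have "\<dots> \<le> reduced_norm \<Sigma> f"
    unfolding reduced_norm_def using x by (intro cSup_upper[OF _ b2]) auto
  finally show "rep_norm \<Sigma> x (convolution \<Sigma> f \<xi>) \<le> reduced_norm \<Sigma> f" .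
qed

lemma finite_rep_le:
  assumes f: "f \<in> Cc \<Sigma>" and x: "x \<in> units \<G>" and \<xi>: "\<xi> \<in> rep_ball x"
    and F: "finite F" "F \<subseteq> source_fibre \<Sigma> x"
  shows "L2_set (\<lambda>g. cmod (convolution \<Sigma> f \<xi> (lift \<Sigma> g))) F \<le> reduced_norm \<Sigma> f"
proof -
  have "L2_set (\<lambda>g. cmod (convolution \<Sigma> f \<xi> (lift \<Sigma> g))) F \<le> rep_norm \<Sigma> x (convolution \<Sigma> f \<xi>)"
    unfolding L2_set_def rep_norm_def using rep_norm_le_reduced_norm(1)[OF f x \<xi>] F
    by (intro real_sqrt_le_mono finite_sum_le_infsum) auto
  then show ?thesis using rep_norm_le_reduced_norm(2)[OF f x \<xi>] by linarith
qed

text \<open>Together with \<open>finite_rep_le\<close> this describes the reduced norm by finite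
  sets of coordinates, so that later estimates handle finite sums only.\<close>

lemma reduced_norm_leI:
  assumes f: "f \<in> Cc \<Sigma>" and C: "C \<ge> 0"
    and le: "\<And>x \<xi> F. \<lbrakk>x \<in> units \<G>; \<xi> \<in> rep_ball x; finite F; F \<subseteq> source_fibre \<Sigma> x\<rbrakk> \<Longrightarrow>
      L2_set (\<lambda>g. cmod (convolution \<Sigma> f \<xi> (lift \<Sigma> g))) F \<le> C"
  shows "reduced_norm \<Sigma> f \<le> C"
  unfolding reduced_norm_def
proof (rule cSup_least)
  fix r assume "r \<in> insert 0 ((\<lambda>x. regular_rep_norm \<Sigma> x f) ` units \<G>)"
  moreover have "regular_rep_norm \<Sigma> x f \<le> C" if x: "x \<in> units \<G>" for x
    unfolding regular_rep_norm_def
  proof (rule cSUP_least)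
    fix \<xi> assume \<xi>: "\<xi> \<in> rep_ball x"
    have "(\<Sum>\<^sub>\<infinity>\<gamma>\<in>source_fibre \<Sigma> x. (cmod (convolution \<Sigma> f \<xi> (lift \<Sigma> \<gamma>)))\<^sup>2) \<le> C\<^sup>2"
    proof (rule infsum_le_finite_sums[OF rep_norm_le_reduced_norm(1)[OF f x \<xi>]])
      fix F assume "finite F" "F \<subseteq> source_fibre \<Sigma> x"
      from le[OF x \<xi> this] show "(\<Sum>g\<in>F. (cmod (convolution \<Sigma> f \<xi> (lift \<Sigma> g)))\<^sup>2) \<le> C\<^sup>2"
        unfolding L2_set_def using C by (simp add: real_sqrt_le_iff real_le_lsqrt sqrt_le_D)
    qed
    then show "rep_norm \<Sigma> x (convolution \<Sigma> f \<xi>) \<le> C"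
      unfolding rep_norm_def using C by (simp add: real_le_lsqrt infsum_nonneg)
  qed (use zero_rep_ball in blast)
  ultimately show "r \<le> C" using C by auto
qed simp

lemma cmod_lift:
  assumes "f \<in> Cc \<Sigma>" "\<sigma> \<in> arrows \<E>" "\<tau> \<in> arrows \<E>" "p \<sigma> = p \<tau>"
  shows "cmod (f \<sigma>) = cmod (f \<tau>)"
  using same_fibre[OF assms(2-4)] Cc_D(2)[OF assms(1,2)] by (metis mult_1 norm_mult)

text \<open>A matrix entry is at most the operator norm: apply f to a unit vector at the source of
  \<sigma> and read off the coordinate at \<open>p \<sigma>\<close>.\<close>

lemma cmod_le_reduced_norm:
  assumes f: "f \<in> Cc \<Sigma>"
  shows "cmod (f \<sigma>) \<le> reduced_norm \<Sigma> f"
proof (cases "\<sigma> \<in> arrows \<E>")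
  case True
  let ?x = "src \<sigma>"
  have x: "?x \<in> units \<G>" using True by simp
  obtain U where U: "sectioned U" "?x \<in> U" "U \<subseteq> units \<G>" using sectioned_basis[OF G.openin_units x] .
  obtain h where h: "h \<in> Cc_on U" "\<And>\<sigma>. \<sigma> \<in> preimage \<Sigma> U \<Longrightarrow> cmod (h \<sigma>) = 1" by (rule bump[OF U(1)]) blast
  \<comment> \<open>A unit vector concentrated at the single unit \<open>?x\<close>. It has to be
    equivariant, so its values come from a unimodular function.\<close>
  define \<xi> where "\<xi> \<tau> = (if p \<tau> = ?x then h \<tau> else 0)" for \<tau>
  have \<xi>: "\<xi> \<in> rep_ball ?x"
  proof (rule rep_ballI)
    show "equivariant_on \<Sigma> (preimage \<Sigma> (source_fibre \<Sigma> ?x)) \<xi>"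
      using Cc_D(2,3)[OF Cc_on_Cc[OF h(1)]] x by (auto simp: equivariant_on_def \<xi>_def)
    fix F assume F: "finite F" "F \<subseteq> source_fibre \<Sigma> ?x"
    have "(\<Sum>\<gamma>\<in>F. (cmod (\<xi> (lift \<Sigma> \<gamma>)))\<^sup>2) \<le> (\<Sum>\<gamma>\<in>F. if \<gamma> = ?x then 1 else 0)"
      using F h(2) U by (intro sum_mono) (auto simp: \<xi>_def)
    also have "\<dots> \<le> 1" using F by (simp add: sum.delta)
    finally show "(\<Sum>\<gamma>\<in>F. (cmod (\<xi> (lift \<Sigma> \<gamma>)))\<^sup>2) \<le> 1" .
  qed
  let ?s = "lift \<Sigma> (p \<sigma>)" and ?u = "lift \<Sigma> ?x"
  have "convolution \<Sigma> f \<xi> ?s = (\<Sum>\<gamma>\<in>{?x}. f (?s \<cdot> inv\<^sub>E (lift \<Sigma> \<gamma>)) * \<xi> (lift \<Sigma> \<gamma>))"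
    by (rule convolution_sum) (use True x in \<open>auto simp: \<xi>_def\<close>)
  then have "cmod (convolution \<Sigma> f \<xi> ?s) = cmod (f (?s \<cdot> inv\<^sub>E ?u)) * cmod (h ?u)"
    using x by (simp add: \<xi>_def norm_mult)
  also have "cmod (h ?u) = 1" using h(2)[of ?u] x U by simp
  also have "cmod (f (?s \<cdot> inv\<^sub>E ?u)) = cmod (f \<sigma>)"
    using True x G.dom_ran(7)[of "p \<sigma>"] by (intro cmod_lift[OF f]) auto
  finally have "cmod (f \<sigma>) = L2_set (\<lambda>g. cmod (convolution \<Sigma> f \<xi> (lift \<Sigma> g))) {p \<sigma>}"
    by (simp add: L2_set_def)
  also have "\<dots> \<le> reduced_norm \<Sigma> f"
    by (rule finite_rep_le[OF f x \<xi>]) (use True in auto)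
  finally show ?thesis .
next
  case False
  \<comment> \<open>When there are no units, no vector is available for a lower bound, and the 0
    inserted in \<open>reduced_norm\<close> gives the claim.\<close>
  have "0 \<le> reduced_norm \<Sigma> f"
  proof (cases "units \<G> = {}")
    case True then show ?thesis by (simp add: reduced_norm_def)
  next
    case False
    then obtain x where x: "x \<in> units \<G>" by blast
    show ?thesis using finite_rep_le[OF f x zero_rep_ball, of "{}"] by simp
  qed
  then show ?thesis using Cc_D(3)[OF f False] by simp
qed

text \<open>The support in the base, without closure. An equivariant f that vanishes at one point
  over an arrow vanishes at all of them, so projecting loses nothing.\<close>

definition supp :: "('e \<Rightarrow> complex) \<Rightarrow> 'g set" where
  "supp f = p ` {\<sigma> \<in> arrows \<E>. f \<sigma> \<noteq> 0}"

lemma supp_nonzero: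
  assumes "f \<in> Cc \<Sigma>" "\<sigma> \<in> arrows \<E>" "p \<sigma> \<in> supp f"
  shows "f \<sigma> \<noteq> 0"
  using assms cmod_lift[OF assms(1)] unfolding supp_def by fastforce

lemma supp_subset: "f \<in> Cc_on K \<Longrightarrow> supp f \<subseteq> K"
  unfolding supp_def Cc_on_def by auto

lemma Cc_on_supp: "f \<in> Cc \<Sigma> \<Longrightarrow> f \<in> Cc_on (supp f)"
  using Cc_D(3) unfolding supp_def Cc_on_def by auto

lemma supp_arrows: "supp f \<subseteq> arrows \<G>"
  unfolding supp_def by auto

subsection \<open>Restriction to open subgroupoids\<close>

definition Cc_sub :: "'g set \<Rightarrow> ('e \<Rightarrow> complex) set" where
  "Cc_sub H = {f. \<exists>K. compactin (gtop \<G>) K \<and> K \<subseteq> H \<and> f \<in> Cc_on K}"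

lemma Cc_sub_Cc: "f \<in> Cc_sub H \<Longrightarrow> f \<in> Cc \<Sigma>"
  by (auto simp: Cc_sub_def Cc_on_Cc)

lemma restrict_simps [simp]:
  "base (restrict_twist \<Sigma> H) = restrict_groupoid \<G> H"
  "total (restrict_twist \<Sigma> H) = restrict_groupoid \<E> (preimage \<Sigma> H)"
  "proj (restrict_twist \<Sigma> H) = p" "incl (restrict_twist \<Sigma> H) = incl \<Sigma>"
  "gtop (restrict_groupoid K L) = subtopology (gtop K) L"
  "gdom (restrict_groupoid K L) = gdom K" "gran (restrict_groupoid K L) = gran K"
  "gmult (restrict_groupoid K L) = gmult K" "ginv (restrict_groupoid K L) = ginv K"
  by (simp_all add: restrict_twist_def restrict_groupoid_def)

lemma circle_act_restrict [simp]: "circle_act (restrict_twist \<Sigma> H) = circle_act \<Sigma>"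
  by (simp add: circle_act_def fun_eq_iff)

lemma equivariant_on_restrict [simp]: "equivariant_on (restrict_twist \<Sigma> H) = equivariant_on \<Sigma>"
  by (simp add: equivariant_on_def fun_eq_iff)

text \<open>A support that is compact in \<open>preimage \<Sigma> H\<close> is compact, hence
  closed, in the whole twist. So f is zero on an open set that together with
  \<open>preimage \<Sigma> H\<close> covers everything, and its extension by zero is continuous
  although H need not be closed.\<close>

lemma Cc_restrict_twist:
  assumes H: "openin (gtop \<G>) H"
  shows "Cc (restrict_twist \<Sigma> H) = Cc_sub H"
proof (intro equalityI subsetI)
  let ?P = "preimage \<Sigma> H"
  have P: "openin (gtop \<E>) ?P" "arrows \<E> \<inter> ?P = ?P" using openin_preimage[OF H] by auto
  {
    fix f assume f: "f \<in> Cc (restrict_twist \<Sigma> H)"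
    let ?S = "subtopology (gtop \<E>) ?P closure_of {\<sigma>. f \<sigma> \<noteq> 0}"
    have f': "continuous_map (subtopology (gtop \<E>) ?P) euclidean f"
      "compactin (subtopology (gtop \<E>) ?P) ?S" "equivariant_on \<Sigma> ?P f"
      using f P by (simp_all add: Cc_def)
    have S: "compactin (gtop \<E>) ?S" "?S \<subseteq> ?P" using f'(2) by (simp_all add: compactin_subtopology)
    have sub: "{\<sigma>. f \<sigma> \<noteq> 0} \<subseteq> ?S"
      using f'(3) P(2) by (intro closure_of_subset) (auto simp: equivariant_on_def)
    let ?K = "p ` ?S"
    have K: "compactin (gtop \<G>) ?K" "?K \<subseteq> H"
      using image_compactin[OF S(1) proj_continuous] S(2) by auto
    have Kc: "closedin (gtop \<E>) (preimage \<Sigma> ?K)"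
      using K(1) closedin_preimage compactin_imp_closedin[OF G.Hausdorff] by blast
    have "f \<in> Cc_on ?K"
    proof (rule Cc_onI[OF _ _ K(1)])
      show "continuous_map (gtop \<E>) euclidean f"
      proof (rule continuous_map_locally)
        fix \<sigma> assume s: "\<sigma> \<in> arrows \<E>"
        let ?O = "arrows \<E> - preimage \<Sigma> ?K"
        have "continuous_map (subtopology (gtop \<E>) ?O) euclidean f"
          by (rule continuous_map_eq[of _ _ "\<lambda>_. 0"]) (use sub in auto)
        moreover have "openin (gtop \<E>) ?O" using Kc by blast
        moreover have "\<sigma> \<in> ?O \<or> \<sigma> \<in> ?P" using s K(2) by auto
        ultimately show "\<exists>U. openin (gtop \<E>) U \<and> \<sigma> \<in> U \<and> continuous_map (subtopology (gtop \<E>) U) euclidean f"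
          using P(1) f'(1) by metis
      qed
    next
      fix \<sigma> z assume s: "\<sigma> \<in> arrows \<E>" "cmod z = 1"
      show "f (z \<star> \<sigma>) = z * f \<sigma>"
      proof (cases "p \<sigma> \<in> H")
        case False
        then have "f \<sigma> = 0" "f (z \<star> \<sigma>) = 0" using f'(3) s by (auto simp: equivariant_on_def)
        then show ?thesis by simp
      qed (use f'(3) s in \<open>auto simp: equivariant_on_def\<close>)
    next
      fix \<sigma> assume "f \<sigma> \<noteq> 0"
      then have "\<sigma> \<in> ?S" using sub by auto
      then show "\<sigma> \<in> preimage \<Sigma> ?K" using S(2) by auto
    qed
    with K show "f \<in> Cc_sub H" unfolding Cc_sub_def by blast
  next
    fix f assume "f \<in> Cc_sub H"
    then obtain K where K: "compactin (gtop \<G>) K" "K \<subseteq> H" "f \<in> Cc_on K" by (auto simp: Cc_sub_def)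
    let ?S = "subtopology (gtop \<E>) ?P closure_of {\<sigma>. f \<sigma> \<noteq> 0}"
    have KP: "preimage \<Sigma> K \<subseteq> ?P" using K(2) by auto
    have "closedin (subtopology (gtop \<E>) ?P) (preimage \<Sigma> K)"
      using KP K(1) closedin_preimage compactin_imp_closedin[OF G.Hausdorff]
      by (metis closedin_subset_topspace)
    then have "?S \<subseteq> preimage \<Sigma> K"
      using K(3) by (intro closure_of_minimal) (auto simp: Cc_on_def)
    moreover have "compactin (subtopology (gtop \<E>) ?P) (preimage \<Sigma> K)"
      using KP compactin_preimage[OF K(1)] by (simp add: compactin_subtopology)
    ultimately have "compactin (subtopology (gtop \<E>) ?P) ?S"
      using closed_compactin by (metis closedin_closure_of)
    moreover have "f \<sigma> = 0" if "p \<sigma> \<notin> H" for \<sigma>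
      using that K(2) Cc_on_support[OF K(3)] by blast
    then have "equivariant_on \<Sigma> ?P f"
      using Cc_D(2,3)[OF Cc_on_Cc[OF K(3)]] by (auto simp: equivariant_on_def)
    ultimately show "f \<in> Cc (restrict_twist \<Sigma> H)"
      using P continuous_map_from_subtopology[OF Cc_D(1)[OF Cc_on_Cc[OF K(3)]]] by (simp add: Cc_def)
  }
qed

text \<open>Vectors on the fibres of H extend by zero to vectors on the fibres of the whole groupoid
  with the same norm, and convolution by f gives the same result on them. The restricted norm is
  thus a supremum over fewer vectors.\<close>

lemma reduced_norm_restrict_le:
  assumes H: "G.open_subgroupoid H" and f: "f \<in> Cc_sub H"
  shows "reduced_norm (restrict_twist \<Sigma> H) f \<le> reduced_norm \<Sigma> f"
proof -
  let ?R = "restrict_twist \<Sigma> H"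
  have Harr: "H \<subseteq> arrows \<G>" and Hmult: "\<And>g h. \<lbrakk>g \<in> H; h \<in> H; gdom \<G> g = gran \<G> h\<rbrakk> \<Longrightarrow> gmult \<G> g h \<in> H"
    using H openin_subset by (auto simp: G.open_subgroupoid_def)
  obtain K where K: "compactin (gtop \<G>) K" "K \<subseteq> H" "f \<in> Cc_on K" using f by (auto simp: Cc_sub_def)
  note f' = Cc_sub_Cc[OF f]
  have arr: "arrows \<G> \<inter> H = H" using Harr by auto
  have fib: "source_fibre ?R x = source_fibre \<Sigma> x \<inter> H" for x
    using Harr by (auto simp: source_fibre_def)
  \<comment> \<open>\<open>lift\<close> is a choice by \<open>SOME\<close>; over H both choices are
    made from the same predicate and therefore coincide.\<close>
  have lift: "lift ?R \<gamma> = lift \<Sigma> \<gamma>" if "\<gamma> \<in> H" for \<gamma>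
  proof -
    have "(\<lambda>\<tau>. \<tau> \<in> arrows (total ?R) \<and> proj ?R \<tau> = \<gamma>) = (\<lambda>\<tau>. \<tau> \<in> arrows \<E> \<and> p \<tau> = \<gamma>)"
      using that by (auto simp: fun_eq_iff)
    then show ?thesis by (simp add: lift_def)
  qed
  have pre: "preimage ?R (source_fibre ?R x) = preimage \<Sigma> (source_fibre \<Sigma> x \<inter> H)" for x
    unfolding fib by (auto simp: preimage_def)
  have off: "\<xi> \<sigma> = 0" if "\<xi> \<in> rep_space ?R x" "p \<sigma> \<notin> H" for \<xi> x \<sigma>
    using that by (auto simp: rep_space_def equivariant_on_def pre)
  have rep: "\<xi> \<in> rep_ball x" if \<xi>: "\<xi> \<in> {\<xi> \<in> rep_space ?R x. rep_norm ?R x \<xi> \<le> 1}" for \<xi> x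
  proof -
    have e: "equivariant_on \<Sigma> (preimage \<Sigma> (source_fibre \<Sigma> x)) \<xi>"
      unfolding equivariant_on_def
    proof (intro conjI ballI allI impI)
      fix \<sigma> z assume s: "\<sigma> \<in> preimage \<Sigma> (source_fibre \<Sigma> x)" "z \<in> circle"
      show "\<xi> (z \<star> \<sigma>) = z * \<xi> \<sigma>"
      proof (cases "p \<sigma> \<in> H")
        case True
        then show ?thesis using s \<xi> by (auto simp: rep_space_def equivariant_on_def pre)
      next
        case False
        then show ?thesis using s \<xi> off[of \<xi> x \<sigma>] off[of \<xi> x "z \<star> \<sigma>"] by simp
      qed
    next
      fix \<sigma> assume "\<sigma> \<notin> preimage \<Sigma> (source_fibre \<Sigma> x)"
      then show "\<xi> \<sigma> = 0" using \<xi> by (auto simp: rep_space_def equivariant_on_def pre)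
    qed
    have 0: "\<xi> (lift \<Sigma> \<gamma>) = 0" if "\<gamma> \<in> source_fibre \<Sigma> x - H" for \<gamma>
      using off[of \<xi> x "lift \<Sigma> \<gamma>"] that \<xi> by auto
    have s: "(\<lambda>\<gamma>. (cmod (\<xi> (lift ?R \<gamma>)))\<^sup>2) summable_on source_fibre ?R x \<longleftrightarrow>
      (\<lambda>\<gamma>. (cmod (\<xi> (lift \<Sigma> \<gamma>)))\<^sup>2) summable_on source_fibre \<Sigma> x"
      by (rule summable_on_cong_neutral) (use 0 in \<open>auto simp: fib lift\<close>)
    have n: "rep_norm ?R x \<xi> = rep_norm \<Sigma> x \<xi>"
      unfolding rep_norm_def
      by (rule arg_cong[of _ _ sqrt], rule infsum_cong_neutral) (use 0 in \<open>auto simp: fib lift\<close>)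
    show ?thesis using \<xi> e s n by (auto simp: rep_space_def)
  qed
  have conv: "rep_norm ?R x (convolution ?R f \<xi>) = rep_norm \<Sigma> x (convolution \<Sigma> f \<xi>)"
    if \<xi>: "\<xi> \<in> rep_space ?R x" for \<xi> x
  proof -
    have 1: "convolution ?R f \<xi> \<sigma> = convolution \<Sigma> f \<xi> \<sigma>" if s: "\<sigma> \<in> preimage \<Sigma> H" for \<sigma>
    proof -
      have "(\<Sum>\<^sub>\<infinity>\<gamma>\<in>source_fibre ?R (src \<sigma>). f (\<sigma> \<cdot> inv\<^sub>E (lift ?R \<gamma>)) * \<xi> (lift ?R \<gamma>)) =
        (\<Sum>\<^sub>\<infinity>\<gamma>\<in>source_fibre \<Sigma> (src \<sigma>). f (\<sigma> \<cdot> inv\<^sub>E (lift \<Sigma> \<gamma>)) * \<xi> (lift \<Sigma> \<gamma>))"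
        by (rule infsum_cong_neutral) (use off[OF \<xi>] in \<open>auto simp: fib lift\<close>)
      then show ?thesis using s by (simp add: convolution_def)
    qed
    \<comment> \<open>The image of a vector on H stays on H: for \<gamma> in H and g outside, g
      \<gamma>^-1 is outside H, since otherwise multiplying by \<gamma> would put g into H.\<close>
    have 2: "convolution \<Sigma> f \<xi> (lift \<Sigma> g) = 0" if g: "g \<in> source_fibre \<Sigma> x - H" for g
    proof -
      have "convolution \<Sigma> f \<xi> (lift \<Sigma> g) = (\<Sum>\<gamma>\<in>{}. f (lift \<Sigma> g \<cdot> inv\<^sub>E (lift \<Sigma> \<gamma>)) * \<xi> (lift \<Sigma> \<gamma>))"
      proof (rule convolution_sum)
        fix \<gamma> assume a: "\<gamma> \<in> arrows \<G>" "gdom \<G> \<gamma> = src (lift \<Sigma> g)"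
        show "f (lift \<Sigma> g \<cdot> inv\<^sub>E (lift \<Sigma> \<gamma>)) * \<xi> (lift \<Sigma> \<gamma>) = 0"
        proof (cases "\<gamma> \<in> H")
          case True
          have "gmult \<G> g (ginv \<G> \<gamma>) \<notin> H"
            using Hmult[of "gmult \<G> g (ginv \<G> \<gamma>)" \<gamma>] True g a by auto
          then show ?thesis
            using Cc_on_support[OF K(3), of "lift \<Sigma> g \<cdot> inv\<^sub>E (lift \<Sigma> \<gamma>)"] K(2) g a by auto
        qed (use off[OF \<xi>, of "lift \<Sigma> \<gamma>"] a in simp)
      qed (use g in auto)
      then show ?thesis by simp
    qed
    show ?thesis
      unfolding rep_norm_def
      by (rule arg_cong[of _ _ sqrt], rule infsum_cong_neutral) (use 1 2 in \<open>auto simp: fib lift\<close>)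
  qed
  have units: "units (base ?R) \<subseteq> units \<G>"
  proof -
    have "units (base ?R) = gdom \<G> ` (arrows \<G> \<inter> H)"
      by (simp only: units_def restrict_simps topspace_subtopology)
    then show ?thesis unfolding units_def by blast
  qed
  have zero: "(\<lambda>_. 0) \<in> {\<xi> \<in> rep_space ?R x. rep_norm ?R x \<xi> \<le> 1}" for x
    by (auto simp: rep_space_def rep_norm_def equivariant_on_def)
  show ?thesis
    unfolding reduced_norm_def[of ?R]
  proof (rule cSup_least)
    fix r assume "r \<in> insert 0 ((\<lambda>x. regular_rep_norm ?R x f) ` units (base ?R))"
    moreover have "0 \<le> reduced_norm \<Sigma> f"
      using cmod_le_reduced_norm[OF f', of undefined] norm_ge_zero order_trans by blast
    moreover have "regular_rep_norm ?R x f \<le> reduced_norm \<Sigma> f" if x: "x \<in> units (base ?R)" for x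
      unfolding regular_rep_norm_def
    proof (rule cSUP_least)
      fix \<xi> assume \<xi>: "\<xi> \<in> {\<xi> \<in> rep_space ?R x. rep_norm ?R x \<xi> \<le> 1}"
      then show "rep_norm ?R x (convolution ?R f \<xi>) \<le> reduced_norm \<Sigma> f"
        using conv rep_norm_le_reduced_norm(2)[OF f' _ rep[OF \<xi>]] x units by auto
    qed (use zero in blast)
    ultimately show "r \<le> reduced_norm \<Sigma> f" by auto
  qed simp
qed

end

section \<open>C*-algebras\<close>

lemma scaleC_zero_left [simp]: "scaleC 0 (a :: 'a::cstar_algebra) = 0"
  using scaleC_of_real[of 0 a] by simp

lemma scaleC_minus_one: "scaleC (-1) (a :: 'a::cstar_algebra) = - a"
  using scaleC_of_real[of "-1" a] by simp

text \<open>Not an axiom: the C*-identity and submultiplicativity give one inequality, and applying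
  it to \<open>star a\<close> gives the other.\<close>

lemma norm_star [simp]: "norm (star a) = norm (a :: 'a::cstar_algebra)"
proof -
  have le: "norm b \<le> norm (star b)" for b :: 'a
  proof (cases "b = 0")
    case False
    have "norm b * norm b \<le> norm (star b) * norm b"
      using cstar_identity[of b] norm_mult_ineq[of "star b" b] by (simp add: power2_eq_square)
    then show ?thesis using False by simp
  qed simp
  show ?thesis using le[of a] le[of "star a"] by (simp add: star_star)
qed

lemma bounded_linear_star: "bounded_linear (star :: 'a::cstar_algebra \<Rightarrow> 'a)"
proof (rule bounded_linear_intro[where K = 1])
  show "star (r *\<^sub>R a) = r *\<^sub>R star a" for r and a :: 'a
    by (simp add: star_scaleC flip: scaleC_of_real)
qed (auto simp: star_add)

lemma bounded_linear_scaleC: "bounded_linear (scaleC c :: 'a::cstar_algebra \<Rightarrow> 'a)"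
proof (rule bounded_linear_intro[where K = "cmod c"])
  show "scaleC c (r *\<^sub>R a) = r *\<^sub>R scaleC c a" for r and a :: 'a
    by (simp add: scaleC_scaleC mult.commute flip: scaleC_of_real)
qed (auto simp: scaleC_add_right norm_scaleC mult.commute)

lemmas tendsto_star = bounded_linear.tendsto[OF bounded_linear_star]
lemmas tendsto_scaleC = bounded_linear.tendsto[OF bounded_linear_scaleC]

lemma star_zero [simp]: "star (0 :: 'a::cstar_algebra) = 0"
  using linear_0[OF bounded_linear.linear[OF bounded_linear_star]] .

lemma closure_image_sequential:
  fixes \<phi> :: "'b \<Rightarrow> 'c::first_countable_topology"
  assumes "a \<in> closure (\<phi> ` S)"
  obtains f where "\<And>n. f n \<in> S" "(\<lambda>n. \<phi> (f n)) \<longlonglongrightarrow> a"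
proof -
  obtain y where y: "\<forall>n. y n \<in> \<phi> ` S" "y \<longlonglongrightarrow> a" using assms unfolding closure_sequential by blast
  then have "\<forall>n. \<exists>f. f \<in> S \<and> y n = \<phi> f" by blast
  then obtain f where f: "\<And>n. f n \<in> S" "\<And>n. y n = \<phi> (f n)" by metis
  from f(2) have "y = (\<lambda>n. \<phi> (f n))" by blast
  with y(2) have "(\<lambda>n. \<phi> (f n)) \<longlonglongrightarrow> a" by simp
  with f(1) show ?thesis by (rule that)
qed

lemma cstar_subalgebra_closure:
  assumes "0 \<in> S" "\<And>a b. a \<in> S \<Longrightarrow> b \<in> S \<Longrightarrow> a + b \<in> S" "\<And>a b. a \<in> S \<Longrightarrow> b \<in> S \<Longrightarrow> a * b \<in> S"
    "\<And>c a. a \<in> S \<Longrightarrow> scaleC c a \<in> S" "\<And>a. a \<in> S \<Longrightarrow> star a \<in> S"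
  shows "cstar_subalgebra (closure S)"
  unfolding cstar_subalgebra_def
proof (intro conjI ballI allI)
  show "0 \<in> closure S" using assms(1) closure_subset by blast
  show "closed (closure S)" by simp
next
  fix a b assume "a \<in> closure S" "b \<in> closure S"
  then obtain f g where fg: "\<forall>n. f n \<in> S" "f \<longlonglongrightarrow> a" "\<forall>n. g n \<in> S" "g \<longlonglongrightarrow> b"
    by (auto simp: closure_sequential)
  show "a + b \<in> closure S"
    using fg assms(2) tendsto_add[OF fg(2,4)] unfolding closure_sequential
    by (intro exI[of _ "\<lambda>n. f n + g n"]) auto
  show "a * b \<in> closure S"
    using fg assms(3) tendsto_mult[OF fg(2,4)] unfolding closure_sequential
    by (intro exI[of _ "\<lambda>n. f n * g n"]) auto
next
  fix c a assume "a \<in> closure S"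
  then obtain f where f: "\<forall>n. f n \<in> S" "f \<longlonglongrightarrow> a" by (auto simp: closure_sequential)
  show "scaleC c a \<in> closure S"
    using f assms(4) tendsto_scaleC[OF f(2)] unfolding closure_sequential
    by (intro exI[of _ "\<lambda>n. scaleC c (f n)"]) auto
next
  fix a assume "a \<in> closure S"
  then obtain f where f: "\<forall>n. f n \<in> S" "f \<longlonglongrightarrow> a" by (auto simp: closure_sequential)
  show "star a \<in> closure S"
    using f assms(5) tendsto_star[OF f(2)] unfolding closure_sequential
    by (intro exI[of _ "\<lambda>n. star (f n)"]) auto
qed

lemma cstar_subalgebraD:
  assumes "cstar_subalgebra B"
  shows "0 \<in> B" "closed B" "\<And>a b. a \<in> B \<Longrightarrow> b \<in> B \<Longrightarrow> a + b \<in> B"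
    "\<And>a b. a \<in> B \<Longrightarrow> b \<in> B \<Longrightarrow> a * b \<in> B" "\<And>c a. a \<in> B \<Longrightarrow> scaleC c a \<in> B"
    "\<And>a. a \<in> B \<Longrightarrow> star a \<in> B"
  using assms by (auto simp: cstar_subalgebra_def)

lemma cstar_subalgebra_hull: "cstar_subalgebra (cstar_subalgebra hull S)"
proof (rule hull_in)
  fix T :: "'a set set" assume "\<forall>B\<in>T. cstar_subalgebra B"
  then show "cstar_subalgebra (\<Inter>T)" unfolding cstar_subalgebra_def by (auto intro: closed_Inter)
qed

section \<open>Elements of the reduced C*-algebra as functions\<close>

locale reduced_ample_twist = ample_twist \<Sigma> for \<Sigma> :: "('e, 'g) twist_data" +
  fixes \<iota> :: "('e \<Rightarrow> complex) \<Rightarrow> 'a::cstar_algebra"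
  assumes reduced: "reduced_cstar_algebra \<Sigma> UNIV \<iota>"
begin

lemma iota_add: "\<lbrakk>f \<in> Cc \<Sigma>; g \<in> Cc \<Sigma>\<rbrakk> \<Longrightarrow> \<iota> (\<lambda>\<sigma>. f \<sigma> + g \<sigma>) = \<iota> f + \<iota> g"
  and iota_mult: "\<lbrakk>f \<in> Cc \<Sigma>; g \<in> Cc \<Sigma>\<rbrakk> \<Longrightarrow> \<iota> (convolution \<Sigma> f g) = \<iota> f * \<iota> g"
  and iota_scale: "f \<in> Cc \<Sigma> \<Longrightarrow> \<iota> (\<lambda>\<sigma>. c * f \<sigma>) = scaleC c (\<iota> f)"
  and iota_star: "f \<in> Cc \<Sigma> \<Longrightarrow> \<iota> (involution \<Sigma> f) = star (\<iota> f)"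
  and iota_norm: "f \<in> Cc \<Sigma> \<Longrightarrow> norm (\<iota> f) = reduced_norm \<Sigma> f"
  and iota_dense: "closure (\<iota> ` Cc \<Sigma>) = UNIV"
  using reduced unfolding reduced_cstar_algebra_def by blast+

lemma iota_zero [simp]: "\<iota> (\<lambda>_. 0) = 0"
  using iota_scale[OF Cc_on_Cc[OF Cc_zero], of 0] by simp

lemma iota_diff:
  assumes "f \<in> Cc \<Sigma>" "g \<in> Cc \<Sigma>"
  shows "\<iota> (\<lambda>\<sigma>. f \<sigma> - g \<sigma>) = \<iota> f - \<iota> g"
  using iota_add[OF assms(1) Cc_times[OF assms(2), of "-1"]] iota_scale[OF assms(2), of "-1"]
  by (simp add: scaleC_minus_one)

lemma cmod_diff_le:
  assumes "f \<in> Cc \<Sigma>" "g \<in> Cc \<Sigma>"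
  shows "cmod (f \<sigma> - g \<sigma>) \<le> norm (\<iota> f - \<iota> g)"
  using cmod_le_reduced_norm[OF Cc_minus[OF assms], of \<sigma>] iota_norm[OF Cc_minus[OF assms]] iota_diff[OF assms]
  by simp

lemma approximation:
  obtains f where "\<And>n. f n \<in> Cc \<Sigma>" "(\<lambda>n. \<iota> (f n)) \<longlonglongrightarrow> a"
  by (rule closure_image_sequential[of a \<iota> "Cc \<Sigma>"]) (auto simp: iota_dense)

text \<open>The extension of the evaluation at \<sigma> from \<open>Cc \<Sigma>\<close> to the
  completion, taken along some approximating sequence; by \<open>ev_tendsto\<close> any other
  sequence gives the same value.\<close>

definition ev :: "'a \<Rightarrow> 'e \<Rightarrow> complex" where
  "ev a \<sigma> = lim (\<lambda>n. (SOME f. (\<forall>n. f n \<in> Cc \<Sigma>) \<and> (\<lambda>n. \<iota> (f n)) \<longlonglongrightarrow> a) n \<sigma>)"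

text \<open>Evaluation is contractive for the reduced norm. So convergence in A forces convergence
  of the values, and for two sequences with the same limit the differences of the values tend to
  0.\<close>

lemma ev_tendsto:
  assumes f: "\<And>n. f n \<in> Cc \<Sigma>" "(\<lambda>n. \<iota> (f n)) \<longlonglongrightarrow> a"
  shows "(\<lambda>n. f n \<sigma>) \<longlonglongrightarrow> ev a \<sigma>"
proof -
  define g where "g = (SOME f. (\<forall>n. f n \<in> Cc \<Sigma>) \<and> (\<lambda>n. \<iota> (f n)) \<longlonglongrightarrow> a)"
  have "(\<forall>n. g n \<in> Cc \<Sigma>) \<and> (\<lambda>n. \<iota> (g n)) \<longlonglongrightarrow> a"
    unfolding g_def by (rule someI[of _ f]) (use f in auto)
  then have g: "g n \<in> Cc \<Sigma>" "(\<lambda>n. \<iota> (g n)) \<longlonglongrightarrow> a" for n by auto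
  have "Cauchy (\<lambda>n. \<iota> (g n))" using g(2) by (rule LIMSEQ_imp_Cauchy)
  then have "Cauchy (\<lambda>n. g n \<sigma>)"
    unfolding Cauchy_def dist_norm using cmod_diff_le[OF g(1) g(1)] le_less_trans by metis
  then have "(\<lambda>n. g n \<sigma>) \<longlonglongrightarrow> ev a \<sigma>"
    unfolding ev_def g_def[symmetric] by (simp add: Cauchy_convergent_iff convergent_LIMSEQ_iff)
  moreover have "(\<lambda>n. f n \<sigma> - g n \<sigma>) \<longlonglongrightarrow> 0"
  proof (rule Lim_null_comparison)
    show "\<forall>\<^sub>F n in sequentially. cmod (f n \<sigma> - g n \<sigma>) \<le> norm (\<iota> (f n) - \<iota> (g n))"
      using cmod_diff_le[OF f(1) g(1)] by simp
    show "(\<lambda>n. norm (\<iota> (f n) - \<iota> (g n))) \<longlonglongrightarrow> 0"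
      using tendsto_norm[OF tendsto_diff[OF f(2) g(2)]] by simp
  qed
  ultimately show ?thesis using tendsto_add[of "\<lambda>n. g n \<sigma>" _ _ "\<lambda>n. f n \<sigma> - g n \<sigma>" 0] by simp
qed

lemma ev_iota [simp]: "f \<in> Cc \<Sigma> \<Longrightarrow> ev (\<iota> f) \<sigma> = f \<sigma>"
  using ev_tendsto[of "\<lambda>_. f" "\<iota> f" \<sigma>] by (simp add: LIMSEQ_const_iff)

lemma ev_diff: "ev (a - b) \<sigma> = ev a \<sigma> - ev b \<sigma>"
proof -
  obtain f where f: "\<And>n. f n \<in> Cc \<Sigma>" "(\<lambda>n. \<iota> (f n)) \<longlonglongrightarrow> a" by (rule approximation) blast
  obtain g where g: "\<And>n. g n \<in> Cc \<Sigma>" "(\<lambda>n. \<iota> (g n)) \<longlonglongrightarrow> b" by (rule approximation) blast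
  have "(\<lambda>n. \<iota> (\<lambda>\<sigma>. f n \<sigma> - g n \<sigma>)) \<longlonglongrightarrow> a - b"
    using tendsto_diff[OF f(2) g(2)] by (simp add: iota_diff f g)
  from ev_tendsto[OF _ this, of \<sigma>] have "(\<lambda>n. f n \<sigma> - g n \<sigma>) \<longlonglongrightarrow> ev (a - b) \<sigma>"
    using Cc_minus f(1) g(1) by blast
  then show ?thesis
    using LIMSEQ_unique tendsto_diff[OF ev_tendsto[OF f, of \<sigma>] ev_tendsto[OF g, of \<sigma>]] by blast
qed

lemma ev_dist:
  assumes "f \<in> Cc \<Sigma>"
  shows "cmod (f \<sigma> - ev a \<sigma>) \<le> norm (\<iota> f - a)"
proof -
  obtain g where g: "\<And>n. g n \<in> Cc \<Sigma>" "(\<lambda>n. \<iota> (g n)) \<longlonglongrightarrow> a" by (rule approximation) blast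
  show ?thesis
  proof (rule tendsto_le[OF sequentially_bot])
    show "(\<lambda>n. cmod (f \<sigma> - g n \<sigma>)) \<longlonglongrightarrow> cmod (f \<sigma> - ev a \<sigma>)"
      by (intro tendsto_intros ev_tendsto g)
    show "(\<lambda>n. norm (\<iota> f - \<iota> (g n))) \<longlonglongrightarrow> norm (\<iota> f - a)"
      by (intro tendsto_intros g)
  qed (use cmod_diff_le[OF assms g(1)] in simp)
qed

lemma ev_act:
  assumes "\<sigma> \<in> arrows \<E>" "cmod z = 1"
  shows "ev a (z \<star> \<sigma>) = z * ev a \<sigma>"
proof -
  obtain g where g: "\<And>n. g n \<in> Cc \<Sigma>" "(\<lambda>n. \<iota> (g n)) \<longlonglongrightarrow> a" by (rule approximation) blast
  have "(\<lambda>n. g n (z \<star> \<sigma>)) = (\<lambda>n. z * g n \<sigma>)" using Cc_D(2)[OF g(1) assms] by simp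
  then show ?thesis
    using LIMSEQ_unique ev_tendsto[OF g, of "z \<star> \<sigma>"] tendsto_mult_left[OF ev_tendsto[OF g, of \<sigma>], of z]
    by metis
qed

lemma ev_outside: "\<sigma> \<notin> arrows \<E> \<Longrightarrow> ev a \<sigma> = 0"
proof -
  assume s: "\<sigma> \<notin> arrows \<E>"
  obtain g where g: "\<And>n. g n \<in> Cc \<Sigma>" "(\<lambda>n. \<iota> (g n)) \<longlonglongrightarrow> a" by (rule approximation) blast
  have "(\<lambda>n. g n \<sigma>) = (\<lambda>n. 0)" using Cc_D(3)[OF g(1) s] by simp
  then show ?thesis using LIMSEQ_unique[OF ev_tendsto[OF g, of \<sigma>]] by simp
qed

text \<open>The bound \<open>ev_dist\<close> is uniform in \<sigma>, so \<open>ev a\<close> is a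
  uniform limit of continuous functions.\<close>

lemma ev_continuous: "continuous_map (gtop \<E>) euclidean (ev a)"
proof -
  obtain g where g: "\<And>n. g n \<in> Cc \<Sigma>" "(\<lambda>n. \<iota> (g n)) \<longlonglongrightarrow> a" by (rule approximation) blast
  have "continuous_map (gtop \<E>) Met_TC.mtopology (ev a)"
  proof (rule Met_TC.continuous_map_uniform_limit[where f = g and F = sequentially])
    show "\<forall>\<^sub>F n in sequentially. continuous_map (gtop \<E>) Met_TC.mtopology (g n)"
      using Cc_D(1)[OF g(1)] by simp
    fix \<epsilon> :: real assume "\<epsilon> > 0"
    then have "\<forall>\<^sub>F n in sequentially. dist (\<iota> (g n)) a < \<epsilon>" using g(2) tendstoD by blast
    then show "\<forall>\<^sub>F n in sequentially. \<forall>x\<in>topspace (gtop \<E>). ev a x \<in> UNIV \<and> dist (g n x) (ev a x) < \<epsilon>"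
      by eventually_elim (use ev_dist[OF g(1)] le_less_trans in \<open>simp add: dist_norm, blast\<close>)
  qed simp
  then show ?thesis by simp
qed

lemma open_support: "openin (gtop \<G>) (supp (ev a))"
proof -
  have "openin (gtop \<E>) {\<sigma> \<in> arrows \<E>. ev a \<sigma> \<in> - {0}}"
    by (rule openin_continuous_map_preimage[OF ev_continuous]) auto
  moreover have "{\<sigma> \<in> arrows \<E>. ev a \<sigma> \<in> - {0}} = {\<sigma> \<in> arrows \<E>. ev a \<sigma> \<noteq> 0}" by auto
  ultimately show ?thesis using proj_open by (simp add: open_map_def supp_def)
qed

text \<open>
  An element supported on a bisection acts in each regular representation as a weighted partial
  permutation. The case \<open>C = 0\<close> says that \<open>ev\<close> is injective.
\<close>

lemma norm_le_of_bisection: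
  assumes C: "\<And>\<sigma>. cmod (ev a \<sigma>) \<le> C"
    and bis: "G.bisection (supp (ev a))"
  shows "norm a \<le> C"
proof -
  have C0: "C \<ge> 0" using C[of undefined] norm_ge_zero order_trans by blast
  \<comment> \<open>The reduced norm is defined on functions only, so the estimate is made for a
    function f, with its distance to a as the error; letting f tend to a gives the claim.\<close>
  have main: "norm (\<iota> f) \<le> norm (\<iota> f - a) + C" if f: "f \<in> Cc \<Sigma>" for f
    unfolding iota_norm[OF f]
  proof (rule reduced_norm_leI[OF f])
    fix x \<xi> F assume x: "x \<in> units \<G>" and \<xi>: "\<xi> \<in> rep_ball x" and F: "finite F" "F \<subseteq> source_fibre \<Sigma> x"
    obtain K where K: "compactin (gtop \<G>) K" "f \<in> Cc_on K" using Cc_compact[OF f] .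
    obtain N where N: "\<And>g. g \<in> arrows \<G> \<Longrightarrow> finite (row K g) \<and> card (row K g) \<le> N"
      by (rule row_column_bound[OF K(1)]) blast
    define R where "R = (\<Union>g\<in>F. row K g)"
    have arr: "g \<in> arrows \<G>" "gdom \<G> g = x" if "g \<in> F" for g using F(2) that by auto
    have R: "finite R" "R \<subseteq> source_fibre \<Sigma> x"
      using F N(1) arr by (auto simp: R_def row_def)
    \<comment> \<open>Dropping the coordinates outside R does not change the rows in F of f, and it
      makes these rows finite sums for every other function as well. This permits the passage from
      the approximants \<open>k n\<close>, whose supports may grow, to \<open>ev a\<close>.\<close>
    define \<eta> where "\<eta> \<tau> = (if p \<tau> \<in> R then \<xi> \<tau> else 0)" for \<tau>
    have \<eta>: "\<eta> \<in> rep_ball x"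
    proof (rule rep_ballI)
      show "equivariant_on \<Sigma> (preimage \<Sigma> (source_fibre \<Sigma> x)) \<eta>"
        using \<xi> by (auto simp: rep_space_def equivariant_on_def \<eta>_def)
      fix F' assume F': "finite F'" "F' \<subseteq> source_fibre \<Sigma> x"
      then have "(\<Sum>\<gamma>\<in>F'. (cmod (\<eta> (lift \<Sigma> \<gamma>)))\<^sup>2) \<le> (\<Sum>\<gamma>\<in>F'. (cmod (\<xi> (lift \<Sigma> \<gamma>)))\<^sup>2)"
        by (intro sum_mono) (auto simp: \<eta>_def)
      also have "\<dots> \<le> 1" by (rule rep_ballD(3)[OF \<xi> F'])
      finally show "(\<Sum>\<gamma>\<in>F'. (cmod (\<eta> (lift \<Sigma> \<gamma>)))\<^sup>2) \<le> 1" .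
    qed
    define T where "T h g = (\<Sum>\<gamma>\<in>R. h (lift \<Sigma> g \<cdot> inv\<^sub>E (lift \<Sigma> \<gamma>)) * \<eta> (lift \<Sigma> \<gamma>))" for h :: "'e \<Rightarrow> complex" and g
    have conv: "convolution \<Sigma> h \<eta> (lift \<Sigma> g) = T h g" if "g \<in> F" for h g
      unfolding T_def by (rule convolution_sum) (use arr[OF that] R in \<open>auto simp: \<eta>_def\<close>)
    have conv_f: "convolution \<Sigma> f \<xi> (lift \<Sigma> g) = T f g" if g: "g \<in> F" for g
    proof -
      have "row K g \<subseteq> R" using g by (auto simp: R_def)
      then have "convolution \<Sigma> f \<xi> (lift \<Sigma> g) = (\<Sum>\<gamma>\<in>R. f (lift \<Sigma> g \<cdot> inv\<^sub>E (lift \<Sigma> \<gamma>)) * \<xi> (lift \<Sigma> \<gamma>))"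
        using convolution_row(1)[OF K(2) arr(1)[OF g] R(1)] R(2) arr(2)[OF g] by simp
      also have "\<dots> = T f g" unfolding T_def using R(2) by (intro sum.cong refl) (auto simp: \<eta>_def)
      finally show ?thesis .
    qed
    obtain k where k: "\<And>n. k n \<in> Cc \<Sigma>" "(\<lambda>n. \<iota> (k n)) \<longlonglongrightarrow> a" by (rule approximation) blast
    have "L2_set (\<lambda>g. cmod (T f g)) F \<le> norm (\<iota> f - a) + L2_set (\<lambda>g. cmod (T (ev a) g)) F"
    proof (rule tendsto_le[OF sequentially_bot])
      show "(\<lambda>n. norm (\<iota> f - \<iota> (k n)) + L2_set (\<lambda>g. cmod (T (k n) g)) F)
        \<longlonglongrightarrow> norm (\<iota> f - a) + L2_set (\<lambda>g. cmod (T (ev a) g)) F"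
        unfolding L2_set_def T_def by (intro tendsto_intros k ev_tendsto)
      show "(\<lambda>n. L2_set (\<lambda>g. cmod (T f g)) F) \<longlonglongrightarrow> L2_set (\<lambda>g. cmod (T f g)) F" by simp
      have "L2_set (\<lambda>g. cmod (T f g)) F \<le> norm (\<iota> f - \<iota> (k n)) + L2_set (\<lambda>g. cmod (T (k n) g)) F" for n
      proof -
        let ?d = "\<lambda>\<sigma>. f \<sigma> - k n \<sigma>"
        have d: "?d \<in> Cc \<Sigma>" using Cc_minus[OF f k(1)] .
        have "T f g = T ?d g + T (k n) g" for g
          by (simp add: T_def flip: sum.distrib distrib_right)
        then have "L2_set (\<lambda>g. cmod (T f g)) F \<le> L2_set (\<lambda>g. cmod (T ?d g) + cmod (T (k n) g)) F"
          by (intro L2_set_mono) (auto simp: norm_triangle_ineq)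
        also have "\<dots> \<le> L2_set (\<lambda>g. cmod (T ?d g)) F + L2_set (\<lambda>g. cmod (T (k n) g)) F"
          by (rule L2_set_triangle_ineq)
        also have "L2_set (\<lambda>g. cmod (T ?d g)) F = L2_set (\<lambda>g. cmod (convolution \<Sigma> ?d \<eta> (lift \<Sigma> g))) F"
          by (rule L2_set_cong) (use conv in auto)
        also have "\<dots> \<le> reduced_norm \<Sigma> ?d" by (rule finite_rep_le[OF d x \<eta> F])
        also have "\<dots> = norm (\<iota> f - \<iota> (k n))" using iota_norm[OF d] iota_diff[OF f k(1)] by simp
        finally show ?thesis by simp
      qed
      then show "\<forall>\<^sub>F n in sequentially. L2_set (\<lambda>g. cmod (T f g)) F
        \<le> norm (\<iota> f - \<iota> (k n)) + L2_set (\<lambda>g. cmod (T (k n) g)) F" by simp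
    qed
    also have "L2_set (\<lambda>g. cmod (T (ev a) g)) F \<le> C"
    proof -
      let ?m = "\<lambda>g \<gamma>. ev a (lift \<Sigma> g \<cdot> inv\<^sub>E (lift \<Sigma> \<gamma>))"
      have Rarr: "\<gamma> \<in> arrows \<G>" "gdom \<G> \<gamma> = x" if "\<gamma> \<in> R" for \<gamma> using R(2) that by auto
      have nz: "gmult \<G> g (ginv \<G> \<gamma>) \<in> supp (ev a)"
        if "g \<in> F" "\<gamma> \<in> R" "?m g \<gamma> \<noteq> 0" for g \<gamma>
        unfolding supp_def using that arr[OF that(1)] Rarr[OF that(2)]
        by (intro image_eqI[of _ _ "lift \<Sigma> g \<cdot> inv\<^sub>E (lift \<Sigma> \<gamma>)"]) auto
      have "(\<Sum>g\<in>F. (cmod (T (ev a) g))\<^sup>2) \<le> C\<^sup>2 * (1::nat) * (1::nat) * (\<Sum>\<gamma>\<in>R. (cmod (\<eta> (lift \<Sigma> \<gamma>)))\<^sup>2)"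
        unfolding T_def
      proof (rule sparse_matrix_bound[OF F(1) R(1) C])
        fix g assume g: "g \<in> F"
        have "\<gamma> = \<delta>" if "\<gamma> \<in> R" "\<delta> \<in> R" "?m g \<gamma> \<noteq> 0" "?m g \<delta> \<noteq> 0" for \<gamma> \<delta>
        proof -
          note * = arr[OF g] Rarr[OF that(1)] Rarr[OF that(2)]
          have "gmult \<G> g (ginv \<G> \<gamma>) = gmult \<G> g (ginv \<G> \<delta>)"
            by (rule G.bisection_ranD[OF bis nz nz]) (use that g * in auto)
          from G.mult_left_cancel[OF _ _ _ _ _ this] have "ginv \<G> \<gamma> = ginv \<G> \<delta>" using * by simp
          then show ?thesis using * G.inv_inv by metis
        qed
        then show "card {\<gamma> \<in> R. ?m g \<gamma> \<noteq> 0} \<le> 1"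
          using R(1) by (simp add: card_le_Suc0_iff_eq)
      next
        fix \<gamma> assume g: "\<gamma> \<in> R"
        have "g = h" if "g \<in> F" "h \<in> F" "?m g \<gamma> \<noteq> 0" "?m h \<gamma> \<noteq> 0" for g h
        proof -
          note * = Rarr[OF g] arr[OF that(1)] arr[OF that(2)]
          have "gmult \<G> g (ginv \<G> \<gamma>) = gmult \<G> h (ginv \<G> \<gamma>)"
            by (rule G.bisection_domD[OF bis nz nz]) (use that g * in auto)
          from G.mult_right_cancel[OF _ _ _ _ _ this] show ?thesis using * by simp
        qed
        then show "card {g \<in> F. ?m g \<gamma> \<noteq> 0} \<le> 1"
          using F(1) by (simp add: card_le_Suc0_iff_eq)
      qed
      also have "\<dots> \<le> C\<^sup>2 * 1"
        using rep_ballD(3)[OF \<eta> R] by (simp add: mult_left_le)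
      finally show ?thesis unfolding L2_set_def using C0 by (simp add: real_le_lsqrt)
    qed
    finally have "L2_set (\<lambda>g. cmod (T f g)) F \<le> norm (\<iota> f - a) + C" by simp
    also have "L2_set (\<lambda>g. cmod (T f g)) F = L2_set (\<lambda>g. cmod (convolution \<Sigma> f \<xi> (lift \<Sigma> g))) F"
      by (rule L2_set_cong) (use conv_f in auto)
    finally show "L2_set (\<lambda>g. cmod (convolution \<Sigma> f \<xi> (lift \<Sigma> g))) F \<le> norm (\<iota> f - a) + C" .
  qed (use C0 in simp)
  obtain k where k: "\<And>n. k n \<in> Cc \<Sigma>" "(\<lambda>n. \<iota> (k n)) \<longlonglongrightarrow> a" by (rule approximation) blast
  have "norm a \<le> norm (a - a) + C"
  proof (rule tendsto_le[OF sequentially_bot])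
    show "(\<lambda>n. norm (\<iota> (k n))) \<longlonglongrightarrow> norm a" by (intro tendsto_intros k)
    show "(\<lambda>n. norm (\<iota> (k n) - a) + C) \<longlonglongrightarrow> norm (a - a) + C" by (intro tendsto_intros k)
  qed (use main[OF k(1)] in simp)
  then show ?thesis by simp
qed

lemma ev_inject:
  assumes "\<And>\<sigma>. \<sigma> \<in> arrows \<E> \<Longrightarrow> ev a \<sigma> = ev b \<sigma>"
  shows "a = b"
proof -
  have 0: "ev (a - b) \<sigma> = 0" for \<sigma>
    using assms by (cases "\<sigma> \<in> arrows \<E>") (auto simp: ev_diff ev_outside)
  have "norm (a - b) \<le> 0"
    by (rule norm_le_of_bisection) (use 0 in \<open>auto simp: G.bisection_def supp_def\<close>)
  then show ?thesis by simp
qed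

lemma ev_star:
  assumes "\<sigma> \<in> arrows \<E>"
  shows "ev (star a) \<sigma> = cnj (ev a (inv\<^sub>E \<sigma>))"
proof -
  obtain g where g: "\<And>n. g n \<in> Cc \<Sigma>" "(\<lambda>n. \<iota> (g n)) \<longlonglongrightarrow> a" by (rule approximation) blast
  have "(\<lambda>n. \<iota> (involution \<Sigma> (g n))) \<longlonglongrightarrow> star a"
    using tendsto_star[OF g(2)] by (simp add: iota_star g)
  from ev_tendsto[OF _ this, of \<sigma>] have "(\<lambda>n. cnj (g n (inv\<^sub>E \<sigma>))) \<longlonglongrightarrow> ev (star a) \<sigma>"
    using involution_in_Cc g(1) assms by (simp add: involution_def)
  then show ?thesis using LIMSEQ_unique tendsto_cnj[OF ev_tendsto[OF g, of "inv\<^sub>E \<sigma>"]] by blast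
qed

text \<open>A nonzero value of a at \<sigma> thus forces a nonzero value of
  \<open>star a * a\<close> at the source of \<sigma>, where evaluation is multiplicative on
  D.\<close>

lemma ev_star_mult_ge:
  assumes s: "\<sigma> \<in> arrows \<E>"
  shows "(cmod (ev a \<sigma>))\<^sup>2 \<le> Re (ev (star a * a) (one (src \<sigma>)))"
proof -
  obtain g where g: "\<And>n. g n \<in> Cc \<Sigma>" "(\<lambda>n. \<iota> (g n)) \<longlonglongrightarrow> a" by (rule approximation) blast
  have "(\<lambda>n. \<iota> (convolution \<Sigma> (involution \<Sigma> (g n)) (g n))) \<longlonglongrightarrow> star a * a"
    using tendsto_mult[OF tendsto_star[OF g(2)] g(2)] by (simp add: iota_star iota_mult g involution_in_Cc)
  from ev_tendsto[OF _ this] have 1: "(\<lambda>n. convolution \<Sigma> (involution \<Sigma> (g n)) (g n) (one (src \<sigma>)))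
      \<longlonglongrightarrow> ev (star a * a) (one (src \<sigma>))"
    using involution_in_Cc convolution_in_Cc g(1) by blast
  show ?thesis
    by (rule tendsto_le[OF sequentially_bot tendsto_Re[OF 1] tendsto_power[OF tendsto_norm[OF ev_tendsto[OF g, of \<sigma>]]]])
      (use involution_convolution_ge[OF g(1) s] in simp)
qed

end

section \<open>Cartan intermediate subalgebras\<close>

text \<open>An approximate unit in D, a faithful expectation onto D and the maximality of D all
  survive the passage from A to a smaller algebra containing D. What remains is generation by
  normalizers.\<close>

lemma cartan_intermediateI:
  assumes A: "cartan_pair A D" and B: "cstar_subalgebra B" "D \<subseteq> B" "B \<subseteq> A"
    and gen: "B \<subseteq> cstar_subalgebra hull (normalizers B D)"
  shows "cartan_intermediate A D B"
proof -
  have "cstar_subalgebra hull (normalizers B D) \<subseteq> B"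
    by (rule hull_minimal) (use B in \<open>auto simp: normalizers_def\<close>)
  moreover have "contains_approximate_unit D B"
    using A B(3) unfolding cartan_pair_def contains_approximate_unit_def by (meson subsetD)
  moreover obtain P where "conditional_expectation A D P" "faithful_on A P"
    using A by (auto simp: cartan_pair_def)
  then have "conditional_expectation B D P" "faithful_on B P"
    using B(3) unfolding conditional_expectation_def faithful_on_def by (meson subsetD)+
  moreover have "{a \<in> B. \<forall>d\<in>D. d * a = a * d} = D"
    using A B(2,3) unfolding cartan_pair_def by blast
  ultimately show ?thesis
    using A B gen unfolding cartan_intermediate_def cartan_pair_def by blast
qed

context reduced_ample_twist begin

lemma C0_units_eq: "C0_units \<Sigma> \<iota> = closure (\<iota> ` unit_supported)"
  unfolding C0_units_def unit_supported_def Cc_on_def ..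

abbreviation "D \<equiv> C0_units \<Sigma> \<iota>"

lemma iota_unit_supported: "f \<in> unit_supported \<Longrightarrow> \<iota> f \<in> D"
  unfolding C0_units_eq by (rule subsetD[OF closure_subset]) (rule imageI)

lemma closed_D: "closed D"
  by (simp add: C0_units_def)

lemma D_approximation:
  assumes "d \<in> D"
  obtains h where "\<And>n. h n \<in> unit_supported" "(\<lambda>n. \<iota> (h n)) \<longlonglongrightarrow> d"
  by (rule closure_image_sequential[OF assms[unfolded C0_units_eq]]) blast

lemma unit_supported_Cc: "h \<in> unit_supported \<Longrightarrow> h \<in> Cc \<Sigma>"
  by (simp add: unit_supported_def Cc_on_Cc)

lemma ev_unit_left:
  assumes d: "d \<in> D" and s: "\<sigma> \<in> arrows \<E>"
  shows "ev (d * a) \<sigma> = ev d (one (rng \<sigma>)) * ev a \<sigma>"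
proof -
  obtain g where g: "\<And>n. g n \<in> Cc \<Sigma>" "(\<lambda>n. \<iota> (g n)) \<longlonglongrightarrow> a" by (rule approximation) blast
  obtain h where h: "\<And>n. h n \<in> unit_supported" "(\<lambda>n. \<iota> (h n)) \<longlonglongrightarrow> d" by (rule D_approximation[OF d]) blast
  note h' = unit_supported_Cc[OF h(1)]
  have "(\<lambda>n. \<iota> (convolution \<Sigma> (h n) (g n))) \<longlonglongrightarrow> d * a"
    using tendsto_mult[OF h(2) g(2)] by (simp add: iota_mult g h')
  from ev_tendsto[OF convolution_in_Cc[OF h' g(1)] this, of \<sigma>]
  have "(\<lambda>n. h n (one (rng \<sigma>)) * g n \<sigma>) \<longlonglongrightarrow> ev (d * a) \<sigma>"
    using convolution_unit_left[OF g(1) h(1) s] by simp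
  then show ?thesis
    using LIMSEQ_unique tendsto_mult[OF ev_tendsto[OF h' h(2)] ev_tendsto[OF g]] by blast
qed

lemma ev_unit_right:
  assumes d: "d \<in> D" and s: "\<sigma> \<in> arrows \<E>"
  shows "ev (a * d) \<sigma> = ev a \<sigma> * ev d (one (src \<sigma>))"
proof -
  obtain g where g: "\<And>n. g n \<in> Cc \<Sigma>" "(\<lambda>n. \<iota> (g n)) \<longlonglongrightarrow> a" by (rule approximation) blast
  obtain h where h: "\<And>n. h n \<in> unit_supported" "(\<lambda>n. \<iota> (h n)) \<longlonglongrightarrow> d" by (rule D_approximation[OF d]) blast
  note h' = unit_supported_Cc[OF h(1)]
  have "(\<lambda>n. \<iota> (convolution \<Sigma> (g n) (h n))) \<longlonglongrightarrow> a * d"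
    using tendsto_mult[OF g(2) h(2)] by (simp add: iota_mult g h')
  from ev_tendsto[OF convolution_in_Cc[OF g(1) h'] this, of \<sigma>]
  have "(\<lambda>n. g n \<sigma> * h n (one (src \<sigma>))) \<longlonglongrightarrow> ev (a * d) \<sigma>"
    using convolution_unit_right[OF g(1) h(1) s] by simp
  then show ?thesis
    using LIMSEQ_unique tendsto_mult[OF ev_tendsto[OF g] ev_tendsto[OF h' h(2)]] by blast
qed

subsection \<open>The subalgebra of an open subgroupoid\<close>

definition subalg :: "'g set \<Rightarrow> 'a set" where
  "subalg H = closure (\<iota> ` Cc_sub H)"

lemma iota_subalg: "f \<in> Cc_sub H \<Longrightarrow> \<iota> f \<in> subalg H"
  unfolding subalg_def by (rule subsetD[OF closure_subset]) (rule imageI)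

lemma Cc_subI: "\<lbrakk>f \<in> Cc_on K; compactin (gtop \<G>) K; K \<subseteq> H\<rbrakk> \<Longrightarrow> f \<in> Cc_sub H"
  by (auto simp: Cc_sub_def)

lemma Cc_subE:
  assumes "f \<in> Cc_sub H"
  obtains K where "f \<in> Cc_on K" "compactin (gtop \<G>) K" "K \<subseteq> H"
  using assms by (auto simp: Cc_sub_def)

lemma Cc_sub_add:
  assumes "f \<in> Cc_sub H" "g \<in> Cc_sub H"
  shows "(\<lambda>\<sigma>. f \<sigma> + g \<sigma>) \<in> Cc_sub H"
proof -
  obtain K where K: "f \<in> Cc_on K" "compactin (gtop \<G>) K" "K \<subseteq> H" by (rule Cc_subE[OF assms(1)])
  obtain L where L: "g \<in> Cc_on L" "compactin (gtop \<G>) L" "L \<subseteq> H" by (rule Cc_subE[OF assms(2)])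
  have c: "compactin (gtop \<G>) (K \<union> L)" using K L by (simp add: compactin_Un)
  show ?thesis
    by (rule Cc_subI[OF Cc_add[OF Cc_on_mono[OF K(1)] Cc_on_mono[OF L(1)] c] c]) (use K L in auto)
qed

lemma Cc_sub_scale: "f \<in> Cc_sub H \<Longrightarrow> (\<lambda>\<sigma>. c * f \<sigma>) \<in> Cc_sub H"
  by (metis Cc_subE Cc_subI Cc_scale)

lemma Cc_sub_diff:
  assumes "f \<in> Cc_sub H" "g \<in> Cc_sub H"
  shows "(\<lambda>\<sigma>. f \<sigma> - g \<sigma>) \<in> Cc_sub H"
  using Cc_sub_add[OF assms(1) Cc_sub_scale[OF assms(2), of "-1"]] by simp

text \<open>The norm in which \<open>reduced_subalgebra\<close> demands Cauchy sequences is
  dominated by the norm of A, so every sequence that converges in A qualifies, and the natural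
  inclusion becomes a closure in A.\<close>

lemma reduced_subalgebra_eq:
  assumes H: "G.open_subgroupoid H"
  shows "reduced_subalgebra \<Sigma> \<iota> H = subalg H"
proof -
  have CH: "Cc (restrict_twist \<Sigma> H) = Cc_sub H"
    using H by (intro Cc_restrict_twist) (simp add: G.open_subgroupoid_def)
  show ?thesis
  proof (intro equalityI subsetI)
    fix a assume "a \<in> reduced_subalgebra \<Sigma> \<iota> H"
    then obtain f where "\<forall>n. f n \<in> Cc_sub H" "(\<lambda>n. \<iota> (f n)) \<longlonglongrightarrow> a"
      unfolding reduced_subalgebra_def CH by blast
    then show "a \<in> subalg H"
      unfolding subalg_def closure_sequential by (intro exI[of _ "\<lambda>n. \<iota> (f n)"]) auto
  next
    fix a assume "a \<in> subalg H"
    then obtain f where f: "\<And>n. f n \<in> Cc_sub H" and lim: "(\<lambda>n. \<iota> (f n)) \<longlonglongrightarrow> a"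
      unfolding subalg_def by (rule closure_image_sequential) blast
    have le: "reduced_norm (restrict_twist \<Sigma> H) (\<lambda>\<sigma>. f m \<sigma> - f n \<sigma>) \<le> norm (\<iota> (f m) - \<iota> (f n))" for m n
    proof -
      note d = Cc_sub_diff[OF f f, of m n]
      show ?thesis
        using reduced_norm_restrict_le[OF H d] iota_norm[OF Cc_sub_Cc[OF d]]
          iota_diff[OF Cc_sub_Cc[OF f] Cc_sub_Cc[OF f], of m n] by simp
    qed
    have "\<exists>N. \<forall>m\<ge>N. \<forall>n\<ge>N. reduced_norm (restrict_twist \<Sigma> H) (\<lambda>\<sigma>. f m \<sigma> - f n \<sigma>) < \<epsilon>" if e: "\<epsilon> > 0" for \<epsilon>
    proof -
      obtain N where "\<forall>m\<ge>N. \<forall>n\<ge>N. norm (\<iota> (f m) - \<iota> (f n)) < \<epsilon>"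
        using LIMSEQ_imp_Cauchy[OF lim] e unfolding Cauchy_def dist_norm by blast
      then show ?thesis using le le_less_trans by blast
    qed
    with f lim show "a \<in> reduced_subalgebra \<Sigma> \<iota> H"
      unfolding reduced_subalgebra_def CH by blast
  qed
qed

lemma cstar_subalgebra_subalg:
  assumes H: "G.open_subgroupoid H"
  shows "cstar_subalgebra (subalg H)"
  unfolding subalg_def
proof (rule cstar_subalgebra_closure)
  have "(\<lambda>_. 0) \<in> Cc_sub H" by (rule Cc_subI[OF Cc_zero, of "{}"]) auto
  then show "0 \<in> \<iota> ` Cc_sub H" using iota_zero by (metis imageI)
next
  fix a b assume "a \<in> \<iota> ` Cc_sub H" "b \<in> \<iota> ` Cc_sub H"
  then obtain f g where fg: "f \<in> Cc_sub H" "g \<in> Cc_sub H" "a = \<iota> f" "b = \<iota> g" by blast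
  show "a + b \<in> \<iota> ` Cc_sub H"
    using Cc_sub_add[OF fg(1,2)] iota_add[OF fg(1,2)[THEN Cc_sub_Cc]] fg(3,4) by (metis imageI)
  obtain K where K: "f \<in> Cc_on K" "compactin (gtop \<G>) K" "K \<subseteq> H" by (rule Cc_subE[OF fg(1)])
  obtain L where L: "g \<in> Cc_on L" "compactin (gtop \<G>) L" "L \<subseteq> H" by (rule Cc_subE[OF fg(2)])
  have "G.products K L \<subseteq> H"
    using H K(3) L(3) unfolding G.products_def G.open_subgroupoid_def by blast
  then have "convolution \<Sigma> f g \<in> Cc_sub H"
    using Cc_subI[OF convolution_Cc[OF K(1,2) L(1,2)] G.compactin_products[OF K(2) L(2)]] by blast
  then show "a * b \<in> \<iota> ` Cc_sub H"
    using iota_mult[OF fg(1,2)[THEN Cc_sub_Cc]] fg(3,4) by (metis imageI)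
next
  fix c a assume "a \<in> \<iota> ` Cc_sub H"
  then obtain f where f: "f \<in> Cc_sub H" "a = \<iota> f" by blast
  show "scaleC c a \<in> \<iota> ` Cc_sub H"
    unfolding f(2) iota_scale[OF Cc_sub_Cc[OF f(1)], symmetric]
    by (rule imageI) (rule Cc_sub_scale[OF f(1)])
next
  fix a assume "a \<in> \<iota> ` Cc_sub H"
  then obtain f where f: "f \<in> Cc_sub H" "a = \<iota> f" by blast
  obtain K where K: "f \<in> Cc_on K" "compactin (gtop \<G>) K" "K \<subseteq> H" by (rule Cc_subE[OF f(1)])
  have "G.inverses K \<subseteq> H" using H K(3) by (auto simp: G.inverses_def G.open_subgroupoid_def)
  then have "involution \<Sigma> f \<in> Cc_sub H"
    using Cc_subI[OF involution_Cc_on[OF K(1,2)] G.compactin_inverses[OF K(2)]] by blast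
  then show "star a \<in> \<iota> ` Cc_sub H"
    using iota_star[OF Cc_sub_Cc[OF f(1)]] f(2) by (metis imageI)
qed

lemma D_subset_subalg:
  assumes H: "G.open_subgroupoid H"
  shows "D \<subseteq> subalg H"
proof -
  have "unit_supported \<subseteq> Cc_sub H"
  proof
    fix f assume "f \<in> unit_supported"
    then have f: "f \<in> Cc_on (units \<G>)" by (simp add: unit_supported_def)
    obtain K where "compactin (gtop \<G>) K" "K \<subseteq> units \<G>" "f \<in> Cc_on K"
      by (rule Cc_on_compact[OF f G.closedin_units])
    then show "f \<in> Cc_sub H" using H by (intro Cc_subI[of f K]) (auto simp: G.open_subgroupoid_def)
  qed
  then show ?thesis unfolding C0_units_eq subalg_def by (intro closure_mono image_mono)
qed

text \<open>For f on L and d on the units the product lives on L L^-1, which consists of units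
  because two arrows of a bisection with the same source are equal. Closedness of D reduces the
  claim to compactly supported d.\<close>

lemma bisection_conjugates_D:
  assumes f: "f \<in> Cc_on L" "compactin (gtop \<G>) L" and L: "G.bisection L" and d: "d \<in> D"
  shows "\<iota> f * d * star (\<iota> f) \<in> D"
proof -
  have Larr: "L \<subseteq> arrows \<G>" using f(2) by (rule compactin_subset_topspace)
  obtain h where h: "\<And>n. h n \<in> unit_supported" "(\<lambda>n. \<iota> (h n)) \<longlonglongrightarrow> d" by (rule D_approximation[OF d]) blast
  note f' = Cc_on_Cc[OF f(1)]
  have "\<iota> f * \<iota> (h n) * star (\<iota> f) \<in> D" for n
  proof -
    have hn: "h n \<in> Cc_on (units \<G>)" using h(1) by (simp add: unit_supported_def)
    obtain K where K: "compactin (gtop \<G>) K" "K \<subseteq> units \<G>" "h n \<in> Cc_on K"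
      by (rule Cc_on_compact[OF hn G.closedin_units])
    have "gmult \<G> g k = g" if "g \<in> L" "k \<in> K" "gdom \<G> g = gran \<G> k" for g k
    proof -
      have "g \<in> arrows \<G>" "k \<in> units \<G>" using that Larr K(2) by auto
      then show ?thesis using that(3) G.dom_ran(7)[of g] by simp
    qed
    then have "G.products L K \<subseteq> L" by (auto simp: G.products_def)
    then have c: "convolution \<Sigma> f (h n) \<in> Cc_on L"
      using convolution_Cc[OF f K(3,1)] Cc_on_mono by blast
    have "gmult \<G> g (ginv \<G> k) \<in> units \<G>"
      if "g \<in> L" "k \<in> L" "gdom \<G> g = gran \<G> (ginv \<G> k)" for g k
    proof -
      have k: "g \<in> arrows \<G>" "k \<in> arrows \<G>" using that Larr by auto
      then have "g = k" using G.bisection_domD[OF L that(1,2)] that(3) by simp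
      then show ?thesis using k by simp
    qed
    then have "G.products L (G.inverses L) \<subseteq> units \<G>"
      by (auto simp: G.products_def G.inverses_def)
    then have "convolution \<Sigma> (convolution \<Sigma> f (h n)) (involution \<Sigma> f) \<in> unit_supported"
      unfolding unit_supported_def
      using convolution_Cc[OF c f(2) involution_Cc_on[OF f] G.compactin_inverses[OF f(2)]] Cc_on_mono by blast
    from iota_unit_supported[OF this] show ?thesis
      using f' Cc_on_Cc[OF K(3)] by (simp add: iota_mult iota_star convolution_in_Cc involution_in_Cc)
  qed
  moreover have "(\<lambda>n. \<iota> f * \<iota> (h n) * star (\<iota> f)) \<longlonglongrightarrow> \<iota> f * d * star (\<iota> f)"
    by (intro tendsto_intros h)
  ultimately show ?thesis by (rule closed_sequentially[OF closed_D])
qed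

lemma bisection_normalizer:
  assumes f: "f \<in> Cc_on L" "compactin (gtop \<G>) L" and L: "G.bisection L" and B: "\<iota> f \<in> B"
  shows "\<iota> f \<in> normalizers B D"
proof -
  have L': "G.bisection (G.inverses L)"
    using f(2) by (intro G.bisection_inverses[OF L] compactin_subset_topspace)
  have "star (\<iota> f) * d * \<iota> f \<in> D" if "d \<in> D" for d
    using bisection_conjugates_D[OF involution_Cc_on[OF f] G.compactin_inverses[OF f(2)] L' that]
      iota_star[OF Cc_on_Cc[OF f(1)]] by (simp add: star_star)
  then show ?thesis using bisection_conjugates_D[OF f L] B by (auto simp: normalizers_def)
qed

text \<open>Cutting along finitely many sectioned subsets of H leaves functions on bisections; these
  are normalizers and still belong to the algebra of H.\<close>

lemma subalg_generated:
  assumes H: "G.open_subgroupoid H"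
  shows "subalg H \<subseteq> cstar_subalgebra hull (normalizers (subalg H) D)"
proof -
  let ?N = "cstar_subalgebra hull (normalizers (subalg H) D)"
  note N = cstar_subalgebraD[OF cstar_subalgebra_hull[of "normalizers (subalg H) D"]]
  have Hopen: "openin (gtop \<G>) H" using H by (simp add: G.open_subgroupoid_def)
  have "\<iota> f \<in> ?N" if f: "f \<in> Cc_sub H" for f
  proof -
    obtain K where K: "f \<in> Cc_on K" "compactin (gtop \<G>) K" "K \<subseteq> H" by (rule Cc_subE[OF f])
    obtain \<U> where \<U>: "finite \<U>" "\<And>U. U \<in> \<U> \<Longrightarrow> sectioned U \<and> U \<subseteq> H" "K \<subseteq> \<Union>\<U>"
      using sectioned_cover[OF K(2) Hopen K(3)] by metis
    show ?thesis
    proof (rule Cc_induct[OF K(1,2) \<U>(1,3)])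
      fix f U assume fU: "U \<in> \<U>" "f \<in> Cc_on (K \<inter> U)"
      have U: "sectioned U" "U \<subseteq> H" using \<U>(2)[OF fU(1)] by auto
      have fU': "f \<in> Cc_on U" using Cc_on_mono[OF fU(2)] by blast
      have "\<iota> f \<in> subalg H"
        by (rule iota_subalg[OF Cc_subI[OF fU' sectionedD(2)[OF U(1)] U(2)]])
      then have "\<iota> f \<in> normalizers (subalg H) D"
        using bisection_normalizer[OF fU' sectionedD(2,4)[OF U(1)]] by blast
      then show "\<iota> f \<in> ?N" by (rule hull_inc)
    next
      fix f g assume "f \<in> Cc_on K" "g \<in> Cc_on K" "\<iota> f \<in> ?N" "\<iota> g \<in> ?N"
      then show "\<iota> (\<lambda>\<sigma>. f \<sigma> + g \<sigma>) \<in> ?N" by (simp add: iota_add Cc_on_Cc N(3))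
    qed (use \<U>(2) sectionedD N(1) in auto)
  qed
  then show ?thesis unfolding subalg_def using N(2) by (intro closure_minimal) (auto simp: subalg_def)
qed

text \<open>A function of modulus 1 over g has distance at least 1 from every function that vanishes
  over g, since values are dominated by the norm. An approximant in \<open>Cc_sub H'\<close> is
  therefore nonzero over g, which puts g into H'.\<close>

lemma subalg_subset_imp_subset:
  assumes H: "G.open_subgroupoid H" and sub: "subalg H \<subseteq> subalg H'"
  shows "H \<subseteq> H'"
proof
  fix g assume g: "g \<in> H"
  have Hopen: "openin (gtop \<G>) H" using H by (simp add: G.open_subgroupoid_def)
  obtain U where U: "sectioned U" "g \<in> U" "U \<subseteq> H" by (rule sectioned_basis[OF Hopen g])
  obtain u where u: "u \<in> Cc_on U" "\<And>\<sigma>. \<sigma> \<in> preimage \<Sigma> U \<Longrightarrow> cmod (u \<sigma>) = 1" by (rule bump[OF U(1)]) blast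
  note U' = sectionedD[OF U(1)]
  have "\<iota> u \<in> closure (\<iota> ` Cc_sub H')"
    using sub iota_subalg[OF Cc_subI[OF u(1) U'(2) U(3)]] unfolding subalg_def by blast
  then obtain y where "y \<in> \<iota> ` Cc_sub H'" "dist y (\<iota> u) < 1"
    unfolding closure_approachable using zero_less_one by blast
  then obtain f where f: "f \<in> Cc_sub H'" "norm (\<iota> u - \<iota> f) < 1"
    by (auto simp: dist_norm norm_minus_commute)
  have l: "lift \<Sigma> g \<in> arrows \<E>" "p (lift \<Sigma> g) = g" using U U'(5) by auto
  then have "cmod (u (lift \<Sigma> g)) = 1" using u(2) U(2) by simp
  moreover have "cmod (u (lift \<Sigma> g) - f (lift \<Sigma> g)) < 1"
    using cmod_diff_le[OF Cc_on_Cc[OF u(1)] Cc_sub_Cc[OF f(1)]] f(2) le_less_trans by blast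
  ultimately have "f (lift \<Sigma> g) \<noteq> 0" by auto
  moreover obtain K where K: "f \<in> Cc_on K" "compactin (gtop \<G>) K" "K \<subseteq> H'" by (rule Cc_subE[OF f(1)])
  ultimately show "g \<in> H'" using Cc_on_support[OF K(1), of "lift \<Sigma> g"] l by auto
qed

end

context ample_twist begin

lemma convolution_bisection:
  assumes f: "f \<in> Cc \<Sigma>" and g: "g \<in> Cc \<Sigma>" and b: "G.bisection (supp g)"
    and s: "\<sigma> \<in> arrows \<E>" and t: "\<tau> \<in> arrows \<E>" "src \<sigma> = src \<tau>" "g \<tau> \<noteq> 0"
  shows "convolution \<Sigma> f g \<sigma> = f (\<sigma> \<cdot> inv\<^sub>E \<tau>) * g \<tau>"
proof (rule convolution_single[OF f g s t(1,2)])
  fix \<gamma> assume c: "\<gamma> \<in> arrows \<G>" "gdom \<G> \<gamma> = src \<sigma>" "\<gamma> \<noteq> p \<tau>"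
  have "p \<tau> \<in> supp g" using t by (auto simp: supp_def)
  then have "\<gamma> \<notin> supp g" using G.bisection_domD[OF b, of \<gamma> "p \<tau>"] c t by auto
  then have "g (lift \<Sigma> \<gamma>) = 0" using Cc_on_support[OF Cc_on_supp[OF g], of "lift \<Sigma> \<gamma>"] c by simp
  then show "f (\<sigma> \<cdot> inv\<^sub>E (lift \<Sigma> \<gamma>)) * g (lift \<Sigma> \<gamma>) = 0" by simp
qed

end

section \<open>Supports of normalizers\<close>

locale cartan_twist = reduced_ample_twist \<Sigma> \<iota>
  for \<Sigma> :: "('e, 'g) twist_data" and \<iota> :: "('e \<Rightarrow> complex) \<Rightarrow> 'a::cstar_algebra" +
  assumes cartan: "cartan_pair (UNIV :: 'a set) (C0_units \<Sigma> \<iota>)"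
    and principal: "topologically_principal (base \<Sigma>)"
begin

lemma D_algebra: "cstar_subalgebra D"
  and D_commute: "\<lbrakk>a \<in> D; b \<in> D\<rbrakk> \<Longrightarrow> a * b = b * a"
  using cartan by (simp_all add: cartan_pair_def)

lemma D_mult: "\<lbrakk>a \<in> D; b \<in> D\<rbrakk> \<Longrightarrow> a * b \<in> D" and D_star: "a \<in> D \<Longrightarrow> star a \<in> D"
  using cstar_subalgebraD[OF D_algebra] by blast+

lemma normalizer_star: "n \<in> normalizers UNIV D \<Longrightarrow> star n \<in> normalizers UNIV D"
  by (simp add: normalizers_def star_star)

text \<open>D may have no unit, so \<open>n * star n\<close> is reached as the limit of
  \<open>n * (u * star n)\<close> along an approximate unit in D.\<close>

lemma normalizer_mult_star:
  assumes n: "n \<in> normalizers UNIV D"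
  shows "n * star n \<in> D"
proof -
  have "contains_approximate_unit D (UNIV :: 'a set)" using cartan by (simp add: cartan_pair_def)
  then obtain \<F> where F: "\<F> \<noteq> bot" "\<forall>\<^sub>F u in \<F>. u \<in> D \<and> cstar_positive u \<and> norm u \<le> 1"
    "\<And>b. ((\<lambda>u. u * b) \<longlongrightarrow> b) \<F>"
    unfolding contains_approximate_unit_def by blast
  have "((\<lambda>u. n * (u * star n)) \<longlongrightarrow> n * star n) \<F>" by (intro tendsto_intros F)
  moreover have "\<forall>\<^sub>F u in \<F>. n * (u * star n) \<in> D"
    using F(2) by eventually_elim (use n in \<open>auto simp: normalizers_def mult.assoc\<close>)
  ultimately show ?thesis by (rule Lim_in_closed_set[OF closed_D _ F(1), rotated])
qed

text \<open>
  If \<open>n\<close> had two arrows with common source and distinct ranges in its support, then compressing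
  \<open>n\<close> by orthogonal elements of \<open>D\<close> around these ranges would give two elements of \<open>D\<close> with
  product zero which are both nonzero at the common source.
\<close>

lemma normalizer_same_range:
  assumes n: "n \<in> normalizers UNIV D"
    and s: "\<sigma> \<in> arrows \<E>" "ev n \<sigma> \<noteq> 0" and t: "\<tau> \<in> arrows \<E>" "ev n \<tau> \<noteq> 0" and st: "src \<sigma> = src \<tau>"
  shows "rng \<sigma> = rng \<tau>"
proof (rule ccontr)
  assume ne: "rng \<sigma> \<noteq> rng \<tau>"
  obtain V W where VW: "openin (gtop \<G>) V" "openin (gtop \<G>) W" "rng \<sigma> \<in> V" "rng \<tau> \<in> W" "V \<inter> W = {}"
    using G.Hausdorff ne s t unfolding Hausdorff_space_def disjnt_def
    by (metis G.arrow(2) proj_arrow)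
  have V': "openin (gtop \<G>) (V \<inter> units \<G>)" "rng \<sigma> \<in> V \<inter> units \<G>"
    and W': "openin (gtop \<G>) (W \<inter> units \<G>)" "rng \<tau> \<in> W \<inter> units \<G>"
    using VW G.openin_units s t by auto
  obtain K where K: "sectioned K" "rng \<sigma> \<in> K" "K \<subseteq> V \<inter> units \<G>" by (rule sectioned_basis[OF V'])
  obtain L where L: "sectioned L" "rng \<tau> \<in> L" "L \<subseteq> W \<inter> units \<G>" by (rule sectioned_basis[OF W'])
  obtain h where h: "h \<in> Cc_on K" "h \<in> unit_supported" "\<And>x z. \<lbrakk>x \<in> K; cmod z = 1\<rbrakk> \<Longrightarrow> h (incl \<Sigma> (x, z)) = z"
    by (rule unit_indicator[OF sectionedD(1,2)[OF K(1)]]) (use K in auto)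
  obtain k where k: "k \<in> Cc_on L" "k \<in> unit_supported" "\<And>x z. \<lbrakk>x \<in> L; cmod z = 1\<rbrakk> \<Longrightarrow> k (incl \<Sigma> (x, z)) = z"
    by (rule unit_indicator[OF sectionedD(1,2)[OF L(1)]]) (use L in auto)
  define d e where "d = \<iota> h" and "e = \<iota> k"
  have D: "d \<in> D" "e \<in> D" using h(2) k(2) by (simp_all add: d_def e_def iota_unit_supported)
  note h' = Cc_on_Cc[OF h(1)] and k' = Cc_on_Cc[OF k(1)]
  have "d * e = 0"
  proof (rule ev_inject)
    fix \<rho> assume r: "\<rho> \<in> arrows \<E>"
    have "ev e \<rho> = 0 \<or> ev d (one (rng \<rho>)) = 0"
    proof (cases "p \<rho> \<in> L")
      case True
      then have "p \<rho> \<in> units \<G>" "p \<rho> \<notin> K" using K(3) L(3) VW(5) by auto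
      then show ?thesis
        using h' Cc_on_support[OF h(1), of "one (rng \<rho>)"] r by (simp add: d_def)
    next
      case False
      then show ?thesis using k' Cc_on_support[OF k(1)] by (simp add: e_def)
    qed
    moreover have "ev 0 \<rho> = 0" using ev_iota[OF Cc_on_Cc[OF Cc_zero], of \<rho>] by simp
    ultimately show "ev (d * e) \<rho> = ev 0 \<rho>" using ev_unit_left[OF D(1) r] by auto
  qed
  define a b where "a = star (d * n) * (d * n)" and "b = star (e * n) * (e * n)"
  have ab: "a = star n * (star d * d) * n" "b = star n * (star e * e) * n"
    by (simp_all add: a_def b_def star_mult mult.assoc)
  have dd: "star d * d \<in> D" "star e * e \<in> D" using D D_mult D_star by blast+
  have abD: "a \<in> D" "b \<in> D" using n dd unfolding ab normalizers_def by blast+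
  \<comment> \<open>The inner factor \<open>n * star n\<close> lies in D and so commutes with
    \<open>star e * e\<close>; this brings d next to e, where the product vanishes.\<close>
  have "a * b = star n * ((star d * d) * ((n * star n) * (star e * e))) * n"
    by (simp add: ab mult.assoc)
  also have "(n * star n) * (star e * e) = (star e * e) * (n * star n)"
    by (rule D_commute[OF normalizer_mult_star[OF n] dd(2)])
  also have "(star d * d) * ((star e * e) * (n * star n)) = star d * (d * (star e * e)) * (n * star n)"
    by (simp add: mult.assoc)
  also have "d * (star e * e) = (d * e) * star e"
    using D_commute[OF D_star[OF D(2)] D(2)] by (simp add: mult.assoc)
  finally have "a * b = 0" using \<open>d * e = 0\<close> by simp
  let ?u = "one (src \<sigma>)"
  have u: "?u \<in> arrows \<E>" "rng ?u = src \<sigma>" using s by auto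
  have "ev (a * b) ?u = ev a ?u * ev b ?u"
    using ev_unit_left[OF abD(1) u(1)] u(2) by simp
  moreover have "ev (a * b) ?u = 0"
    using \<open>a * b = 0\<close> ev_iota[OF Cc_on_Cc[OF Cc_zero], of ?u] by simp
  \<comment> \<open>Multiplication by d from the left multiplies the value at \<sigma> by that of d
    at the range of \<sigma>, which is 1.\<close>
  moreover have "ev (d * n) \<sigma> \<noteq> 0"
    using ev_unit_left[OF D(1) s(1)] s h(3)[OF K(2), of 1] h' by (simp add: d_def)
  then have "Re (ev a ?u) > 0"
    using ev_star_mult_ge[OF s(1), of "d * n"] unfolding a_def by (smt (verit) zero_less_norm_iff zero_less_power)
  moreover have "ev (e * n) \<tau> \<noteq> 0"
    using ev_unit_left[OF D(2) t(1)] t k(3)[OF L(2), of 1] k' by (simp add: e_def)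
  then have "Re (ev b ?u) > 0"
    using ev_star_mult_ge[OF t(1), of "e * n"] unfolding b_def st by (smt (verit) zero_less_norm_iff zero_less_power)
  ultimately show False by auto
qed

text \<open>Two arrows of the support with a common source have the same range, so they differ by
  isotropy. They have disjoint open neighbourhoods in the support, whose source images overlap in an
  open set of units. A unit with trivial isotropy in this overlap yields two equal arrows in
  disjoint sets.\<close>

lemma normalizer_inj_on_dom:
  assumes n: "n \<in> normalizers UNIV D"
  shows "inj_on (gdom \<G>) (supp (ev n))"
proof (rule inj_onI, rule ccontr)
  fix g h assume gh: "g \<in> supp (ev n)" "h \<in> supp (ev n)" "gdom \<G> g = gdom \<G> h" "g \<noteq> h"
  have arr: "g \<in> arrows \<G>" "h \<in> arrows \<G>" using gh supp_arrows by auto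
  obtain V W where VW: "openin (gtop \<G>) V" "openin (gtop \<G>) W" "g \<in> V" "h \<in> W" "V \<inter> W = {}"
    using G.Hausdorff gh(4) arr unfolding Hausdorff_space_def disjnt_def by metis
  have S: "openin (gtop \<G>) (supp (ev n))" by (rule open_support)
  define O1 where "O1 = gdom \<G> ` (V \<inter> supp (ev n)) \<inter> gdom \<G> ` (W \<inter> supp (ev n))"
  have O: "openin (gtop \<G>) O1" "O1 \<subseteq> units \<G>"
    using G.openin_dom_image[OF openin_Int[OF VW(1) S]] G.openin_dom_image[OF openin_Int[OF VW(2) S]]
      supp_arrows[of "ev n"] by (auto simp: O1_def)
  have "openin (subtopology (gtop \<G>) (units \<G>)) O1"
    using O unfolding openin_subtopology by blast
  moreover have "gdom \<G> g \<in> O1"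
    using VW(3,4) gh(1-3) unfolding O1_def by (metis IntI imageI)
  moreover have "gdom \<G> g \<in> subtopology (gtop \<G>) (units \<G>) closure_of
       {x \<in> units \<G>. {g \<in> arrows \<G>. gdom \<G> g = x \<and> gran \<G> g = x} = {x}}"
    using principal arr(1) unfolding topologically_principal_def by simp
  ultimately obtain y where y: "y \<in> O1" "{g \<in> arrows \<G>. gdom \<G> g = y \<and> gran \<G> g = y} = {y}" "y \<in> units \<G>"
    unfolding in_closure_of by blast
  obtain g' h' where g': "g' \<in> V" "g' \<in> supp (ev n)" "y = gdom \<G> g'"
    and h': "h' \<in> W" "h' \<in> supp (ev n)" "y = gdom \<G> h'"
    using y(1) unfolding O1_def by blast
  have arr': "g' \<in> arrows \<G>" "h' \<in> arrows \<G>" using g' h' supp_arrows by auto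
  obtain \<sigma> where s: "\<sigma> \<in> arrows \<E>" "ev n \<sigma> \<noteq> 0" "g' = p \<sigma>" using g'(2) unfolding supp_def by blast
  obtain \<tau> where t: "\<tau> \<in> arrows \<E>" "ev n \<tau> \<noteq> 0" "h' = p \<tau>" using h'(2) unfolding supp_def by blast
  have r: "gran \<G> g' = gran \<G> h'"
    using normalizer_same_range[OF n s(1,2) t(1,2)] s(3) t(3) g'(3) h'(3) by simp
  have c: "gdom \<G> (ginv \<G> h') = gran \<G> g'" "ginv \<G> h' \<in> arrows \<G>" using arr' r by simp_all
  have "gmult \<G> (ginv \<G> h') g' \<in> {g \<in> arrows \<G>. gdom \<G> g = y \<and> gran \<G> g = y}"
    using c arr' g'(3) h'(3) by simp
  then have "gmult \<G> (ginv \<G> h') (ginv \<G> (ginv \<G> g')) \<in> units \<G>" using y arr' by simp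
  moreover have "gdom \<G> (ginv \<G> h') = gdom \<G> (ginv \<G> g')" using arr' r by simp
  ultimately have "ginv \<G> h' = ginv \<G> g'"
    using G.mult_inv_unit_imp_eq[OF c(2) G.arrow(3)[OF arr'(1)]] by simp
  then have "h' = g'" using arr' G.inv_inv by metis
  then show False using VW(5) g' h' by blast
qed

text \<open>Injectivity of the range map is injectivity of the source map for the normalizer
  \<open>star n\<close>.\<close>

lemma normalizer_bisection:
  assumes n: "n \<in> normalizers UNIV D"
  shows "G.bisection (supp (ev n))"
  unfolding G.bisection_def
proof
  show "inj_on (gdom \<G>) (supp (ev n))" by (rule normalizer_inj_on_dom[OF n])
  have inv: "ginv \<G> g \<in> supp (ev (star n))" if g: "g \<in> supp (ev n)" for g
  proof -
    obtain \<sigma> where s: "\<sigma> \<in> arrows \<E>" "ev n \<sigma> \<noteq> 0" "g = p \<sigma>" using g unfolding supp_def by blast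
    then have "ev (star n) (inv\<^sub>E \<sigma>) \<noteq> 0" by (simp add: ev_star)
    then show ?thesis unfolding supp_def s(3) using s(1) by (intro image_eqI[of _ _ "inv\<^sub>E \<sigma>"]) auto
  qed
  show "inj_on (gran \<G>) (supp (ev n))"
  proof (rule inj_onI)
    fix g h assume gh: "g \<in> supp (ev n)" "h \<in> supp (ev n)" "gran \<G> g = gran \<G> h"
    have arr: "g \<in> arrows \<G>" "h \<in> arrows \<G>" using gh supp_arrows by auto
    have "ginv \<G> g = ginv \<G> h"
      by (rule inj_onD[OF normalizer_inj_on_dom[OF normalizer_star[OF n]] _ inv[OF gh(1)] inv[OF gh(2)]])
        (use arr gh in simp)
    then show "g = h" using arr G.inv_inv by metis
  qed
qed

section \<open>Cutting and approximating normalizers\<close>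

lemma ev_cut:
  assumes W: "openin (gtop \<G>) W" "compactin (gtop \<G>) W"
  shows "(\<lambda>\<sigma>. if \<sigma> \<in> preimage \<Sigma> W then ev a \<sigma> else 0) \<in> Cc_on W"
  by (rule Cc_restrictI[OF W continuous_map_from_subtopology[OF ev_continuous]]) (rule ev_act)

text \<open>Here \<open>h\<close> is the characteristic function of the source image of U. Because
  the support of n is a bisection, restricting sources to this set is the same as restricting arrows
  to U. Written as a product, the cut stays in every algebra that contains n and D.\<close>

lemma normalizer_restrict:
  assumes n: "n \<in> normalizers UNIV D" and U: "sectioned U" "U \<subseteq> supp (ev n)"
  obtains h where "h \<in> unit_supported" "\<iota> (\<lambda>\<sigma>. if \<sigma> \<in> preimage \<Sigma> U then ev n \<sigma> else 0) = n * \<iota> h"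
proof -
  note U' = sectionedD[OF U(1)]
  let ?f = "\<lambda>\<sigma>. if \<sigma> \<in> preimage \<Sigma> U then ev n \<sigma> else 0"
  obtain h where h: "h \<in> Cc_on (gdom \<G> ` U)" "h \<in> unit_supported"
    "\<And>x z. \<lbrakk>x \<in> gdom \<G> ` U; cmod z = 1\<rbrakk> \<Longrightarrow> h (incl \<Sigma> (x, z)) = z"
    by (rule unit_indicator[OF G.clopen_dom_image(1,3)[OF U'(6)]]) (use U'(5) in auto)
  have "\<iota> ?f = n * \<iota> h"
  proof (rule ev_inject)
    fix \<sigma> assume s: "\<sigma> \<in> arrows \<E>"
    have r: "ev (n * \<iota> h) \<sigma> = ev n \<sigma> * h (one (src \<sigma>))"
      using ev_unit_right[OF iota_unit_supported[OF h(2)] s] unit_supported_Cc[OF h(2)] by simp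
    have l: "ev (\<iota> ?f) \<sigma> = ?f \<sigma>" using ev_cut[OF U'(1,2)] Cc_on_Cc by (intro ev_iota) blast
    show "ev (\<iota> ?f) \<sigma> = ev (n * \<iota> h) \<sigma>"
    proof (cases "p \<sigma> \<in> U")
      case True
      then show ?thesis unfolding l r using s h(3)[of "src \<sigma>" 1] by simp
    next
      case False
      have "ev n \<sigma> = 0 \<or> src \<sigma> \<notin> gdom \<G> ` U"
      proof (rule ccontr)
        assume "\<not> ?thesis"
        then obtain g where g: "ev n \<sigma> \<noteq> 0" "g \<in> U" "src \<sigma> = gdom \<G> g" by auto
        then have "p \<sigma> \<in> supp (ev n)" using s by (auto simp: supp_def)
        then have "p \<sigma> = g" using G.bisection_domD[OF normalizer_bisection[OF n]] g U(2) by blast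
        then show False using g False by simp
      qed
      then show ?thesis
        unfolding l r using False s Cc_on_support[OF h(1), of "one (src \<sigma>)"] by auto
    qed
  qed
  with h(2) show ?thesis by (rule that)
qed

text \<open>A compact open W inside the support catches all large values of n. What the cut to W
  leaves over has small values and lives on a bisection, so it is small in norm.\<close>

lemma normalizer_in_subalg:
  assumes n: "n \<in> normalizers UNIV D" and H: "supp (ev n) \<subseteq> H"
  shows "n \<in> subalg H"
  unfolding subalg_def closure_approachable
proof (intro allI impI)
  fix e :: real assume "e > 0"
  \<comment> \<open>The cut will satisfy the non-strict bound 2 \<epsilon>, which has to be less
    than e.\<close>
  define \<epsilon> where "\<epsilon> = e / 3"
  have e: "\<epsilon> > 0" "2 * \<epsilon> < e" using \<open>e > 0\<close> by (auto simp: \<epsilon>_def)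
  let ?S = "supp (ev n)"
  have S: "openin (gtop \<G>) ?S" by (rule open_support)
  have "n \<in> closure (\<iota> ` Cc \<Sigma>)" using iota_dense by simp
  then obtain f0 where f0: "f0 \<in> Cc \<Sigma>" "norm (\<iota> f0 - n) < \<epsilon>"
    using e(1) unfolding closure_approachable dist_norm by blast
  obtain K where K: "compactin (gtop \<G>) K" "f0 \<in> Cc_on K" using Cc_compact[OF f0(1)] .
  \<comment> \<open>Outside K the values of n are below \<epsilon>, because f0 vanishes there. So
    all points where n has modulus at least 2 \<epsilon> lie over K and form a compact set.\<close>
  let ?Q = "{\<sigma> \<in> arrows \<E>. ev n \<sigma> \<in> - ball 0 (2 * \<epsilon>)} \<inter> preimage \<Sigma> K"
  have "closedin (gtop \<E>) {\<sigma> \<in> arrows \<E>. ev n \<sigma> \<in> - ball 0 (2 * \<epsilon>)}"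
    by (rule closedin_continuous_map_preimage[OF ev_continuous]) auto
  then have "compactin (gtop \<E>) ?Q" using compactin_preimage[OF K(1)] by (rule closed_Int_compactin)
  then have Q: "compactin (gtop \<G>) (p ` ?Q)" by (rule image_compactin[OF _ proj_continuous])
  have QS: "p ` ?Q \<subseteq> ?S" using e by (auto simp: supp_def)
  obtain \<U> where \<U>: "finite \<U>" "\<And>U. U \<in> \<U> \<Longrightarrow> sectioned U \<and> U \<subseteq> ?S" "p ` ?Q \<subseteq> \<Union>\<U>"
    by (rule sectioned_cover[OF Q S QS]) blast
  define W where "W = \<Union>\<U>"
  have W: "openin (gtop \<G>) W" "compactin (gtop \<G>) W" "W \<subseteq> ?S"
    unfolding W_def using \<U>(1,2) sectionedD by (auto intro!: compactin_Union)
  let ?f = "\<lambda>\<sigma>. if \<sigma> \<in> preimage \<Sigma> W then ev n \<sigma> else 0"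
  have f: "?f \<in> Cc_on W" by (rule ev_cut[OF W(1,2)])
  have ev: "ev (n - \<iota> ?f) \<sigma> = ev n \<sigma> - ?f \<sigma>" for \<sigma>
    using ev_iota[OF Cc_on_Cc[OF f]] by (simp add: ev_diff)
  have "norm (n - \<iota> ?f) \<le> 2 * \<epsilon>"
  proof (rule norm_le_of_bisection)
    fix \<sigma>
    show "cmod (ev (n - \<iota> ?f) \<sigma>) \<le> 2 * \<epsilon>"
    proof (cases "\<sigma> \<in> arrows \<E> \<and> p \<sigma> \<notin> W")
      case True
      have "cmod (ev n \<sigma>) \<le> 2 * \<epsilon>"
      proof (rule ccontr)
        assume gt: "\<not> ?thesis"
        then have "p \<sigma> \<notin> K" using True \<U>(3) unfolding W_def by fastforce
        then have "cmod (ev n \<sigma>) \<le> norm (\<iota> f0 - n)"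
          using Cc_on_support[OF K(2)] ev_dist[OF f0(1), of \<sigma> n] by simp
        then show False using f0(2) e gt by linarith
      qed
      then show ?thesis unfolding ev using True by simp
    next
      case False
      then show ?thesis unfolding ev using e ev_outside by auto
    qed
    show "G.bisection (supp (ev (n - \<iota> ?f)))"
    proof (rule G.bisection_subset[OF normalizer_bisection[OF n]])
      show "supp (ev (n - \<iota> ?f)) \<subseteq> ?S"
        unfolding supp_def ev by (intro image_mono) auto
    qed
  qed
  moreover have "?f \<in> Cc_sub H" by (rule Cc_subI[OF f W(2)]) (use W H in auto)
  ultimately show "\<exists>y\<in>\<iota> ` Cc_sub H. dist y n < e"
    using e(2) by (intro bexI[of _ "\<iota> ?f"]) (auto simp: dist_norm norm_minus_commute)
qed

subsection \<open>The subgroupoid of an intermediate subalgebra\<close>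

text \<open>Supports on bisections are demanded so that the convolution of two such functions has a
  single term and cannot cancel; this makes the set closed under products.\<close>

definition subgrpd :: "'a set \<Rightarrow> 'g set" where
  "subgrpd B = (\<Union>f\<in>{f \<in> Cc \<Sigma>. \<iota> f \<in> B \<and> G.bisection (supp f)}. supp f)"

lemma subgrpdI: "\<lbrakk>f \<in> Cc \<Sigma>; \<iota> f \<in> B; G.bisection (supp f); g \<in> supp f\<rbrakk> \<Longrightarrow> g \<in> subgrpd B"
  unfolding subgrpd_def by blast

lemma subgrpdE:
  assumes "g \<in> subgrpd B"
  obtains f where "f \<in> Cc \<Sigma>" "\<iota> f \<in> B" "G.bisection (supp f)" "g \<in> supp f"
  using assms unfolding subgrpd_def by blast

lemma open_supp: "f \<in> Cc \<Sigma> \<Longrightarrow> openin (gtop \<G>) (supp f)"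
  using open_support[of "\<iota> f"] by (simp add: supp_def)

lemma open_subgroupoid_subgrpd:
  assumes B: "cstar_subalgebra B" "D \<subseteq> B"
  shows "G.open_subgroupoid (subgrpd B)"
  unfolding G.open_subgroupoid_def
proof (intro conjI ballI impI subsetI)
  show "openin (gtop \<G>) (subgrpd B)" unfolding subgrpd_def using open_supp by blast
next
  fix x assume x: "x \<in> units \<G>"
  obtain U where U: "sectioned U" "x \<in> U" "U \<subseteq> units \<G>" by (rule sectioned_basis[OF G.openin_units x])
  obtain u where u: "u \<in> Cc_on U" "\<And>\<sigma>. \<sigma> \<in> preimage \<Sigma> U \<Longrightarrow> cmod (u \<sigma>) = 1" by (rule bump[OF U(1)]) blast
  have "u \<in> unit_supported" using Cc_on_mono[OF u(1) U(3)] by (simp add: unit_supported_def)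
  then have "\<iota> u \<in> B" using iota_unit_supported B(2) by blast
  moreover have "x \<in> supp u"
    unfolding supp_def using u(2)[of "one x"] x U(2) by (intro image_eqI[of _ _ "one x"]) auto
  ultimately show "x \<in> subgrpd B"
    using subgrpdI[OF Cc_on_Cc[OF u(1)]] G.bisection_subset[OF sectionedD(4)[OF U(1)] supp_subset[OF u(1)]] by blast
next
  fix g assume "g \<in> subgrpd B"
  then obtain f where f: "f \<in> Cc \<Sigma>" "\<iota> f \<in> B" "G.bisection (supp f)" "g \<in> supp f" by (rule subgrpdE)
  then obtain \<sigma> where s: "\<sigma> \<in> arrows \<E>" "f \<sigma> \<noteq> 0" "g = p \<sigma>" unfolding supp_def by blast
  have sub: "supp (involution \<Sigma> f) \<subseteq> G.inverses (supp f)"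
  proof
    fix h assume "h \<in> supp (involution \<Sigma> f)"
    then obtain \<tau> where t: "\<tau> \<in> arrows \<E>" "f (inv\<^sub>E \<tau>) \<noteq> 0" "h = p \<tau>"
      unfolding supp_def by (auto simp: involution_def)
    then have "ginv \<G> (p \<tau>) \<in> supp f" unfolding supp_def by (intro image_eqI[of _ _ "inv\<^sub>E \<tau>"]) auto
    moreover have "ginv \<G> (ginv \<G> (p \<tau>)) = h" using t by simp
    ultimately show "h \<in> G.inverses (supp f)" unfolding G.inverses_def by blast
  qed
  show "ginv \<G> g \<in> subgrpd B"
  proof (rule subgrpdI)
    show "involution \<Sigma> f \<in> Cc \<Sigma>" by (rule involution_in_Cc[OF f(1)])
    show "\<iota> (involution \<Sigma> f) \<in> B" using iota_star[OF f(1)] cstar_subalgebraD(6)[OF B(1)] f(2) by simp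
    show "G.bisection (supp (involution \<Sigma> f))"
      by (rule G.bisection_subset[OF G.bisection_inverses[OF f(3) supp_arrows] sub])
    show "ginv \<G> g \<in> supp (involution \<Sigma> f)"
      unfolding supp_def s(3) using s(1,2) by (intro image_eqI[of _ _ "inv\<^sub>E \<sigma>"]) (auto simp: involution_def)
  qed
next
  fix g h assume gh: "g \<in> subgrpd B" "h \<in> subgrpd B" "gdom \<G> g = gran \<G> h"
  obtain f where f: "f \<in> Cc \<Sigma>" "\<iota> f \<in> B" "G.bisection (supp f)" "g \<in> supp f" by (rule subgrpdE[OF gh(1)])
  obtain k where k: "k \<in> Cc \<Sigma>" "\<iota> k \<in> B" "G.bisection (supp k)" "h \<in> supp k" by (rule subgrpdE[OF gh(2)])
  obtain \<sigma> where s: "\<sigma> \<in> arrows \<E>" "f \<sigma> \<noteq> 0" "g = p \<sigma>" using f(4) unfolding supp_def by blast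
  obtain \<tau> where t: "\<tau> \<in> arrows \<E>" "k \<tau> \<noteq> 0" "h = p \<tau>" using k(4) unfolding supp_def by blast
  have st: "src \<sigma> = rng \<tau>" using gh(3) s t by simp
  have sub: "supp (convolution \<Sigma> f k) \<subseteq> G.products (supp f) (supp k)"
    using convolution_support[OF Cc_on_supp[OF f(1)] Cc_on_supp[OF k(1)]]
    unfolding supp_def[of "convolution \<Sigma> f k"] by auto
  show "gmult \<G> g h \<in> subgrpd B"
  proof (rule subgrpdI)
    show "convolution \<Sigma> f k \<in> Cc \<Sigma>" by (rule convolution_in_Cc[OF f(1) k(1)])
    show "\<iota> (convolution \<Sigma> f k) \<in> B"
      using iota_mult[OF f(1) k(1)] cstar_subalgebraD(4)[OF B(1)] f(2) k(2) by simp
    show "G.bisection (supp (convolution \<Sigma> f k))"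
      by (rule G.bisection_subset[OF G.bisection_products[OF f(3) supp_arrows k(3) supp_arrows] sub])
    have "convolution \<Sigma> f k (\<sigma> \<cdot> \<tau>) = f (\<sigma> \<cdot> \<tau> \<cdot> inv\<^sub>E \<tau>) * k \<tau>"
      by (rule convolution_bisection[OF f(1) k(1,3)]) (use s t st in auto)
    then have "convolution \<Sigma> f k (\<sigma> \<cdot> \<tau>) \<noteq> 0" using s t st by simp
    then show "gmult \<G> g h \<in> supp (convolution \<Sigma> f k)"
      unfolding supp_def using s t st by (intro image_eqI[of _ _ "\<sigma> \<cdot> \<tau>"]) auto
  qed
qed

lemma continuous_map_inverse_cnj:
  assumes "continuous_map X euclidean f" "\<And>x. x \<in> topspace X \<Longrightarrow> f x \<noteq> 0"
  shows "continuous_map X euclidean (\<lambda>x. inverse (cnj (f x)))"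
  using assms by (auto simp: continuous_map_atin intro!: tendsto_inverse tendsto_cnj)

text \<open>
  On \<open>W\<close>, any function is the product of \<open>f\<close> with the function \<open>h\<close> below, which lives on
  the units.
\<close>

lemma Cc_on_subset_algebra:
  assumes B: "cstar_subalgebra B" "D \<subseteq> B"
    and f: "f \<in> Cc \<Sigma>" "\<iota> f \<in> B" "G.bisection (supp f)"
    and W: "openin (gtop \<G>) W" "compactin (gtop \<G>) W" "W \<subseteq> supp f" and k: "k \<in> Cc_on W"
  shows "\<iota> k \<in> B"
proof -
  \<comment> \<open>The conjugate makes the inverse equivariant; the involution of \<open>f1\<close>
    then takes the value \<open>inverse (f \<sigma>)\<close> at the inverse of \<sigma>.\<close>
  define f1 where "f1 \<sigma> = (if \<sigma> \<in> preimage \<Sigma> W then inverse (cnj (f \<sigma>)) else 0)" for \<sigma>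
  have f0: "f \<sigma> \<noteq> 0" if "\<sigma> \<in> preimage \<Sigma> W" for \<sigma>
    using supp_nonzero[OF f(1), of \<sigma>] that W(3) by auto
  have "f1 \<in> Cc_on W"
    unfolding f1_def
  proof (rule Cc_restrictI[OF W(1,2)])
    show "continuous_map (subtopology (gtop \<E>) (preimage \<Sigma> W)) euclidean (\<lambda>\<sigma>. inverse (cnj (f \<sigma>)))"
      by (rule continuous_map_inverse_cnj[OF continuous_map_from_subtopology[OF Cc_D(1)[OF f(1)]]]) (use f0 in auto)
    fix \<sigma> z assume "\<sigma> \<in> arrows \<E>" "cmod z = 1"
    moreover have "inverse (cnj z) = z"
      using cnj_mult_circle(2)[OF \<open>cmod z = 1\<close>] by (metis inverse_unique)
    ultimately show "inverse (cnj (f (z \<star> \<sigma>))) = z * inverse (cnj (f \<sigma>))"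
      using Cc_D(2)[OF f(1)] by simp
  qed
  note f1 = Cc_on_Cc[OF this] this
  note k' = Cc_on_Cc[OF k]
  have Wb: "G.bisection W" by (rule G.bisection_subset[OF f(3) W(3)])
  have Warr: "W \<subseteq> arrows \<G>" using W(3) supp_arrows by blast
  define h where "h = convolution \<Sigma> (involution \<Sigma> f1) k"
  have "gmult \<G> (ginv \<G> a) b \<in> units \<G>" if "a \<in> W" "b \<in> W" "gdom \<G> (ginv \<G> a) = gran \<G> b" for a b
  proof -
    have ab: "a \<in> arrows \<G>" "b \<in> arrows \<G>" using that Warr by auto
    then have "a = b" using G.bisection_ranD[OF Wb that(1,2)] that(3) by simp
    then show ?thesis using ab by simp
  qed
  then have "G.products (G.inverses W) W \<subseteq> units \<G>" by (auto simp: G.products_def G.inverses_def)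
  then have h: "h \<in> unit_supported"
    unfolding unit_supported_def h_def
    using convolution_Cc[OF involution_Cc_on[OF f1(2) W(2)] G.compactin_inverses[OF W(2)] k W(2)] Cc_on_mono by blast
  have "convolution \<Sigma> f h \<sigma> = k \<sigma>" for \<sigma>
  proof (cases "\<sigma> \<in> arrows \<E>")
    case s: True
    let ?u = "one (src \<sigma>)"
    have c: "convolution \<Sigma> f h \<sigma> = f \<sigma> * h ?u" by (rule convolution_unit_right[OF f(1) h s])
    show ?thesis
    proof (cases "p \<sigma> \<in> W")
      case True
      have "h ?u = involution \<Sigma> f1 (?u \<cdot> inv\<^sub>E \<sigma>) * k \<sigma>"
        unfolding h_def
      proof (rule convolution_single[OF involution_in_Cc[OF f1(1)] k'])
        fix \<gamma> assume g: "\<gamma> \<in> arrows \<G>" "gdom \<G> \<gamma> = src ?u" "\<gamma> \<noteq> p \<sigma>"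
        then have "\<gamma> \<notin> W" using G.bisection_domD[OF Wb _ True, of \<gamma>] s by auto
        then show "involution \<Sigma> f1 (?u \<cdot> inv\<^sub>E (lift \<Sigma> \<gamma>)) * k (lift \<Sigma> \<gamma>) = 0"
          using Cc_on_support[OF k, of "lift \<Sigma> \<gamma>"] g by simp
      qed (use s in auto)
      also have "?u \<cdot> inv\<^sub>E \<sigma> = inv\<^sub>E \<sigma>" using E_one(2)[of "inv\<^sub>E \<sigma>"] s by simp
      also have "involution \<Sigma> f1 (inv\<^sub>E \<sigma>) = inverse (f \<sigma>)"
        using s True by (simp add: involution_def f1_def)
      finally show ?thesis unfolding c using f0[of \<sigma>] s True by simp
    next
      case False
      \<comment> \<open>If f is nonzero at \<sigma>, then \<open>p \<sigma>\<close> is the only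
        arrow of its support with this source. It is not in W, so W has no arrow with this source
        and h vanishes there.\<close>
      have "h ?u = 0" if "f \<sigma> \<noteq> 0"
      proof -
        have "h ?u = (\<Sum>\<gamma>\<in>{}. involution \<Sigma> f1 (?u \<cdot> inv\<^sub>E (lift \<Sigma> \<gamma>)) * k (lift \<Sigma> \<gamma>))"
          unfolding h_def
        proof (rule convolution_sum)
          fix \<gamma> assume g: "\<gamma> \<in> arrows \<G>" "gdom \<G> \<gamma> = src ?u"
          have "\<gamma> \<notin> W"
          proof
            assume "\<gamma> \<in> W"
            moreover have "p \<sigma> \<in> supp f" using s that by (auto simp: supp_def)
            ultimately have "\<gamma> = p \<sigma>" using G.bisection_domD[OF f(3), of \<gamma> "p \<sigma>"] W(3) g s by auto
            then show False using False \<open>\<gamma> \<in> W\<close> by simp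
          qed
          then show "involution \<Sigma> f1 (?u \<cdot> inv\<^sub>E (lift \<Sigma> \<gamma>)) * k (lift \<Sigma> \<gamma>) = 0"
            using Cc_on_support[OF k, of "lift \<Sigma> \<gamma>"] g by simp
        qed (use s in auto)
        then show ?thesis by simp
      qed
      then show ?thesis unfolding c using Cc_on_support[OF k False] by auto
    qed
  qed (use Cc_D(3)[OF k'] convolution_outside in auto)
  then have "\<iota> k = \<iota> f * \<iota> h"
    using iota_mult[OF f(1) unit_supported_Cc[OF h]] by (metis ext)
  then show ?thesis
    using cstar_subalgebraD(4)[OF B(1) f(2)] iota_unit_supported[OF h] B(2) by auto
qed

lemma subalg_subgrpd_subset:
  assumes B: "cstar_subalgebra B" "D \<subseteq> B"
  shows "subalg (subgrpd B) \<subseteq> B"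
proof -
  note B' = cstar_subalgebraD[OF B(1)]
  have "\<iota> f \<in> B" if f: "f \<in> Cc_sub (subgrpd B)" for f
  proof -
    obtain K where K: "f \<in> Cc_on K" "compactin (gtop \<G>) K" "K \<subseteq> subgrpd B" by (rule Cc_subE[OF f])
    \<comment> \<open>Membership in B is asked of all functions on U, because the pieces of f are
      unrelated to the functions that put the arrows into \<open>subgrpd B\<close>.\<close>
    let ?\<C> = "{U. sectioned U \<and> (\<forall>k\<in>Cc_on U. \<iota> k \<in> B)}"
    have "K \<subseteq> \<Union>?\<C>"
    proof
      fix g assume "g \<in> K"
      then obtain k where k: "k \<in> Cc \<Sigma>" "\<iota> k \<in> B" "G.bisection (supp k)" "g \<in> supp k"
        using K(3) subgrpdE by blast
      obtain U where U: "sectioned U" "g \<in> U" "U \<subseteq> supp k" by (rule sectioned_basis[OF open_supp[OF k(1)] k(4)])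
      then have "U \<in> ?\<C>" using Cc_on_subset_algebra[OF B k(1-3) sectionedD(1,2)[OF U(1)] U(3)] by blast
      then show "g \<in> \<Union>?\<C>" using U(2) by blast
    qed
    moreover have "openin (gtop \<G>) U" if "U \<in> ?\<C>" for U using that sectionedD(1) by blast
    ultimately obtain \<U> where \<U>: "finite \<U>" "\<U> \<subseteq> ?\<C>" "K \<subseteq> \<Union>\<U>"
      using compactinD[OF K(2), of ?\<C>] by blast
    show ?thesis
    proof (rule Cc_induct[OF K(1,2) \<U>(1,3)])
      fix f U assume "U \<in> \<U>" "f \<in> Cc_on (K \<inter> U)"
      then show "\<iota> f \<in> B" using \<U>(2) Cc_on_mono[of f "K \<inter> U" U] by blast
    next
      fix f g assume "f \<in> Cc_on K" "g \<in> Cc_on K" "\<iota> f \<in> B" "\<iota> g \<in> B"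
      then show "\<iota> (\<lambda>\<sigma>. f \<sigma> + g \<sigma>) \<in> B" by (simp add: iota_add Cc_on_Cc B'(3))
    qed (use \<U>(2) sectionedD B'(1) in auto)
  qed
  then show ?thesis unfolding subalg_def using B'(2) by (intro closure_minimal) auto
qed

lemma subalg_subgrpd:
  assumes B: "cartan_intermediate UNIV D B"
  shows "subalg (subgrpd B) = B"
proof
  have B': "cstar_subalgebra B" "D \<subseteq> B" "cstar_subalgebra hull (normalizers B D) = B"
    using B by (auto simp: cartan_intermediate_def cartan_pair_def)
  show "subalg (subgrpd B) \<subseteq> B" by (rule subalg_subgrpd_subset[OF B'(1,2)])
  have "normalizers B D \<subseteq> subalg (subgrpd B)"
  proof
    fix n assume n: "n \<in> normalizers B D"
    then have nB: "n \<in> B" and nU: "n \<in> normalizers UNIV D" by (auto simp: normalizers_def)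
    have "supp (ev n) \<subseteq> subgrpd B"
    proof
      fix g assume g: "g \<in> supp (ev n)"
      have S: "openin (gtop \<G>) (supp (ev n))" by (rule open_support)
      obtain U where U: "sectioned U" "g \<in> U" "U \<subseteq> supp (ev n)" by (rule sectioned_basis[OF S g])
      note U' = sectionedD[OF U(1)]
      \<comment> \<open>In general n is not the image of a compactly supported function. Its cut to
        U is one, and lies in B as the product of n with an element of D.\<close>
      let ?f = "\<lambda>\<sigma>. if \<sigma> \<in> preimage \<Sigma> U then ev n \<sigma> else 0"
      obtain h where h: "h \<in> unit_supported" "\<iota> ?f = n * \<iota> h" by (rule normalizer_restrict[OF nU U(1,3)])
      have f: "?f \<in> Cc_on U" by (rule ev_cut[OF U'(1,2)])
      show "g \<in> subgrpd B"
      proof (rule subgrpdI[OF Cc_on_Cc[OF f]])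
        show "\<iota> ?f \<in> B"
          unfolding h(2) using cstar_subalgebraD(4)[OF B'(1) nB] iota_unit_supported[OF h(1)] B'(2) by blast
        show "G.bisection (supp ?f)" by (rule G.bisection_subset[OF U'(4) supp_subset[OF f]])
        show "g \<in> supp ?f" using g U(2) unfolding supp_def by auto
      qed
    qed
    then show "n \<in> subalg (subgrpd B)" by (rule normalizer_in_subalg[OF nU])
  qed
  then have "cstar_subalgebra hull (normalizers B D) \<subseteq> subalg (subgrpd B)"
    using cstar_subalgebra_subalg[OF open_subgroupoid_subgrpd[OF B'(1,2)]] by (rule hull_minimal)
  then show "B \<subseteq> subalg (subgrpd B)" unfolding B'(3) .
qed

theorem bij_betw_open_subgroupoids:
  "bij_betw (reduced_subalgebra \<Sigma> \<iota>) {H. G.open_subgroupoid H} {B. cartan_intermediate UNIV D B}"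
proof (rule bij_betwI')
  fix H H' assume "H \<in> {H. G.open_subgroupoid H}" "H' \<in> {H. G.open_subgroupoid H}"
  then have H: "G.open_subgroupoid H" "G.open_subgroupoid H'" by auto
  show "reduced_subalgebra \<Sigma> \<iota> H = reduced_subalgebra \<Sigma> \<iota> H' \<longleftrightarrow> H = H'"
    unfolding reduced_subalgebra_eq[OF H(1)] reduced_subalgebra_eq[OF H(2)]
    using subalg_subset_imp_subset[OF H(1)] subalg_subset_imp_subset[OF H(2)] by blast
next
  fix H assume "H \<in> {H. G.open_subgroupoid H}"
  then have H: "G.open_subgroupoid H" by auto
  show "reduced_subalgebra \<Sigma> \<iota> H \<in> {B. cartan_intermediate UNIV D B}"
    unfolding reduced_subalgebra_eq[OF H]
    using cartan_intermediateI[OF cartan cstar_subalgebra_subalg[OF H] D_subset_subalg[OF H] _ subalg_generated[OF H]]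
    by simp
next
  fix B assume "B \<in> {B. cartan_intermediate UNIV D B}"
  then have B: "cartan_intermediate UNIV D B" by auto
  then have H: "G.open_subgroupoid (subgrpd B)"
    by (intro open_subgroupoid_subgrpd) (auto simp: cartan_intermediate_def)
  then show "\<exists>H\<in>{H. G.open_subgroupoid H}. B = reduced_subalgebra \<Sigma> \<iota> H"
    using subalg_subgrpd[OF B] reduced_subalgebra_eq[OF H] by auto
qed

end

section \<open>Inverse semigroups\<close>

lemma istar:
  "s * istar s * s = s" "istar s * s * istar s = istar s" for s :: "'s::inverse_semigroup_0"
  using theI'[OF ex1_generalized_inverse[of s]] unfolding istar_def by blast+

lemma istar_unique:
  fixes s t :: "'s::inverse_semigroup_0"
  assumes "s * t * s = s" "t * s * t = t"
  shows "istar s = t"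
  using ex1_generalized_inverse[of s] istar[of s] assms by blast

lemma istar_istar [simp]: "istar (istar s) = s" for s :: "'s::inverse_semigroup_0"
  by (rule istar_unique) (rule istar)+

lemma idempotent_iff: "e \<in> idempotents \<longleftrightarrow> e * e = e"
  by (simp add: idempotents_def)

lemma istar_idempotent: "e \<in> idempotents \<Longrightarrow> istar e = e"
  by (rule istar_unique) (simp_all add: idempotent_iff)

lemma istar_mult_idempotent: "istar s * s \<in> idempotents"
  by (simp add: idempotent_iff istar(2) flip: mult.assoc)

lemma mult_istar_idempotent: "s * istar s \<in> idempotents"
  by (simp add: idempotent_iff istar(1) flip: mult.assoc)

text \<open>With x the inverse of e f, also f x e is an inverse of e f, so x = f x e by uniqueness.
  This form makes x idempotent, and an idempotent is its own inverse, so e f = x.\<close>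

lemma idempotent_mult:
  fixes e f :: "'s::inverse_semigroup_0"
  assumes e: "e \<in> idempotents" and f: "f \<in> idempotents"
  shows "e * f \<in> idempotents"
proof -
  have ee: "e * e = e" "e * (e * a) = e * a" and ff: "f * f = f" "f * (f * a) = f * a" for a
    using e f by (simp_all add: idempotent_iff flip: mult.assoc)
  define x where "x = istar (e * f)"
  have x1: "e * (f * (x * (e * f))) = e * f" and x2: "x * (e * (f * x)) = x"
    using istar[of "e * f"] by (simp_all add: x_def mult.assoc)
  have x2': "x * (e * (f * (x * a))) = x * a" for a
    using x2 by (metis mult.assoc)
  have "istar (e * f) = f * x * e"
    by (rule istar_unique) (simp_all add: mult.assoc ee ff x1 x2')
  then have x: "x = f * x * e" by (simp add: x_def)
  have "x * x = (f * x * e) * (f * x * e)" using x by simp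
  also have "\<dots> = f * x * e" by (simp add: mult.assoc x2')
  finally have "x \<in> idempotents" using x by (simp add: idempotent_iff)
  then have "istar x = x" by (rule istar_idempotent)
  then have "e * f = x" unfolding x_def by simp
  with \<open>x \<in> idempotents\<close> show ?thesis by simp
qed

text \<open>The product f e is an inverse of e f; but e f is idempotent, hence its own
  inverse.\<close>

lemma idempotent_commute:
  fixes e f :: "'s::inverse_semigroup_0"
  assumes e: "e \<in> idempotents" and f: "f \<in> idempotents"
  shows "e * f = f * e"
proof -
  have ee: "e * (e * a) = e * a" and ff: "f * (f * a) = f * a" for a
    using e f by (simp_all add: idempotent_iff flip: mult.assoc)
  have ef: "e * (f * (e * f)) = e * f" and fe: "f * (e * (f * e)) = f * e"
    using idempotent_mult[OF e f] idempotent_mult[OF f e] by (simp_all add: idempotent_iff mult.assoc)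
  have "istar (e * f) = f * e"
    by (rule istar_unique) (simp_all add: mult.assoc ee ff ef fe)
  then show ?thesis using istar_idempotent[OF idempotent_mult[OF e f]] by simp
qed

lemma istar_mult: "istar (s * t) = istar t * istar s" for s t :: "'s::inverse_semigroup_0"
proof (rule istar_unique)
  have c: "(t * istar t) * (istar s * s) = (istar s * s) * (t * istar t)"
    by (rule idempotent_commute[OF mult_istar_idempotent istar_mult_idempotent])
  have "s * t * (istar t * istar s) * (s * t) = s * ((t * istar t) * (istar s * s)) * t"
    by (simp add: mult.assoc)
  also have "\<dots> = (s * istar s * s) * (t * istar t * t)" unfolding c by (simp add: mult.assoc)
  finally show "s * t * (istar t * istar s) * (s * t) = s * t" by (simp add: istar)
  have "istar t * istar s * (s * t) * (istar t * istar s) = istar t * ((istar s * s) * (t * istar t)) * istar s"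
    by (simp add: mult.assoc)
  also have "\<dots> = (istar t * t * istar t) * (istar s * s * istar s)"
    unfolding c[symmetric] by (simp add: mult.assoc)
  finally show "istar t * istar s * (s * t) * (istar t * istar s) = istar t * istar s" by (simp add: istar)
qed

text \<open>An idempotent passes through t by conjugation, because \<open>t * istar t\<close>
  commutes with e. This transports witnesses of germ equality along t.\<close>

lemma idempotent_mult_right:
  fixes e t :: "'s::inverse_semigroup_0"
  assumes e: "e \<in> idempotents"
  shows "t * (istar t * e * t) = e * t"
proof -
  have "t * (istar t * e * t) = ((t * istar t) * e) * t" by (simp add: mult.assoc)
  also have "\<dots> = (e * (t * istar t)) * t" by (simp only: idempotent_commute[OF mult_istar_idempotent e])
  also have "\<dots> = e * t" using istar(1)[of t] by (simp add: mult.assoc)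
  finally show ?thesis .
qed

lemma idempotent_conjugate:
  fixes e t :: "'s::inverse_semigroup_0"
  assumes e: "e \<in> idempotents"
  shows "istar t * e * t \<in> idempotents"
proof -
  have "(istar t * e * t) * (istar t * e * t) = istar t * e * (t * (istar t * e * t))" by (simp add: mult.assoc)
  also have "\<dots> = istar t * (e * e) * t" unfolding idempotent_mult_right[OF e] by (simp add: mult.assoc)
  finally show ?thesis using e by (simp add: idempotent_iff)
qed

section \<open>Germs\<close>

locale partial_action =
  fixes X :: "'x topology" and \<alpha> :: "'s::inverse_semigroup_0 \<Rightarrow> 'x \<rightharpoonup> 'x"
  assumes action: "semigroup_action X \<alpha>"
begin

lemma act_mult: "\<alpha> (s * t) x = (case \<alpha> t x of None \<Rightarrow> None | Some y \<Rightarrow> \<alpha> s y)"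
  using action by (simp add: semigroup_action_def map_comp_def)

lemma openin_dom: "openin X (dom (\<alpha> s))"
  using action by (auto simp: semigroup_action_def partial_homeomorphisms_def)

lemma dom_subset: "x \<in> dom (\<alpha> s) \<Longrightarrow> x \<in> topspace X"
  using openin_subset[OF openin_dom] by blast

lemma act_inj:
  assumes "\<alpha> s x = Some z" "\<alpha> s y = Some z"
  shows "x = y"
proof -
  have "homeomorphic_map (subtopology X (dom (\<alpha> s))) (subtopology X (ran (\<alpha> s))) (\<lambda>x. the (\<alpha> s x))"
    using action by (auto simp: semigroup_action_def partial_homeomorphisms_def)
  then have "inj_on (\<lambda>x. the (\<alpha> s x)) (topspace X \<inter> dom (\<alpha> s))"
    using homeomorphic_imp_injective_map by fastforce
  then show ?thesis
  proof (rule inj_onD)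
    show "x \<in> topspace X \<inter> dom (\<alpha> s)" "y \<in> topspace X \<inter> dom (\<alpha> s)"
      using assms dom_subset by blast+
  qed (use assms in simp)
qed

text \<open>An idempotent injective partial map fixes every point of its domain.\<close>

lemma act_idempotent:
  assumes "e \<in> idempotents" "x \<in> dom (\<alpha> e)"
  shows "\<alpha> e x = Some x"
proof -
  obtain y where y: "\<alpha> e x = Some y" using assms(2) by blast
  then have "\<alpha> e y = Some y" using act_mult[of e e x] assms(1) by (simp add: idempotent_iff)
  then show ?thesis using act_inj y by metis
qed

text \<open>As a rewrite rule this removes \<open>istar s * s\<close> from the domain conditions of
  the definitions.\<close>

lemma dom_istar_mult [simp]: "dom (\<alpha> (istar s * s)) = dom (\<alpha> s)"
proof -
  have "\<alpha> (istar s * s) x = None \<longleftrightarrow> \<alpha> s x = None" for x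
    using act_mult[of s "istar s * s" x] istar(1)[of s] act_mult[of "istar s" s x]
    by (auto simp: mult.assoc)
  then show ?thesis by (intro set_eqI) (simp only: domIff)
qed

lemma act_istar:
  assumes "\<alpha> s x = Some y"
  shows "\<alpha> (istar s) y = Some x"
proof -
  have "\<alpha> (istar s * s) x = Some x"
    using assms by (intro act_idempotent istar_mult_idempotent) auto
  then show ?thesis using assms by (simp add: act_mult)
qed

lemma act_mult_idempotent:
  assumes "e \<in> idempotents" "x \<in> dom (\<alpha> e)"
  shows "\<alpha> (s * e) x = \<alpha> s x"
  using act_idempotent[OF assms] by (simp add: act_mult)

lemma dom_mult_idempotent:
  assumes "e \<in> idempotents"
  shows "dom (\<alpha> (s * e)) = dom (\<alpha> s) \<inter> dom (\<alpha> e)"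
proof -
  have "x \<in> dom (\<alpha> (s * e)) \<longleftrightarrow> x \<in> dom (\<alpha> s) \<inter> dom (\<alpha> e)" for x
    using act_mult_idempotent[OF assms, of x s]
    by (cases "\<alpha> e x") (auto simp: act_mult dom_def)
  then show ?thesis by blast
qed

definition germ_equiv :: "'s \<Rightarrow> 's \<Rightarrow> 'x \<Rightarrow> bool" where
  "germ_equiv s t x \<longleftrightarrow> (\<exists>e\<in>idempotents. x \<in> dom (\<alpha> e) \<and> s * e = t * e)"

lemma germ_equivI: "\<lbrakk>e \<in> idempotents; x \<in> dom (\<alpha> e); s * e = t * e\<rbrakk> \<Longrightarrow> germ_equiv s t x"
  unfolding germ_equiv_def by blast

lemma mem_germ: "(t, y) \<in> germ \<alpha> s x \<longleftrightarrow> x = y \<and> x \<in> dom (\<alpha> t) \<and> germ_equiv s t x"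
  by (auto simp: germ_def germ_equiv_def)

lemma germ_equiv_refl: "x \<in> dom (\<alpha> s) \<Longrightarrow> germ_equiv s s x"
  by (rule germ_equivI[OF istar_mult_idempotent[of s]]) auto

lemma germ_equiv_sym: "germ_equiv s t x \<Longrightarrow> germ_equiv t s x"
  unfolding germ_equiv_def by metis

lemma dom_idempotents: "\<lbrakk>e \<in> idempotents; f \<in> idempotents\<rbrakk> \<Longrightarrow> dom (\<alpha> (e * f)) = dom (\<alpha> e) \<inter> dom (\<alpha> f)"
  by (rule dom_mult_idempotent)

lemma germ_equiv_trans:
  assumes "germ_equiv s t x" "germ_equiv t u x"
  shows "germ_equiv s u x"
proof -
  obtain e where e: "e \<in> idempotents" "x \<in> dom (\<alpha> e)" "s * e = t * e" using assms(1) by (auto simp: germ_equiv_def)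
  obtain f where f: "f \<in> idempotents" "x \<in> dom (\<alpha> f)" "t * f = u * f" using assms(2) by (auto simp: germ_equiv_def)
  show ?thesis
  proof (rule germ_equivI[OF idempotent_mult[OF e(1) f(1)]])
    show "x \<in> dom (\<alpha> (e * f))" using e f by (simp add: dom_idempotents)
    have "s * (e * f) = t * (e * f)" using e(3) by (metis mult.assoc)
    also have "\<dots> = t * (f * e)" by (simp only: idempotent_commute[OF e(1) f(1)])
    also have "\<dots> = u * (f * e)" using f(3) by (metis mult.assoc)
    finally show "s * (e * f) = u * (e * f)" by (simp only: idempotent_commute[OF e(1) f(1)])
  qed
qed

lemma germ_eq_iff:
  assumes "x \<in> dom (\<alpha> s)" "y \<in> dom (\<alpha> t)"
  shows "germ \<alpha> s x = germ \<alpha> t y \<longleftrightarrow> x = y \<and> germ_equiv s t x"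
proof
  assume "germ \<alpha> s x = germ \<alpha> t y"
  moreover have "(t, y) \<in> germ \<alpha> t y" using assms(2) by (simp add: mem_germ germ_equiv_refl)
  ultimately have "(t, y) \<in> germ \<alpha> s x" by simp
  then show "x = y \<and> germ_equiv s t x" unfolding mem_germ by blast
next
  assume a: "x = y \<and> germ_equiv s t x"
  then have "germ_equiv s u x \<longleftrightarrow> germ_equiv t u x" for u
    using germ_equiv_trans germ_equiv_sym by blast
  then show "germ \<alpha> s x = germ \<alpha> t y" using a by (auto simp: mem_germ)
qed

lemma act_germ_equiv: "germ_equiv s t x \<Longrightarrow> \<alpha> s x = \<alpha> t x"
  unfolding germ_equiv_def using act_mult_idempotent by metis

lemma germ_rep:
  assumes "x \<in> dom (\<alpha> s)"
  obtains t where "germ_rep (germ \<alpha> s x) = (t, x)" "x \<in> dom (\<alpha> t)" "germ_equiv t s x"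
proof -
  have "(s, x) \<in> germ \<alpha> s x" using assms by (simp add: mem_germ germ_equiv_refl)
  then have "germ_rep (germ \<alpha> s x) \<in> germ \<alpha> s x" unfolding germ_rep_def by (rule someI)
  then show ?thesis
    using that germ_equiv_sym by (cases "germ_rep (germ \<alpha> s x)") (auto simp: mem_germ)
qed

lemma germ_equiv_idempotents:
  assumes e: "e \<in> idempotents" "x \<in> dom (\<alpha> e)" and f: "f \<in> idempotents" "x \<in> dom (\<alpha> f)"
  shows "germ_equiv e f x"
proof (rule germ_equivI[OF idempotent_mult[OF e(1) f(1)]])
  show "x \<in> dom (\<alpha> (e * f))" using e f by (simp add: dom_idempotents)
  have "e * (e * f) = e * f" using e(1) by (simp add: idempotent_iff flip: mult.assoc)
  moreover have "f * (e * f) = f * (f * e)" by (simp only: idempotent_commute[OF e(1) f(1)])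
  moreover have "f * (f * e) = f * e" using f(1) by (simp add: idempotent_iff flip: mult.assoc)
  ultimately show "e * (e * f) = f * (e * f)" by (simp only: idempotent_commute[OF e(1) f(1)])
qed

text \<open>If \<open>s * e = t * e\<close> with e defined at x, the inverses agree after
  \<open>s * e * istar s\<close>, which is e carried from x to y.\<close>

lemma germ_equiv_istar:
  assumes st: "germ_equiv s t x" and y: "\<alpha> s x = Some y"
  shows "germ_equiv (istar s) (istar t) y"
proof -
  obtain e where e: "e \<in> idempotents" "x \<in> dom (\<alpha> e)" "s * e = t * e" using st by (auto simp: germ_equiv_def)
  have ie: "istar e = e" by (rule istar_idempotent[OF e(1)])
  have es: "e * istar s = e * istar t" using arg_cong[OF e(3), of istar] by (simp add: istar_mult ie)
  have c: "istar u * (u * e * istar u) = e * istar u" for u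
    using idempotent_mult_right[OF e(1), of "istar u"] by simp
  have f: "s * e * istar s \<in> idempotents" using idempotent_conjugate[OF e(1), of "istar s"] by simp
  show ?thesis
  proof (rule germ_equivI[OF f])
    show "y \<in> dom (\<alpha> (s * e * istar s))"
      using act_istar[OF y] act_idempotent[OF e(1,2)] y by (auto simp: act_mult)
    have "s * e * istar s = t * e * istar t" using e(3) es by (metis mult.assoc)
    then show "istar s * (s * e * istar s) = istar t * (s * e * istar s)" using c es by metis
  qed
qed

lemma germ_equiv_mult:
  assumes s: "germ_equiv s s' y" and t: "germ_equiv t t' x" and y: "\<alpha> t x = Some y"
  shows "germ_equiv (s * t) (s' * t') x"
proof -
  obtain e where e: "e \<in> idempotents" "y \<in> dom (\<alpha> e)" "s * e = s' * e" using s by (auto simp: germ_equiv_def)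
  obtain f where f: "f \<in> idempotents" "x \<in> dom (\<alpha> f)" "t * f = t' * f" using t by (auto simp: germ_equiv_def)
  \<comment> \<open>The witness e at y is pulled back along t to a witness at x.\<close>
  let ?g = "istar t * e * t"
  have g: "?g \<in> idempotents" by (rule idempotent_conjugate[OF e(1)])
  show ?thesis
  proof (rule germ_equivI[OF idempotent_mult[OF f(1) g]])
    have "x \<in> dom (\<alpha> ?g)" using y e(2) act_idempotent[OF e(1,2)] act_istar[OF y] by (auto simp: act_mult)
    then show "x \<in> dom (\<alpha> (f * ?g))" using f g by (simp add: dom_idempotents)
    have 1: "u * t * (f * ?g) = u * e * (t * f)" for u
    proof -
      have "u * t * (f * ?g) = u * (t * ?g) * f"
        using idempotent_commute[OF f(1) g] by (simp add: mult.assoc)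
      also have "\<dots> = u * e * (t * f)" unfolding idempotent_mult_right[OF e(1)] by (simp add: mult.assoc)
      finally show ?thesis .
    qed
    have "s * t * (f * ?g) = s' * t * (f * ?g)" unfolding 1 e(3) ..
    also have "\<dots> = s' * (t * f) * ?g" by (simp add: mult.assoc)
    also have "\<dots> = s' * t' * (f * ?g)" unfolding f(3) by (simp add: mult.assoc)
    finally show "s * t * (f * ?g) = s' * t' * (f * ?g)" .
  qed
qed

abbreviation "G \<equiv> transformation_groupoid X \<alpha>"

text \<open>The groupoid operations are defined through a representative picked by
  \<open>germ_rep\<close>. Here and for the other operations below any representative is allowed,
  because equivalent ones give equal germs; for source and range, any idempotent defined at the
  point represents the unit.\<close>

lemma gdom_germ:
  assumes "x \<in> dom (\<alpha> s)" "e \<in> idempotents" "x \<in> dom (\<alpha> e)"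
  shows "gdom G (germ \<alpha> s x) = germ \<alpha> e x"
proof -
  obtain t where t: "germ_rep (germ \<alpha> s x) = (t, x)" "x \<in> dom (\<alpha> t)" by (rule germ_rep[OF assms(1)])
  then have "gdom G (germ \<alpha> s x) = germ \<alpha> (istar t * t) x" by (simp add: transformation_groupoid_def)
  also have "\<dots> = germ \<alpha> e x"
    using assms t germ_equiv_idempotents[OF istar_mult_idempotent] by (subst germ_eq_iff) auto
  finally show ?thesis .
qed

lemma dom_mult_istar: "\<alpha> s x = Some y \<Longrightarrow> y \<in> dom (\<alpha> (s * istar s))"
  using act_istar by (auto simp: act_mult)

lemma gran_germ:
  assumes "\<alpha> s x = Some y" "e \<in> idempotents" "y \<in> dom (\<alpha> e)"
  shows "gran G (germ \<alpha> s x) = germ \<alpha> e y"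
proof -
  have "x \<in> dom (\<alpha> s)" using assms by auto
  then obtain t where t: "germ_rep (germ \<alpha> s x) = (t, x)" "x \<in> dom (\<alpha> t)" "germ_equiv t s x" by (rule germ_rep)
  then have ty: "\<alpha> t x = Some y" using act_germ_equiv assms(1) by metis
  then have "gran G (germ \<alpha> s x) = germ \<alpha> (t * istar t) y" using t by (simp add: transformation_groupoid_def)
  also have "\<dots> = germ \<alpha> e y"
    using assms germ_equiv_idempotents[OF mult_istar_idempotent] dom_mult_istar[OF ty] by (subst germ_eq_iff) auto
  finally show ?thesis .
qed

lemma ginv_germ:
  assumes "\<alpha> s x = Some y"
  shows "ginv G (germ \<alpha> s x) = germ \<alpha> (istar s) y"
proof -
  have "x \<in> dom (\<alpha> s)" using assms by auto
  then obtain t where t: "germ_rep (germ \<alpha> s x) = (t, x)" "x \<in> dom (\<alpha> t)" "germ_equiv t s x" by (rule germ_rep)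
  then have ty: "\<alpha> t x = Some y" using act_germ_equiv assms(1) by metis
  then have "ginv G (germ \<alpha> s x) = germ \<alpha> (istar t) y" using t by (simp add: transformation_groupoid_def)
  also have "\<dots> = germ \<alpha> (istar s) y"
    using germ_equiv_istar[OF t(3) ty] act_istar[OF ty] act_istar[OF assms] by (subst germ_eq_iff) auto
  finally show ?thesis .
qed

lemma gmult_germ:
  assumes "\<alpha> t x = Some y" "y \<in> dom (\<alpha> s)"
  shows "gmult G (germ \<alpha> s y) (germ \<alpha> t x) = germ \<alpha> (s * t) x"
proof -
  obtain s' where s': "germ_rep (germ \<alpha> s y) = (s', y)" "y \<in> dom (\<alpha> s')" "germ_equiv s' s y" by (rule germ_rep[OF assms(2)])
  have "x \<in> dom (\<alpha> t)" using assms by auto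
  then obtain t' where t': "germ_rep (germ \<alpha> t x) = (t', x)" "x \<in> dom (\<alpha> t')" "germ_equiv t' t x" by (rule germ_rep)
  have y: "\<alpha> t' x = Some y" using act_germ_equiv[OF t'(3)] assms(1) by simp
  have "gmult G (germ \<alpha> s y) (germ \<alpha> t x) = germ \<alpha> (s' * t') x" using s' t' by (simp add: transformation_groupoid_def)
  also have "\<dots> = germ \<alpha> (s * t) x"
    using germ_equiv_mult[OF s'(3) t'(3) y] y s'(2) assms by (subst germ_eq_iff) (auto simp: act_mult)
  finally show ?thesis .
qed

lemma openin_germ_image: "\<lbrakk>openin X U; U \<subseteq> dom (\<alpha> s)\<rbrakk> \<Longrightarrow> openin (gtop G) (germ \<alpha> s ` U)"
  unfolding transformation_groupoid_def tgroupoid.simps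
  by (rule topology_generated_by_Basis) auto

lemma germ_arrow: "x \<in> dom (\<alpha> s) \<Longrightarrow> germ \<alpha> s x \<in> arrows G"
  using openin_subset[OF openin_germ_image[OF openin_dom subset_refl, of s]] by blast

lemma arrows_germ:
  assumes "g \<in> arrows G"
  obtains s x where "x \<in> dom (\<alpha> s)" "g = germ \<alpha> s x"
proof -
  have "g \<in> \<Union>{germ \<alpha> s ` U |s U. openin X U \<and> U \<subseteq> dom (\<alpha> (istar s * s))}"
    using assms unfolding transformation_groupoid_def tgroupoid.simps topology_generated_by_topspace .
  then obtain s U x where "U \<subseteq> dom (\<alpha> s)" "x \<in> U" "g = germ \<alpha> s x" by auto
  then show ?thesis by (intro that[of x s]) auto
qed

text \<open>By induction on the generation of open sets. For a generating set given by t, the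
  idempotent witnessing that s and t have the same germ at x provides a neighbourhood of x on which
  all their germs agree.\<close>

lemma openin_germ:
  assumes "openin (gtop G) W" "germ \<alpha> s x \<in> W" "x \<in> dom (\<alpha> s)"
  shows "\<exists>U. openin X U \<and> x \<in> U \<and> U \<subseteq> dom (\<alpha> s) \<and> germ \<alpha> s ` U \<subseteq> W"
proof -
  have "generate_topology_on {germ \<alpha> s ` U |s U. openin X U \<and> U \<subseteq> dom (\<alpha> (istar s * s))} W"
    using assms(1) unfolding transformation_groupoid_def tgroupoid.simps openin_topology_generated_by_iff .
  then show ?thesis using assms(2)
  proof induction
    case (Int V W)
    then obtain U U' where "openin X U" "x \<in> U" "U \<subseteq> dom (\<alpha> s)" "germ \<alpha> s ` U \<subseteq> V"
      "openin X U'" "x \<in> U'" "germ \<alpha> s ` U' \<subseteq> W" by auto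
    then show ?case by (intro exI[of _ "U \<inter> U'"]) auto
  next
    case (UN K)
    then obtain V where V: "V \<in> K" "germ \<alpha> s x \<in> V" by blast
    then obtain U where "openin X U" "x \<in> U" "U \<subseteq> dom (\<alpha> s)" "germ \<alpha> s ` U \<subseteq> V"
      using UN.IH by blast
    then show ?case using V by blast
  next
    case (Basis W)
    then obtain t U where U: "W = germ \<alpha> t ` U" "openin X U" "U \<subseteq> dom (\<alpha> t)" by auto
    then obtain y where y: "y \<in> U" "germ \<alpha> s x = germ \<alpha> t y" using Basis by auto
    then have xy: "x = y" "germ_equiv s t x" using germ_eq_iff[OF assms(3), of y t] U(3) by auto
    then obtain e where e: "e \<in> idempotents" "x \<in> dom (\<alpha> e)" "s * e = t * e" by (auto simp: germ_equiv_def)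
    let ?V = "U \<inter> dom (\<alpha> e) \<inter> dom (\<alpha> s)"
    have "germ \<alpha> s z = germ \<alpha> t z" if "z \<in> ?V" for z
      using that U(3) e germ_equivI[OF e(1) _ e(3), of z] by (subst germ_eq_iff) auto
    then have "germ \<alpha> s ` ?V \<subseteq> W" using U(1) by auto
    moreover have "openin X ?V" using U(2) openin_dom by blast
    ultimately show ?case using xy y e assms(3) by blast
  qed auto
qed

lemma continuous_map_germ: "continuous_map (subtopology X (dom (\<alpha> s))) (gtop G) (germ \<alpha> s)"
proof -
  have "openin (subtopology X (dom (\<alpha> s))) {x \<in> dom (\<alpha> s). germ \<alpha> s x \<in> W}" if W: "openin (gtop G) W" for W
  proof (subst openin_subopen, intro ballI)
    fix x assume "x \<in> {x \<in> dom (\<alpha> s). germ \<alpha> s x \<in> W}"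
    then obtain U where U: "openin X U" "x \<in> U" "U \<subseteq> dom (\<alpha> s)" "germ \<alpha> s ` U \<subseteq> W"
      using openin_germ[OF W, of s x] by blast
    then have "openin (subtopology X (dom (\<alpha> s))) U" unfolding openin_subtopology by blast
    then show "\<exists>T. openin (subtopology X (dom (\<alpha> s))) T \<and> x \<in> T \<and> T \<subseteq> {x \<in> dom (\<alpha> s). germ \<alpha> s x \<in> W}"
      using U by blast
  qed
  moreover have "topspace X \<inter> dom (\<alpha> s) = dom (\<alpha> s)" using dom_subset by auto
  ultimately show ?thesis by (auto simp: continuous_map_def germ_arrow)
qed

end

section \<open>Open subgroupoids and subsemigroups for a strongly tight action\<close>

locale germ_groupoid = partial_action X \<alpha> + lch_topological_groupoid "transformation_groupoid X \<alpha>"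
  for X :: "'x topology" and \<alpha> :: "'s::inverse_semigroup_0 \<Rightarrow> 'x \<rightharpoonup> 'x" +
  assumes tight: "strongly_tight X \<alpha>"
begin

lemma compact_dom: "e \<in> idempotents \<Longrightarrow> compactin X (dom (\<alpha> e))"
  using tight by (simp add: strongly_tight_def)

lemma dom_basis:
  assumes "openin X U" "x \<in> U"
  obtains e where "e \<in> idempotents" "x \<in> dom (\<alpha> e)" "dom (\<alpha> e) \<subseteq> U"
proof -
  have "topology_basis X ((\<lambda>e. dom (\<alpha> e)) ` idempotents)" using tight by (simp add: strongly_tight_def)
  then obtain V where "V \<in> (\<lambda>e. dom (\<alpha> e)) ` idempotents" "x \<in> V" "V \<subseteq> U"
    using assms unfolding topology_basis_def by metis
  then show ?thesis using that by (elim imageE) simp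
qed

lemma germ_bisection:
  assumes e: "e \<in> idempotents" and s: "dom (\<alpha> e) \<subseteq> dom (\<alpha> s)"
  shows "compact_open_bisection (germ \<alpha> s ` dom (\<alpha> e))"
  unfolding compact_open_bisection_def bisection_def
proof (intro conjI inj_onI)
  show "openin (gtop G) (germ \<alpha> s ` dom (\<alpha> e))" by (rule openin_germ_image[OF openin_dom s])
  have "compactin (subtopology X (dom (\<alpha> s))) (dom (\<alpha> e))"
    using compact_dom[OF e] s by (simp add: compactin_subtopology)
  then show "compactin (gtop G) (germ \<alpha> s ` dom (\<alpha> e))" by (rule image_compactin[OF _ continuous_map_germ])
next
  fix g h assume gh: "g \<in> germ \<alpha> s ` dom (\<alpha> e)" "h \<in> germ \<alpha> s ` dom (\<alpha> e)"
  then obtain x y where xy: "g = germ \<alpha> s x" "h = germ \<alpha> s y" "x \<in> dom (\<alpha> e)" "y \<in> dom (\<alpha> e)" by blast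
  {
    assume "gdom G g = gdom G h"
    moreover have "gdom G g = germ \<alpha> e x" "gdom G h = germ \<alpha> e y" using xy s e gdom_germ by blast+
    ultimately show "g = h" using xy germ_eq_iff by auto
  next
    assume eq: "gran G g = gran G h"
    obtain x' y' where x': "\<alpha> s x = Some x'" "\<alpha> s y = Some y'" using xy s by blast
    have "gran G g = germ \<alpha> (s * istar s) x'" "gran G h = germ \<alpha> (s * istar s) y'"
      unfolding xy using gran_germ[OF _ mult_istar_idempotent dom_mult_istar] x' by blast+
    then have "x' = y'" using eq germ_eq_iff[OF dom_mult_istar dom_mult_istar, OF x'] by simp
    then show "g = h" using act_inj x' xy by metis
  }
qed

text \<open>The compact open sets \<open>dom (\<alpha> e)\<close> form a basis of X, and
  \<open>germ \<alpha> s\<close> carries those inside the domain of s to compact open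
  bisections.\<close>

lemma ample_germs:
  assumes W: "openin (gtop G) W" "g \<in> W"
  shows "\<exists>U. compact_open_bisection U \<and> g \<in> U \<and> U \<subseteq> W"
proof -
  have "g \<in> arrows G" using W openin_subset by blast
  then obtain s x where g: "x \<in> dom (\<alpha> s)" "g = germ \<alpha> s x" by (rule arrows_germ)
  then obtain U where U: "openin X U" "x \<in> U" "U \<subseteq> dom (\<alpha> s)" "germ \<alpha> s ` U \<subseteq> W"
    using openin_germ[OF W(1), of s x] W(2) by auto
  obtain e where e: "e \<in> idempotents" "x \<in> dom (\<alpha> e)" "dom (\<alpha> e) \<subseteq> U" by (rule dom_basis[OF U(1,2)])
  have sub: "dom (\<alpha> e) \<subseteq> dom (\<alpha> s)" "germ \<alpha> s ` dom (\<alpha> e) \<subseteq> W" using e(3) U(3,4) by blast+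
  moreover have "g \<in> germ \<alpha> s ` dom (\<alpha> e)" using g(2) e(2) by (rule image_eqI)
  ultimately show ?thesis using germ_bisection[OF e(1)] by blast
qed

lemma transformation_subgroupoid_iff:
  "g \<in> transformation_subgroupoid \<alpha> T \<longleftrightarrow> (\<exists>t x. t \<in> T \<and> x \<in> dom (\<alpha> t) \<and> g = germ \<alpha> t x)"
  by (auto simp: transformation_subgroupoid_def)

lemma composable_germs:
  assumes "y \<in> dom (\<alpha> s)" "\<alpha> t x = Some z" "gdom G (germ \<alpha> s y) = gran G (germ \<alpha> t x)"
  shows "z = y"
proof -
  have "germ \<alpha> (istar s * s) y = germ \<alpha> (t * istar t) z"
    using assms gdom_germ[OF assms(1) istar_mult_idempotent] gran_germ[OF assms(2) mult_istar_idempotent dom_mult_istar[OF assms(2)]]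
    by simp
  then show ?thesis using germ_eq_iff[OF _ dom_mult_istar[OF assms(2)], of y "istar s * s"] assms(1) by simp
qed

lemma open_subgroupoid_of_wide:
  assumes T: "wide_subsemigroup T"
  shows "open_subgroupoid (transformation_subgroupoid \<alpha> T)"
  unfolding open_subgroupoid_def
proof (intro conjI ballI impI subsetI)
  have "transformation_subgroupoid \<alpha> T = (\<Union>t\<in>T. germ \<alpha> t ` dom (\<alpha> t))"
    by (rule set_eqI, unfold transformation_subgroupoid_iff UN_iff image_iff) blast
  then show "openin (gtop G) (transformation_subgroupoid \<alpha> T)"
    using openin_germ_image[OF openin_dom subset_refl] by auto
next
  fix u assume "u \<in> units G"
  then obtain g where "g \<in> arrows G" "u = gdom G g" unfolding units_def by blast
  then obtain s x where "x \<in> dom (\<alpha> s)" "u = gdom G (germ \<alpha> s x)" using arrows_germ by metis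
  then have "u = germ \<alpha> (istar s * s) x" "x \<in> dom (\<alpha> (istar s * s))"
    using gdom_germ[OF _ istar_mult_idempotent] by auto
  then show "u \<in> transformation_subgroupoid \<alpha> T"
    using T istar_mult_idempotent unfolding transformation_subgroupoid_iff wide_subsemigroup_def by blast
next
  fix g assume "g \<in> transformation_subgroupoid \<alpha> T"
  then obtain t x y where "t \<in> T" "\<alpha> t x = Some y" "g = germ \<alpha> t x" by (auto simp: transformation_subgroupoid_iff)
  moreover have "y \<in> dom (\<alpha> (istar t))" using act_istar calculation(2) by blast
  ultimately show "ginv G g \<in> transformation_subgroupoid \<alpha> T"
    using T ginv_germ unfolding transformation_subgroupoid_iff wide_subsemigroup_def by metis
next
  fix g h assume gh: "g \<in> transformation_subgroupoid \<alpha> T" "h \<in> transformation_subgroupoid \<alpha> T" "gdom G g = gran G h"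
  obtain s y where s: "s \<in> T" "y \<in> dom (\<alpha> s)" "g = germ \<alpha> s y" using gh(1) by (auto simp: transformation_subgroupoid_iff)
  obtain t x z where t: "t \<in> T" "\<alpha> t x = Some z" "h = germ \<alpha> t x" using gh(2) by (auto simp: transformation_subgroupoid_iff)
  have z: "z = y" using composable_germs s t gh(3) by blast
  then have "gmult G g h = germ \<alpha> (s * t) x" using gmult_germ s t by simp
  moreover have "x \<in> dom (\<alpha> (s * t))" using s t z by (auto simp: act_mult)
  moreover have "s * t \<in> T" using T s t by (simp add: wide_subsemigroup_def)
  ultimately show "gmult G g h \<in> transformation_subgroupoid \<alpha> T" unfolding transformation_subgroupoid_iff by blast
qed

definition subsemigroup_of :: "('s \<times> 'x) set set \<Rightarrow> 's set" where
  "subsemigroup_of H = {s. \<forall>x\<in>dom (\<alpha> s). germ \<alpha> s x \<in> H}"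

lemma wide_subsemigroup_of:
  assumes H: "open_subgroupoid H"
  shows "wide_subsemigroup (subsemigroup_of H)"
  unfolding wide_subsemigroup_def
proof (intro conjI ballI subsetI)
  fix s t assume st: "s \<in> subsemigroup_of H" "t \<in> subsemigroup_of H"
  have "germ \<alpha> (s * t) x \<in> H" if "x \<in> dom (\<alpha> (s * t))" for x
  proof -
    have ne: "\<alpha> (s * t) x \<noteq> None" using that by (simp only: domIff not_False_eq_True)
    then obtain y where y1: "\<alpha> t x = Some y" by (cases "\<alpha> t x") (simp_all add: act_mult)
    with ne have "y \<in> dom (\<alpha> s)" by (simp add: act_mult domIff)
    note y = y1 this
    have "germ \<alpha> s y \<in> H" "germ \<alpha> t x \<in> H" using st y by (auto simp: subsemigroup_of_def)
    moreover have "gdom G (germ \<alpha> s y) = gran G (germ \<alpha> t x)"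
      using gdom_germ[OF y(2) istar_mult_idempotent] gran_germ[OF y(1) istar_mult_idempotent] y(2) by simp
    ultimately show ?thesis using H gmult_germ[OF y] unfolding open_subgroupoid_def by metis
  qed
  then show "s * t \<in> subsemigroup_of H" by (simp add: subsemigroup_of_def)
next
  fix s assume s: "s \<in> subsemigroup_of H"
  have "germ \<alpha> (istar s) y \<in> H" if y: "y \<in> dom (\<alpha> (istar s))" for y
  proof -
    obtain x where "\<alpha> (istar s) y = Some x" using domD[OF y] by blast
    then have x: "\<alpha> s x = Some y" using act_istar by fastforce
    then have "germ \<alpha> s x \<in> H" using s by (auto simp: subsemigroup_of_def)
    then show ?thesis using H ginv_germ[OF x] unfolding open_subgroupoid_def by metis
  qed
  then show "istar s \<in> subsemigroup_of H" by (simp add: subsemigroup_of_def)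
next
  fix e :: 's assume e: "e \<in> idempotents"
  have "germ \<alpha> e x \<in> H" if x: "x \<in> dom (\<alpha> e)" for x
  proof -
    have "germ \<alpha> e x = gdom G (germ \<alpha> e x)" using gdom_germ[OF x e x] by simp
    then have "germ \<alpha> e x \<in> units G" unfolding units_def using germ_arrow[OF x] by (rule image_eqI)
    then show ?thesis using H unfolding open_subgroupoid_def by blast
  qed
  then show "e \<in> subsemigroup_of H" by (simp add: subsemigroup_of_def)
qed

lemma germ_mult_idempotent:
  assumes "e \<in> idempotents" "x \<in> dom (\<alpha> e)" "x \<in> dom (\<alpha> s)"
  shows "germ \<alpha> (s * e) x = germ \<alpha> s x"
proof -
  have "germ_equiv (s * e) s x"
    by (rule germ_equivI[OF assms(1,2)]) (use assms(1) in \<open>simp add: mult.assoc idempotent_iff\<close>)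
  then show ?thesis using assms by (subst germ_eq_iff) (auto simp: dom_mult_idempotent)
qed

text \<open>Membership is tested germ by germ, and on the domain of f the elements s and s f have
  the same germs. In the other direction the single idempotent \<open>istar s * s\<close>
  serves.\<close>

lemma join_closed_subsemigroup_of: "join_closed \<alpha> (subsemigroup_of H)"
  unfolding join_closed_def
proof (intro allI iffI)
  fix s assume s: "s \<in> subsemigroup_of H"
  have "s * (istar s * s) = s" using istar(1)[of s] by (simp add: mult.assoc)
  then show "\<exists>F. finite F \<and> F \<subseteq> idempotents \<and> (\<forall>f\<in>F. s * f \<in> subsemigroup_of H) \<and>
      dom (\<alpha> (istar s * s)) \<subseteq> (\<Union>f\<in>F. dom (\<alpha> f))"
    using s istar_mult_idempotent by (intro exI[of _ "{istar s * s}"]) auto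
next
  fix s assume "\<exists>F. finite F \<and> F \<subseteq> idempotents \<and> (\<forall>f\<in>F. s * f \<in> subsemigroup_of H) \<and>
      dom (\<alpha> (istar s * s)) \<subseteq> (\<Union>f\<in>F. dom (\<alpha> f))"
  then obtain F where F: "F \<subseteq> idempotents" "\<And>f. f \<in> F \<Longrightarrow> s * f \<in> subsemigroup_of H"
    "dom (\<alpha> s) \<subseteq> (\<Union>f\<in>F. dom (\<alpha> f))" by auto
  have "germ \<alpha> s x \<in> H" if x: "x \<in> dom (\<alpha> s)" for x
  proof -
    obtain f where f: "f \<in> F" "x \<in> dom (\<alpha> f)" using F(3) x by blast
    then have "x \<in> dom (\<alpha> (s * f))" using dom_mult_idempotent[of f s] F(1) x by blast
    then have "germ \<alpha> (s * f) x \<in> H" using F(2)[OF f(1)] unfolding subsemigroup_of_def by blast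
    then show ?thesis using germ_mult_idempotent F(1) f x by (metis subsetD)
  qed
  then show "s \<in> subsemigroup_of H" by (simp add: subsemigroup_of_def)
qed

text \<open>For an arrow [s,x] of H, the element s may have germs outside H away from x. Since H is
  open and the domains of idempotents form a basis, some \<open>s * e\<close> has all its germs in H
  and the same germ as s at x.\<close>

lemma subgroupoid_subsemigroup_of:
  assumes H: "open_subgroupoid H"
  shows "transformation_subgroupoid \<alpha> (subsemigroup_of H) = H"
proof (intro equalityI subsetI)
  fix g assume "g \<in> transformation_subgroupoid \<alpha> (subsemigroup_of H)"
  then show "g \<in> H" by (auto simp: transformation_subgroupoid_iff subsemigroup_of_def)
next
  fix g assume g: "g \<in> H"
  have Ho: "openin (gtop G) H" using H by (simp add: open_subgroupoid_def)
  then have "g \<in> arrows G" using g openin_subset by blast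
  then obtain s x where s: "x \<in> dom (\<alpha> s)" "g = germ \<alpha> s x" by (rule arrows_germ)
  then obtain U where U: "openin X U" "x \<in> U" "U \<subseteq> dom (\<alpha> s)" "germ \<alpha> s ` U \<subseteq> H"
    using openin_germ[OF Ho, of s x] g by auto
  obtain e where e: "e \<in> idempotents" "x \<in> dom (\<alpha> e)" "dom (\<alpha> e) \<subseteq> U" by (rule dom_basis[OF U(1,2)])
  have "germ \<alpha> (s * e) z \<in> H" if "z \<in> dom (\<alpha> (s * e))" for z
  proof -
    have z: "z \<in> dom (\<alpha> s)" "z \<in> dom (\<alpha> e)" using that dom_mult_idempotent[OF e(1), of s] by blast+
    then have "germ \<alpha> s z \<in> H" using e(3) U(4) by blast
    then show ?thesis using germ_mult_idempotent[OF e(1) z(2,1)] by simp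
  qed
  then have "s * e \<in> subsemigroup_of H" by (simp add: subsemigroup_of_def)
  moreover have "x \<in> dom (\<alpha> (s * e))" using s e by (simp add: dom_mult_idempotent)
  moreover have "g = germ \<alpha> (s * e) x" using germ_mult_idempotent[OF e(1,2) s(1)] s by simp
  ultimately show "g \<in> transformation_subgroupoid \<alpha> (subsemigroup_of H)"
    unfolding transformation_subgroupoid_iff by blast
qed

text \<open>Where a germ of s is a germ of some t in T, an idempotent e satisfies s e = t e, and t e
  is in T because T contains the idempotents. The domains of such e cover the compact domain of s,
  and a finite subcover is what join closedness asks for.\<close>

lemma subsemigroup_of_subgroupoid:
  assumes T: "wide_subsemigroup T" "join_closed \<alpha> T"
  shows "subsemigroup_of (transformation_subgroupoid \<alpha> T) = T"
proof (intro equalityI subsetI)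
  fix s assume "s \<in> T"
  then show "s \<in> subsemigroup_of (transformation_subgroupoid \<alpha> T)"
    by (auto simp: subsemigroup_of_def transformation_subgroupoid_iff)
next
  fix s assume s: "s \<in> subsemigroup_of (transformation_subgroupoid \<alpha> T)"
  let ?\<C> = "(\<lambda>f. dom (\<alpha> f)) ` {f \<in> idempotents. s * f \<in> T}"
  have "dom (\<alpha> s) \<subseteq> \<Union>?\<C>"
  proof
    fix x assume x: "x \<in> dom (\<alpha> s)"
    then have "germ \<alpha> s x \<in> transformation_subgroupoid \<alpha> T" using s by (simp add: subsemigroup_of_def)
    then obtain t y where t: "t \<in> T" "y \<in> dom (\<alpha> t)" "germ \<alpha> s x = germ \<alpha> t y"
      by (auto simp: transformation_subgroupoid_iff)
    then have "germ_equiv s t x" using germ_eq_iff x by blast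
    then obtain e where e: "e \<in> idempotents" "x \<in> dom (\<alpha> e)" "s * e = t * e" by (auto simp: germ_equiv_def)
    then have "s * e \<in> T" using T(1) t(1) by (auto simp: wide_subsemigroup_def)
    then show "x \<in> \<Union>?\<C>" using e by blast
  qed
  moreover have "compactin X (dom (\<alpha> s))"
    using compact_dom[OF istar_mult_idempotent[of s]] by simp
  moreover have "openin X V" if "V \<in> ?\<C>" for V using that openin_dom by (elim imageE) simp
  ultimately have "\<exists>\<F>. finite \<F> \<and> \<F> \<subseteq> ?\<C> \<and> dom (\<alpha> s) \<subseteq> \<Union>\<F>" by (intro compactinD)
  then obtain \<F> where \<F>: "finite \<F>" "\<F> \<subseteq> ?\<C>" "dom (\<alpha> s) \<subseteq> \<Union>\<F>" by blast
  then obtain F where F: "F \<subseteq> {f \<in> idempotents. s * f \<in> T}" "finite F" "\<F> = (\<lambda>f. dom (\<alpha> f)) ` F"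
    using finite_subset_image by meson
  then have "finite F \<and> F \<subseteq> idempotents \<and> (\<forall>f\<in>F. s * f \<in> T) \<and> dom (\<alpha> (istar s * s)) \<subseteq> (\<Union>f\<in>F. dom (\<alpha> f))"
    using \<F>(3) by auto
  then show "s \<in> T" using T(2) unfolding join_closed_def by blast
qed

lemma bij_betw_subsemigroups:
  "bij_betw (transformation_subgroupoid \<alpha>) {T. wide_subsemigroup T \<and> join_closed \<alpha> T} {H. open_subgroupoid H}"
  by (rule bij_betw_byWitness[where f' = subsemigroup_of])
    (auto simp: subsemigroup_of_subgroupoid subgroupoid_subsemigroup_of open_subgroupoid_of_wide
      wide_subsemigroup_of join_closed_subsemigroup_of)

end

section \<open>The Galois correspondence\<close>

theorem corollary5p1p4:
  fixes D :: "'a::cstar_algebra set"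
    and X :: "'x topology"
    and \<alpha> :: "'s::inverse_semigroup_0 \<Rightarrow> 'x \<rightharpoonup> 'x"
    and G :: "('s \<times> 'x) set tgroupoid"
    and \<Sigma> :: "('e, ('s \<times> 'x) set) twist_data"
    and \<iota> :: "('e \<Rightarrow> complex) \<Rightarrow> 'a"
  assumes cartan: "cartan_pair (UNIV :: 'a set) D"
    and separable: "separable_space (euclidean :: 'a topology)"
    and twist: "twist \<Sigma>" "base \<Sigma> = G"
    and second_countable: "second_countable (gtop G)"
    and principal: "topologically_principal G"
    and identification: "reduced_cstar_algebra \<Sigma> UNIV \<iota>" "D = C0_units \<Sigma> \<iota>"
    and X: "locally_compact_space X" "Hausdorff_space X"
    and action: "semigroup_action X \<alpha>" "strongly_tight X \<alpha>"
    and G: "G = transformation_groupoid X \<alpha>"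
  shows "bij_betw (\<lambda>T. reduced_subalgebra \<Sigma> \<iota> (transformation_subgroupoid \<alpha> T))
           {T. wide_subsemigroup T \<and> join_closed \<alpha> T}
           {B. cartan_intermediate (UNIV :: 'a set) D B}"
proof -
  have lch: "lch_groupoid G" "etale G" using twist by (auto simp: twist_def)
  interpret germs: germ_groupoid X \<alpha>
    using lch action unfolding G
    by unfold_locales (auto simp: lch_groupoid_def topological_groupoid_def)
  interpret algebra: cartan_twist \<Sigma> \<iota>
  proof (unfold_locales, unfold twist(2))
    show "is_groupoid G" "lch_groupoid G" "etale G" "topologically_principal G"
      using lch principal by (auto simp: lch_groupoid_def topological_groupoid_def)
    show "twist \<Sigma>" by (rule twist(1))
    show "reduced_cstar_algebra \<Sigma> UNIV \<iota>" by (rule identification(1))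
    show "cartan_pair UNIV (C0_units \<Sigma> \<iota>)" using cartan identification(2) by simp
    fix W g assume "openin (gtop G) W" "g \<in> W"
    then show "\<exists>U. lch_topological_groupoid.compact_open_bisection G U \<and> g \<in> U \<and> U \<subseteq> W"
      using germs.ample_germs unfolding G by blast
  qed
  \<comment> \<open>The two bijections meet in the wide open subgroupoids of G.\<close>
  have "bij_betw (transformation_subgroupoid \<alpha>)
      {T. wide_subsemigroup T \<and> join_closed \<alpha> T} {H. lch_topological_groupoid.open_subgroupoid G H}"
    unfolding G by (rule germs.bij_betw_subsemigroups)
  moreover have "bij_betw (reduced_subalgebra \<Sigma> \<iota>)
      {H. lch_topological_groupoid.open_subgroupoid G H} {B. cartan_intermediate UNIV D B}"
    using algebra.bij_betw_open_subgroupoids unfolding twist(2) identification(2) .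
  ultimately show ?thesis
    using bij_betw_trans unfolding comp_def by blast
qed

end
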